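(* Let $m\in\mathbb{N}$, $a\in\mathbb{R}$, $1<p<\infty$, $0<\tau<p$, and let $\delta$ denote the dimension of the singular set of the domain $D\subset\mathbb{R}^d$. Moreover, let either $$m-a=(d-\delta)\Big(\frac1\tau-\frac1p\Big)\quad\text{and}\quad a<m,$$ or $$m-a>(d-\delta)\Big(\frac1\tau-\frac1p\Big).$$ Then there exists a function $u\in\mathcal{K}^m_{a,p}(D)$ such that $\|\rho^{-m}u|L_\tau(D)\|=\infty$. Consequently, $\mathcal{K}^m_{a,p}(D)\not\hookrightarrow F^{m,\mathrm{rloc}}_{\tau,2}(D)$.
   Context: Domains. $D$ is either $\mathbb{R}^d\setminus S$, where the singular set $S$ is $\mathbb{R}^\ell\equiv\mathbb{R}^\ell\times\{0\}^{d-\ell}$ with $0\le\ell<d$ (so $\delta=\ell$) or the singular set of a polytope, or $D$ is itself a polytope (polygon for $d=2$, polyhedron for $d=3$). The singular set $S$ of a polytope consists of the vertices for $d=2$, of the vertices and edges for $d=3$, and in general of the faces of dimension at most $d-2$ (so $\delta=d-2$). Kondratiev spaces. $\rho:D\to(0,1]$ is the regularized distance to $S$: a $C^\infty$ function on $D$ equivalent to $\min(1,\mathrm{dist}(x,S))$ with $|\partial^\alpha\rho(x)|\le A_\alpha\rho(x)^{1-|\alpha|}$ for all multiindices $\alpha$. $\mathcal{K}^m_{a,p}(D)$ is the space of functions $u$ on $D$ with weak derivatives up to order $m$ in $D$ such that $\|u|\mathcal{K}^m_{a,p}(D)\|^p=\sum_{|\alpha|\le m}\int_D|\rho(x)^{|\alpha|-a}\partial^\alpha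 u(x)|^p\,dx<\infty$. Triebel-Lizorkin spaces. Let $\varphi_0\in\mathcal{S}(\mathbb{R}^d)$ with $\varphi_0(x)=1$ for $|x|\le1$, $\varphi_0(x)=0$ for $|x|\ge\frac32$, $\varphi_1(x)=\varphi_0(x/2)-\varphi_0(x)$ and $\varphi_j(x)=\varphi_1(2^{-j+1}x)$, $j\ge1$. For $s\in\mathbb{R}$, $0<p<\infty$, $0<q\le\infty$, $F^s_{p,q}(\mathbb{R}^d)$ is the set of $f\in\mathcal{S}'(\mathbb{R}^d)$ with $\|f|F^s_{p,q}(\mathbb{R}^d)\|=\big\|\big(\sum_{j\ge0}2^{jsq}|\mathcal{F}^{-1}(\varphi_j\mathcal{F}f)(\cdot)|^q\big)^{1/q}\big|L_p(\mathbb{R}^d)\big\|<\infty$ (supremum if $q=\infty$). Refined localization spaces. Let $D\subset\mathbb{R}^d$ be a domain (non-empty open set). Let $Q_{j,k}=2^{-j}((0,1)^d+k)$, $j\ge0$, $k\in\mathbb{Z}^d$, and let $2Q_{j,k}$ be the concentric cube with side length $2^{-j+1}$. A Whitney decomposition of $D$ is a collection of pairwise disjoint cubes $\{Q_{j,k_l}\}_{j\ge0,\,l=1,\dots,N_j}$ ($N_j$ possibly infinite) with $D=\bigcup_{j\ge 0}\bigcup_{l=1}^{N_j}\overline{Q}_{j,k_l}$, $\mathrm{dist}(2Q_{j,k_l},\partial D)\sim2^{-j}$ for $j\ge1$, and $\mathrm{dist}(2Q_{0,k_l},\partial D)\ge c>0$. Let $\{\varphi_{j,l}\}$ be non-negative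 $C^\infty$ functions with $\mathrm{supp}\,\varphi_{j,l}\subset2Q_{j,k_l}$, $\sum_{j,l}\varphi_{j,l}=1$ on $D$, and $|\partial^\alpha\varphi_{j,l}(x)|\le c_\alpha2^{j|\alpha|}$ for all $\alpha\in\mathbb{N}_0^d$. For $0<p<\infty$, $0<q\le\infty$, $s>\sigma_{p,q}:=d\big(\frac1{\min(1,p,q)}-1\big)$, $F^{s,\mathrm{rloc}}_{p,q}(D)$ is the set of locally integrable $f$ on $D$ with $\|f|F^{s,\mathrm{rloc}}_{p,q}(D)\|=\big(\sum_{j=0}^\infty\sum_{l=1}^{N_j}\|\varphi_{j,l}f|F^s_{p,q}(\mathbb{R}^d)\|^p\big)^{1/p}<\infty$. The space $F^{m,\mathrm{rloc}}_{\tau,2}(D)$ is only defined for $m>\sigma_{\tau,2}=d\big(\frac{1}{\min(1,\tau)}-1\big)$; the final non-embedding assertion has content only in that case (for $m\le\sigma_{\tau,2}$ the embedding is by convention regarded as non-existent). *)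

theory Defs
  imports "HOL-Analysis.Analysis"
begin

text \<open>
  Throughout, the ambient space is \<open>real ^ 'd\<close>, so \<open>d = CARD('d)\<close> is arbitrary.
  Functions on an open set \<open>D\<close> are total functions of which only the values on \<open>D\<close> matter,
  multiindices are functions \<open>'d \<Rightarrow> nat\<close>, and norms take values in \<open>ennreal\<close>.
\<close>

definition partial :: "'d::finite \<Rightarrow> (real ^ 'd \<Rightarrow> 'b::real_normed_vector) \<Rightarrow> real ^ 'd \<Rightarrow> 'b" where
  "partial i f x = vector_derivative (\<lambda>t. f (x + t *\<^sub>R axis i 1)) (at 0)"

text \<open>
  Differentiability of every iterated partial derivative makes all of them continuous, so on
  an open set this is the class of infinitely differentiable functions.
\<close>

definition smooth_on :: "(real ^ 'd::finite) set \<Rightarrow> (real ^ 'd \<Rightarrow> 'b::real_normed_vector) \<Rightarrow> bool" where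
  "smooth_on U f \<longleftrightarrow> (\<forall>is. foldr partial is f differentiable_on U)"

definition multi_order :: "('d::finite \<Rightarrow> nat) \<Rightarrow> nat" where
  "multi_order \<alpha> = (\<Sum>i\<in>UNIV. \<alpha> i)"

text \<open>
  Only applied to smooth functions, for which the order in which the coordinate directions
  are listed is irrelevant.
\<close>

definition multi_deriv ::
    "('d::finite \<Rightarrow> nat) \<Rightarrow> (real ^ 'd \<Rightarrow> 'b::real_normed_vector) \<Rightarrow> real ^ 'd \<Rightarrow> 'b" where
  "multi_deriv \<alpha> f = foldr partial (SOME is. \<forall>i. count_list is i = \<alpha> i) f"

definition support :: "('a::topological_space \<Rightarrow> 'b::zero) \<Rightarrow> 'a set" where
  "support f = closure {x. f x \<noteq> 0}"

text \<open>
  Polytopes need not be convex (a polygon may have reentrant corners): a polytope is the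
  interior of a finite union of convex polytopes.
\<close>

definition polytopal_domain :: "(real ^ 'd::finite) set \<Rightarrow> bool" where
  "polytopal_domain D \<longleftrightarrow>
     D \<noteq> {} \<and> (\<exists>\<P>. finite \<P> \<and> (\<forall>P\<in>\<P>. polytope P) \<and> D = interior (\<Union>\<P>))"

text \<open>
  Near a boundary point \<open>x\<close> a polytope coincides with a cone with apex \<open>x\<close>; \<open>lineality D x\<close> is the
  subspace of the directions in which that cone is translation invariant. Its dimension is \<open>k\<close>
  precisely if \<open>x\<close> is a relative interior point of a \<open>k\<close>-dimensional face, so the
  \<open>k\<close>-dimensional faces are the closures of the connected components of the set of these points.
  For convex polytopes, \<open>singular_set_convex\<close> below compares this with the library's \<open>face_of\<close>.
\<close>

definition lineality :: "(real ^ 'd::finite) set \<Rightarrow> real ^ 'd \<Rightarrow> (real ^ 'd) set" where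
  "lineality D x = {v. \<exists>e>0. \<forall>y\<in>ball x e. \<forall>t. y + t *\<^sub>R v \<in> ball x e \<longrightarrow> (y + t *\<^sub>R v \<in> D \<longleftrightarrow> y \<in> D)}"

definition polytope_faces :: "nat \<Rightarrow> (real ^ 'd::finite) set \<Rightarrow> (real ^ 'd) set set" where
  "polytope_faces k D = closure ` components {x \<in> frontier D. dim (lineality D x) = k}"

definition singular_set :: "(real ^ 'd::finite) set \<Rightarrow> (real ^ 'd) set" where
  "singular_set D = (\<Union>k\<in>{k. k + 2 \<le> CARD('d)}. \<Union>(polytope_faces k D))"

text \<open>
  For a convex polytope, the faces used above are the library's faces: the dimension of the
  lineality space at a point is that of the face having this point in its relative interior.
\<close>

lemma dim_lineality_convex:
  fixes P F :: "(real ^ 'd::finite) set"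
  assumes "polytope P" "interior P \<noteq> {}" "F face_of P" "x \<in> rel_interior F"
  shows "int (dim (lineality (interior P) x)) = aff_dim F"
proof -
  have "convex P" "closed P"
    using assms(1) polytope_imp_convex polytope_imp_closed by blast+
  have clP: "closure (interior P) = P"
    using convex_closure_interior[OF \<open>convex P\<close> assms(2)] \<open>closed P\<close> by simp
  obtain H where H: "finite H" "P = \<Inter>H" "\<forall>h\<in>H. \<exists>a b. a \<noteq> 0 \<and> h = {x. a \<bullet> x \<le> b}"
    using polytope_imp_polyhedron[OF assms(1)] unfolding polyhedron_def by blast
  then obtain a b where ab: "\<And>h. h \<in> H \<Longrightarrow> a h \<noteq> 0 \<and> h = {x. a h \<bullet> x \<le> b h}"
    by metis
  have memP: "y \<in> P \<longleftrightarrow> (\<forall>h\<in>H. a h \<bullet> y \<le> b h)" for y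
    using H(2) ab by blast
  have intP: "interior P = {y. \<forall>h\<in>H. a h \<bullet> y < b h}"
  proof
    have "interior P \<subseteq> interior h" if "h \<in> H" for h
      using H(2) that by (intro interior_mono) blast
    moreover have "interior h = {y. a h \<bullet> y < b h}" if "h \<in> H" for h
      using ab[OF that] interior_halfspace_le by metis
    ultimately show "interior P \<subseteq> {y. \<forall>h\<in>H. a h \<bullet> y < b h}"
      by blast
    have "{y. \<forall>h\<in>H. a h \<bullet> y < b h} = (\<Inter>h\<in>H. {y. a h \<bullet> y < b h})"
      by blast
    moreover have "open (\<Inter>h\<in>H. {y. a h \<bullet> y < b h})"
      using H(1) by (intro open_INT) (auto simp: open_halfspace_lt)
    ultimately show "{y. \<forall>h\<in>H. a h \<bullet> y < b h} \<subseteq> interior P"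
      using memP by (intro interior_maximal) (auto dest!: bspec intro: less_imp_le)
  qed
  have xF: "x \<in> F" and xP: "x \<in> P"
    using assms(3,4) rel_interior_subset face_of_imp_subset by blast+
  let ?V = "(+) (- x) ` (affine hull F)"
  have seg: "\<exists>e>0. \<forall>t. \<bar>t\<bar> < e \<longrightarrow> x + t *\<^sub>R v \<in> F" if v: "v \<in> ?V" for v
  proof -
    obtain z where z: "z \<in> affine hull F" "v = z - x"
      using v by auto
    obtain r where r: "r > 0" "ball x r \<inter> affine hull F \<subseteq> F"
      using assms(4) by (auto simp: mem_rel_interior_ball)
    have "x + t *\<^sub>R v \<in> F" if "\<bar>t\<bar> < r / (norm v + 1)" for t
    proof -
      have "\<bar>t\<bar> * norm v \<le> \<bar>t\<bar> * (norm v + 1)"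
        by (simp add: mult_left_mono)
      also have "\<dots> < r"
        using that by (simp add: pos_less_divide_eq add_nonneg_pos)
      finally have "x + t *\<^sub>R v \<in> ball x r"
        by (simp add: dist_norm)
      moreover have "x + t *\<^sub>R v = (1 - t) *\<^sub>R x + t *\<^sub>R z"
        by (simp add: z algebra_simps)
      then have "x + t *\<^sub>R v \<in> affine hull F"
        using z(1) hull_inc[OF xF] by (simp add: mem_affine affine_affine_hull)
      ultimately show ?thesis
        using r(2) by blast
    qed
    moreover have "r / (norm v + 1) > 0"
      using r(1) by (simp add: add_nonneg_pos)
    ultimately show ?thesis by blast
  qed
  have "lineality (interior P) x = ?V"
  proof (intro set_eqI iffI)
    fix v assume "v \<in> ?V"
    then obtain e where e: "e > 0" "\<And>t. \<bar>t\<bar> < e \<Longrightarrow> x + t *\<^sub>R v \<in> F"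
      using seg by blast
    have inP: "x + t *\<^sub>R v \<in> P" if "\<bar>t\<bar> < e" for t
      using e(2)[OF that] face_of_imp_subset[OF assms(3)] by blast
    have act: "a h \<bullet> v = 0" if "h \<in> H" "a h \<bullet> x = b h" for h
    proof -
      have "x + (e/2) *\<^sub>R v \<in> P" "x + (-(e/2)) *\<^sub>R v \<in> P"
        using e(1) by (intro inP; simp)+
      then have "(e/2) * (a h \<bullet> v) \<le> 0" "-(e/2) * (a h \<bullet> v) \<le> 0"
        using that by (auto simp: memP inner_add_right inner_diff_right dest!: bspec[OF _ \<open>h \<in> H\<close>])
      then show ?thesis
        using e(1) by (simp add: mult_le_0_iff zero_le_mult_iff)
    qed
    have "open (\<Inter>h\<in>{h\<in>H. a h \<bullet> x < b h}. {y. a h \<bullet> y < b h})"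
      using H(1) by (intro open_INT) (auto simp: open_halfspace_lt)
    moreover have "x \<in> (\<Inter>h\<in>{h\<in>H. a h \<bullet> x < b h}. {y. a h \<bullet> y < b h})"
      by blast
    ultimately obtain r where r: "r > 0"
      "ball x r \<subseteq> (\<Inter>h\<in>{h\<in>H. a h \<bullet> x < b h}. {y. a h \<bullet> y < b h})"
      by (meson openE)
    have loc: "y \<in> interior P \<longleftrightarrow> (\<forall>h\<in>H. a h \<bullet> x = b h \<longrightarrow> a h \<bullet> y < b h)" if "y \<in> ball x r" for y
    proof -
      have "a h \<bullet> x < b h \<or> a h \<bullet> x = b h" if "h \<in> H" for h
        using xP memP that by (metis order_le_less)
      moreover have "a h \<bullet> y < b h" if "h \<in> H" "a h \<bullet> x < b h" for h
        using r(2) \<open>y \<in> ball x r\<close> that by blast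
      ultimately show ?thesis
        unfolding intP by blast
    qed
    have "y + t *\<^sub>R v \<in> interior P \<longleftrightarrow> y \<in> interior P"
      if "y \<in> ball x r" "y + t *\<^sub>R v \<in> ball x r" for y t
      using that act by (auto simp: loc inner_add_right)
    then show "v \<in> lineality (interior P) x"
      unfolding lineality_def using r(1) by blast
  next
    fix v assume "v \<in> lineality (interior P) x"
    then obtain e where e: "e > 0"
      "\<And>y t. \<lbrakk>y \<in> ball x e; y + t *\<^sub>R v \<in> ball x e\<rbrakk> \<Longrightarrow> y + t *\<^sub>R v \<in> interior P \<longleftrightarrow> y \<in> interior P"
      unfolding lineality_def by blast
    have inP: "x + t *\<^sub>R v \<in> P" if t: "x + t *\<^sub>R v \<in> ball x e" for t
    proof -
      have "x \<in> closure (interior P)"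
        using clP xP by simp
      then obtain f where f: "\<And>n. f n \<in> interior P" "f \<longlonglongrightarrow> x"
        unfolding closure_sequential by blast
      have lim: "(\<lambda>n. f n + t *\<^sub>R v) \<longlonglongrightarrow> x + t *\<^sub>R v"
        by (intro tendsto_intros f(2))
      have "\<forall>\<^sub>F n in sequentially. f n \<in> ball x e"
        using f(2) e(1) by (intro topological_tendstoD) auto
      moreover have "\<forall>\<^sub>F n in sequentially. f n + t *\<^sub>R v \<in> ball x e"
        using lim t by (intro topological_tendstoD) auto
      ultimately have "\<forall>\<^sub>F n in sequentially. f n + t *\<^sub>R v \<in> P"
        by eventually_elim (use e(2) f(1) interior_subset in blast)
      then show ?thesis
        using Lim_in_closed_set[OF \<open>closed P\<close> _ _ lim] by simp
    qed
    define s where "s = e / (2 * (norm v + 1))"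
    have s: "s > 0" "s * norm v < e"
    proof -
      show "s > 0" using e(1) by (simp add: s_def add_nonneg_pos)
      have "s * norm v \<le> s * (norm v + 1)"
        using \<open>s > 0\<close> by simp
      also have "\<dots> = e / 2"
        unfolding s_def using norm_ge_zero[of v] by (simp add: field_simps del: norm_ge_zero)
      finally show "s * norm v < e" using e(1) by simp
    qed
    have plus: "x + s *\<^sub>R v \<in> P" and minus: "x + (- s) *\<^sub>R v \<in> P"
      using s by (intro inP; simp add: dist_norm)+
    have "x + s *\<^sub>R v \<in> F"
    proof (cases "v = 0")
      case True
      then show ?thesis using xF by simp
    next
      case False
      have mid: "x = midpoint (x + s *\<^sub>R v) (x + (- s) *\<^sub>R v)"
        by (simp add: midpoint_def flip: scaleR_2)
      have "x + s *\<^sub>R v \<noteq> x + (- s) *\<^sub>R v"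
        using False s(1) by (simp only: add_left_cancel scaleR_cancel_right) simp
      then have "midpoint (x + s *\<^sub>R v) (x + (- s) *\<^sub>R v)
          \<in> open_segment (x + s *\<^sub>R v) (x + (- s) *\<^sub>R v)"
        by (simp only: midpoint_in_open_segment) simp
      then have "x \<in> open_segment (x + s *\<^sub>R v) (x + (- s) *\<^sub>R v)"
        unfolding mid[symmetric] .
      then show ?thesis
        using assms(3) plus minus xF unfolding face_of_def by blast
    qed
    then have "x + s *\<^sub>R v \<in> affine hull F"
      by (rule hull_inc)
    moreover have "x + v = (1 - 1 / s) *\<^sub>R x + (1 / s) *\<^sub>R (x + s *\<^sub>R v)"
      using s(1) by (simp add: algebra_simps)
    moreover have "(1 - 1 / s) + 1 / s = 1"
      by simp
    ultimately have "x + v \<in> affine hull F"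
      using mem_affine[OF affine_affine_hull hull_inc[OF xF]] by metis
    moreover have "v = - x + (x + v)" by simp
    ultimately show "v \<in> ?V" by blast
  qed
  moreover have "aff_dim F = int (dim ?V)"
    using aff_dim_eq_dim[of x "affine hull F"] hull_inc[OF xF] hull_inc[of x "affine hull F"]
    by (simp add: aff_dim_affine_hull)
  ultimately show ?thesis by simp
qed

lemma singular_set_convex:
  fixes P :: "(real ^ 'd::finite) set"
  assumes "polytope P" "interior P \<noteq> {}"
  shows "singular_set (interior P) = \<Union>{F. F face_of P \<and> aff_dim F + 2 \<le> int CARD('d)}"
proof -
  let ?st = "\<lambda>k. {x \<in> frontier (interior P). dim (lineality (interior P) x) = k}"
  have "convex P" "closed P" "polyhedron P"
    using assms(1) polytope_imp_convex polytope_imp_closed polytope_imp_polyhedron by blast+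
  have clP: "closure (interior P) = P"
    using convex_closure_interior[OF \<open>convex P\<close> assms(2)] \<open>closed P\<close> by simp
  have frP: "frontier (interior P) = P - interior P"
    by (simp add: frontier_def clP)
  have ex: "\<exists>F. F face_of P \<and> F \<subseteq> G \<and> x \<in> rel_interior F" if G: "G face_of P" "x \<in> G" for G x
  proof -
    define A where "A = {F. F face_of P \<and> F \<subseteq> G \<and> x \<in> F}"
    have "G \<in> A" using G by (simp add: A_def)
    then obtain F where F: "F \<in> A" "\<And>F'. F' \<in> A \<Longrightarrow> nat (aff_dim F) \<le> nat (aff_dim F')"
      using arg_min_natI[of "\<lambda>F. F \<in> A" G] arg_min_nat_le[of "\<lambda>F. F \<in> A" _ "\<lambda>F. nat (aff_dim F)"]
      by metis
    have Fp: "polyhedron F"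
      using F(1) \<open>polyhedron P\<close> face_of_polyhedron_polyhedron unfolding A_def by blast
    have "x \<in> rel_interior F"
    proof (rule ccontr)
      assume "x \<notin> rel_interior F"
      then obtain F' where F': "F' facet_of F" "x \<in> F'"
        using rel_interior_of_polyhedron[OF Fp] F(1) unfolding A_def by blast
      then have "F' face_of F" "aff_dim F' = aff_dim F - 1"
        by (auto simp: facet_of_def)
      moreover have "F' \<in> A"
        using F(1) F'(2) \<open>F' face_of F\<close> face_of_trans face_of_imp_subset
        unfolding A_def by blast
      moreover have "0 \<le> aff_dim F'"
        using F'(2) aff_dim_geq[of F'] aff_dim_empty[of F'] by force
      ultimately show False
        using F(2)[of F'] by simp
    qed
    then show ?thesis
      using F(1) unfolding A_def by blast
  qed
  show ?thesis
  proof (intro subset_antisym subsetI)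
    fix x assume "x \<in> singular_set (interior P)"
    then obtain k C where k: "k + 2 \<le> CARD('d)" and C: "C \<in> components (?st k)" "x \<in> closure C"
      unfolding singular_set_def polytope_faces_def by auto
    let ?U = "\<Union>{F. F face_of P \<and> aff_dim F = int k}"
    have "?st k \<subseteq> ?U"
    proof
      fix y assume y: "y \<in> ?st k"
      then have "y \<in> P" by (simp add: frP)
      then obtain F where "F face_of P" "y \<in> rel_interior F"
        using ex[OF face_of_refl[OF \<open>convex P\<close>]] by blast
      then show "y \<in> ?U"
        using dim_lineality_convex[OF assms, of F y] y rel_interior_subset by auto
    qed
    moreover have "closed ?U"
    proof (rule closed_Union)
      show "finite {F. F face_of P \<and> aff_dim F = int k}"
        using finite_polytope_faces[OF assms(1)] by (rule rev_finite_subset) auto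
      show "\<forall>F\<in>{F. F face_of P \<and> aff_dim F = int k}. closed F"
        using face_of_polytope_polytope[OF assms(1)] polytope_imp_closed by blast
    qed
    ultimately have "closure C \<subseteq> ?U"
      using in_components_subset[OF C(1)] by (intro closure_minimal) auto
    then obtain F where "F face_of P" "aff_dim F = int k" "x \<in> F"
      using C(2) by blast
    moreover have "int k + 2 \<le> int CARD('d)"
      using k by linarith
    ultimately show "x \<in> \<Union>{F. F face_of P \<and> aff_dim F + 2 \<le> int CARD('d)}"
      by auto
  next
    fix x assume "x \<in> \<Union>{F. F face_of P \<and> aff_dim F + 2 \<le> int CARD('d)}"
    then obtain G where G: "G face_of P" "aff_dim G + 2 \<le> int CARD('d)" "x \<in> G" by blast
    then obtain F where F: "F face_of P" "F \<subseteq> G" "x \<in> rel_interior F"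
      using ex by blast
    have dF: "aff_dim F + 2 \<le> int CARD('d)"
      using aff_dim_subset[OF F(2)] G(2) by simp
    have xP: "x \<in> P" using G face_of_imp_subset by blast
    have "x \<notin> interior P"
    proof
      assume "x \<in> interior P"
      moreover have "rel_interior P = interior P"
        using assms(2) rel_interior_nonempty_interior by blast
      ultimately have "F = P"
        using face_of_disjoint_rel_interior[OF F(1)] F(3) rel_interior_subset by blast
      moreover have "aff_dim P = int CARD('d)"
        using aff_dim_nonempty_interior[OF assms(2)] by simp
      ultimately show False using dF by simp
    qed
    then have x: "x \<in> ?st (dim (lineality (interior P) x))"
      using xP by (simp add: frP)
    let ?k = "dim (lineality (interior P) x)"
    let ?C = "connected_component_set (?st ?k) x"
    have "?C \<in> components (?st ?k)" "x \<in> ?C"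
      using x by (auto simp: components_def connected_component_refl)
    moreover have "?k + 2 \<le> CARD('d)"
      using dim_lineality_convex[OF assms F(1,3)] dF by simp
    moreover have "x \<in> closure ?C"
      using \<open>x \<in> ?C\<close> closure_subset by blast
    ultimately show "x \<in> singular_set (interior P)"
      unfolding singular_set_def polytope_faces_def by blast
  qed
qed

text \<open>
  Admissible pairs of a domain \<open>D\<close> and a singular set \<open>S\<close> of dimension \<open>\<delta>\<close>. In the first case
  \<open>I\<close> selects the \<open>\<delta>\<close> coordinates spanning \<open>S\<close> (the index type carries no order, so there are no
  distinguished ``first'' coordinates).
\<close>

definition admissible_domain :: "(real ^ 'd::finite) set \<Rightarrow> (real ^ 'd) set \<Rightarrow> nat \<Rightarrow> bool" where
  "admissible_domain D S \<delta> \<longleftrightarrow>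
     (\<delta> < CARD('d) \<and> (\<exists>I::'d set. card I = \<delta> \<and> S = {x. \<forall>i. i \<notin> I \<longrightarrow> x $ i = 0}) \<and> D = - S) \<or>
     (2 \<le> CARD('d) \<and> \<delta> = CARD('d) - 2 \<and>
       (\<exists>P. polytopal_domain P \<and> S = singular_set P \<and> (D = - S \<or> D = P)))"

definition regularized_distance ::
    "(real ^ 'd::finite) set \<Rightarrow> (real ^ 'd) set \<Rightarrow> (real ^ 'd \<Rightarrow> real) \<Rightarrow> bool" where
  "regularized_distance D S \<rho> \<longleftrightarrow>
     smooth_on D \<rho> \<and>
     (\<forall>x\<in>D. 0 < \<rho> x \<and> \<rho> x \<le> 1) \<and>
     (\<exists>c C. 0 < c \<and> 0 < C \<and>
        (\<forall>x\<in>D. c * min 1 (infdist x S) \<le> \<rho> x \<and> \<rho> x \<le> C * min 1 (infdist x S))) \<and>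
     (\<forall>\<alpha>. \<exists>A. \<forall>x\<in>D. \<bar>multi_deriv \<alpha> \<rho> x\<bar> \<le> A * \<rho> x powr (1 - real (multi_order \<alpha>)))"

definition locally_integrable_on ::
    "(real ^ 'd::finite \<Rightarrow> complex) \<Rightarrow> (real ^ 'd) set \<Rightarrow> bool" (infixr \<open>locally'_integrable'_on\<close> 46) where
  "f locally_integrable_on D \<longleftrightarrow> (\<forall>K. compact K \<and> K \<subseteq> D \<longrightarrow> f absolutely_integrable_on K)"

definition test_function :: "(real ^ 'd::finite) set \<Rightarrow> (real ^ 'd \<Rightarrow> complex) \<Rightarrow> bool" where
  "test_function D \<psi> \<longleftrightarrow> smooth_on UNIV \<psi> \<and> compact (support \<psi>) \<and> support \<psi> \<subseteq> D"

definition has_weak_deriv ::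
    "(real ^ 'd::finite) set \<Rightarrow> ('d \<Rightarrow> nat) \<Rightarrow> (real ^ 'd \<Rightarrow> complex) \<Rightarrow> (real ^ 'd \<Rightarrow> complex) \<Rightarrow> bool" where
  "has_weak_deriv D \<alpha> u v \<longleftrightarrow>
     u locally_integrable_on D \<and> v locally_integrable_on D \<and>
     (\<forall>\<psi>. test_function D \<psi> \<longrightarrow>
        (LINT x:D|lebesgue. u x * multi_deriv \<alpha> \<psi> x) =
          (-1) ^ multi_order \<alpha> * (LINT x:D|lebesgue. v x * \<psi> x))"

definition weak_deriv ::
    "(real ^ 'd::finite) set \<Rightarrow> ('d \<Rightarrow> nat) \<Rightarrow> (real ^ 'd \<Rightarrow> complex) \<Rightarrow> real ^ 'd \<Rightarrow> complex" where
  "weak_deriv D \<alpha> u = (SOME v. has_weak_deriv D \<alpha> u v)"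

text \<open>Powers with a positive real exponent, continued by \<open>\<infinity>\<close> at \<open>\<infinity>\<close>.\<close>

definition epowr :: "ennreal \<Rightarrow> real \<Rightarrow> ennreal" where
  "epowr x r = (if x = \<infinity> then \<infinity> else ennreal (enn2real x powr r))"

definition Lp_norm :: "(real ^ 'd::finite) set \<Rightarrow> real \<Rightarrow> (real ^ 'd \<Rightarrow> ennreal) \<Rightarrow> ennreal" where
  "Lp_norm D p h = epowr (\<integral>\<^sup>+x\<in>D. epowr (h x) p \<partial>lebesgue) (1 / p)"

definition kondratiev_norm ::
    "(real ^ 'd::finite) set \<Rightarrow> (real ^ 'd \<Rightarrow> real) \<Rightarrow> nat \<Rightarrow> real \<Rightarrow> real \<Rightarrow> (real ^ 'd \<Rightarrow> complex) \<Rightarrow> ennreal" where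
  "kondratiev_norm D \<rho> m a p u =
     epowr (\<Sum>\<alpha> | multi_order \<alpha> \<le> m.
        \<integral>\<^sup>+x\<in>D. ennreal (norm (\<rho> x powr (real (multi_order \<alpha>) - a) *\<^sub>R weak_deriv D \<alpha> u x) powr p) \<partial>lebesgue)
       (1 / p)"

definition kondratiev_space ::
    "(real ^ 'd::finite) set \<Rightarrow> (real ^ 'd \<Rightarrow> real) \<Rightarrow> nat \<Rightarrow> real \<Rightarrow> real \<Rightarrow> (real ^ 'd \<Rightarrow> complex) set" where
  "kondratiev_space D \<rho> m a p =
     {u. (\<forall>\<alpha>. multi_order \<alpha> \<le> m \<longrightarrow> (\<exists>v. has_weak_deriv D \<alpha> u v)) \<and> kondratiev_norm D \<rho> m a p u < \<infinity>}"

definition schwartz_seminorm :: "nat \<Rightarrow> (real ^ 'd::finite \<Rightarrow> complex) \<Rightarrow> ennreal" where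
  "schwartz_seminorm N \<psi> =
     (SUP x. ennreal ((1 + norm x) ^ N * (\<Sum>\<alpha> | multi_order \<alpha> \<le> N. norm (multi_deriv \<alpha> \<psi> x))))"

definition schwartz_space :: "(real ^ 'd::finite \<Rightarrow> complex) set" where
  "schwartz_space = {\<psi>. smooth_on UNIV \<psi> \<and> (\<forall>N. schwartz_seminorm N \<psi> < \<infinity>)}"

text \<open>Distributions are functionals of which only the values on \<open>schwartz_space\<close> matter.\<close>

type_synonym 'd distr = "(real ^ 'd \<Rightarrow> complex) \<Rightarrow> complex"

definition tempered :: "'d::finite distr \<Rightarrow> bool" where
  "tempered T \<longleftrightarrow>
     (\<forall>\<phi>\<in>schwartz_space. \<forall>\<psi>\<in>schwartz_space. T (\<lambda>x. \<phi> x + \<psi> x) = T \<phi> + T \<psi>) \<and>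
     (\<forall>c. \<forall>\<psi>\<in>schwartz_space. T (\<lambda>x. c * \<psi> x) = c * T \<psi>) \<and>
     (\<exists>N C. \<forall>\<psi>\<in>schwartz_space. ennreal (norm (T \<psi>)) \<le> ennreal C * schwartz_seminorm N \<psi>)"

definition function_distr :: "(real ^ 'd::finite \<Rightarrow> complex) \<Rightarrow> 'd distr" where
  "function_distr g \<psi> = (LINT x|lebesgue. g x * \<psi> x)"

definition fourier :: "(real ^ 'd::finite \<Rightarrow> complex) \<Rightarrow> real ^ 'd \<Rightarrow> complex" where
  "fourier \<psi> \<xi> =
     of_real ((2 * pi) powr (- real CARD('d) / 2)) * (LINT x|lebesgue. exp (- \<i> * of_real (x \<bullet> \<xi>)) * \<psi> x)"

definition inv_fourier :: "(real ^ 'd::finite \<Rightarrow> complex) \<Rightarrow> real ^ 'd \<Rightarrow> complex" where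
  "inv_fourier \<psi> x =
     of_real ((2 * pi) powr (- real CARD('d) / 2)) * (LINT \<xi>|lebesgue. exp (\<i> * of_real (x \<bullet> \<xi>)) * \<psi> \<xi>)"

definition distr_fourier :: "'d::finite distr \<Rightarrow> 'd distr" where
  "distr_fourier T \<psi> = T (fourier \<psi>)"

definition distr_inv_fourier :: "'d::finite distr \<Rightarrow> 'd distr" where
  "distr_inv_fourier T \<psi> = T (inv_fourier \<psi>)"

definition distr_mult :: "(real ^ 'd::finite \<Rightarrow> complex) \<Rightarrow> 'd distr \<Rightarrow> 'd distr" where
  "distr_mult \<phi> T \<psi> = T (\<lambda>x. \<phi> x * \<psi> x)"

definition lp_generator :: "(real ^ 'd::finite \<Rightarrow> complex) \<Rightarrow> bool" where
  "lp_generator \<phi>0 \<longleftrightarrow>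
     \<phi>0 \<in> schwartz_space \<and>
     (\<forall>x. norm x \<le> 1 \<longrightarrow> \<phi>0 x = 1) \<and> (\<forall>x. 3 / 2 \<le> norm x \<longrightarrow> \<phi>0 x = 0)"

definition dyadic_resolution ::
    "(real ^ 'd::finite \<Rightarrow> complex) \<Rightarrow> nat \<Rightarrow> real ^ 'd \<Rightarrow> complex" where
  "dyadic_resolution \<phi>0 j x =
     (if j = 0 then \<phi>0 x
      else let y = (2 powr (1 - real j)) *\<^sub>R x in \<phi>0 ((1 / 2) *\<^sub>R y) - \<phi>0 y)"

text \<open>
  By the Paley-Wiener-Schwartz theorem \<open>\<F>\<^sup>-\<^sup>1(\<phi>\<^sub>j \<F> T)\<close> is given by a unique continuous function.
\<close>

definition lp_piece ::
    "(real ^ 'd::finite \<Rightarrow> complex) \<Rightarrow> nat \<Rightarrow> 'd distr \<Rightarrow> real ^ 'd \<Rightarrow> complex" where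
  "lp_piece \<phi>0 j T =
     (THE g. continuous_on UNIV g \<and>
        (\<forall>\<psi>\<in>schwartz_space.
           integrable lebesgue (\<lambda>x. g x * \<psi> x) \<and>
           function_distr g \<psi> =
             distr_inv_fourier (distr_mult (dyadic_resolution \<phi>0 j) (distr_fourier T)) \<psi>))"

definition lq_norm :: "ennreal \<Rightarrow> (nat \<Rightarrow> ennreal) \<Rightarrow> ennreal" where
  "lq_norm q b =
     (if q = \<infinity> then SUP j. b j
      else epowr (\<Sum>j. epowr (b j) (enn2real q)) (1 / enn2real q))"

definition tl_norm ::
    "(real ^ 'd::finite \<Rightarrow> complex) \<Rightarrow> real \<Rightarrow> real \<Rightarrow> ennreal \<Rightarrow> 'd distr \<Rightarrow> ennreal" where
  "tl_norm \<phi>0 s p q T =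
     Lp_norm UNIV p (\<lambda>x. lq_norm q (\<lambda>j. ennreal (2 powr (real j * s) * norm (lp_piece \<phi>0 j T x))))"

definition tl_space ::
    "(real ^ 'd::finite \<Rightarrow> complex) \<Rightarrow> real \<Rightarrow> real \<Rightarrow> ennreal \<Rightarrow> 'd distr set" where
  "tl_space \<phi>0 s p q = {T. tempered T \<and> tl_norm \<phi>0 s p q T < \<infinity>}"

definition dyadic_cube :: "nat \<times> (int ^ 'd::finite) \<Rightarrow> (real ^ 'd) set" where
  "dyadic_cube = (\<lambda>(j, k). {x. \<forall>i. of_int (k $ i) / 2 ^ j < x $ i \<and> x $ i < (of_int (k $ i) + 1) / 2 ^ j})"

definition double_cube :: "nat \<times> (int ^ 'd::finite) \<Rightarrow> (real ^ 'd) set" where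
  "double_cube = (\<lambda>(j, k). {x. \<forall>i. \<bar>x $ i - (of_int (k $ i) + 1 / 2) / 2 ^ j\<bar> < 1 / 2 ^ j})"

text \<open>\<open>W\<close> is the set of the index pairs \<open>(j, k)\<close> of the cubes in the decomposition.\<close>

definition whitney_decomposition ::
    "(real ^ 'd::finite) set \<Rightarrow> (nat \<times> (int ^ 'd)) set \<Rightarrow> bool" where
  "whitney_decomposition D W \<longleftrightarrow>
     disjoint_family_on dyadic_cube W \<and>
     D = (\<Union>w\<in>W. closure (dyadic_cube w)) \<and>
     (\<exists>c C. 0 < c \<and> 0 < C \<and> (\<forall>w\<in>W. 1 \<le> fst w \<longrightarrow>
        c / 2 ^ fst w \<le> setdist (double_cube w) (frontier D) \<and>
        setdist (double_cube w) (frontier D) \<le> C / 2 ^ fst w)) \<and>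
     (\<exists>c>0. \<forall>w\<in>W. fst w = 0 \<longrightarrow> c \<le> setdist (double_cube w) (frontier D))"

definition whitney_partition ::
    "(real ^ 'd::finite) set \<Rightarrow> (nat \<times> (int ^ 'd)) set \<Rightarrow> (nat \<times> (int ^ 'd) \<Rightarrow> real ^ 'd \<Rightarrow> real) \<Rightarrow> bool" where
  "whitney_partition D W \<phi> \<longleftrightarrow>
     (\<forall>w\<in>W. smooth_on UNIV (\<phi> w) \<and> (\<forall>x. 0 \<le> \<phi> w x) \<and> support (\<phi> w) \<subseteq> double_cube w) \<and>
     (\<forall>x\<in>D. ((\<lambda>w. \<phi> w x) has_sum 1) W) \<and>
     (\<forall>\<alpha>. \<exists>c. \<forall>w\<in>W. \<forall>x. \<bar>multi_deriv \<alpha> (\<phi> w) x\<bar> \<le> c * 2 ^ (fst w * multi_order \<alpha>))"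

definition localized ::
    "(real ^ 'd::finite) set \<Rightarrow> (real ^ 'd \<Rightarrow> real) \<Rightarrow> (real ^ 'd \<Rightarrow> complex) \<Rightarrow> 'd distr" where
  "localized D \<phi> f = function_distr (\<lambda>x. if x \<in> D then of_real (\<phi> x) * f x else 0)"

definition rloc_norm ::
    "(real ^ 'd::finite \<Rightarrow> complex) \<Rightarrow> (real ^ 'd) set \<Rightarrow> (nat \<times> (int ^ 'd)) set \<Rightarrow>
     (nat \<times> (int ^ 'd) \<Rightarrow> real ^ 'd \<Rightarrow> real) \<Rightarrow> real \<Rightarrow> real \<Rightarrow> ennreal \<Rightarrow> (real ^ 'd \<Rightarrow> complex) \<Rightarrow> ennreal" where
  "rloc_norm \<phi>0 D W \<phi> s p q f =
     epowr (\<Sum>\<^sub>\<infinity>w\<in>W. epowr (tl_norm \<phi>0 s p q (localized D (\<phi> w) f)) p) (1 / p)"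

definition rloc_space ::
    "(real ^ 'd::finite \<Rightarrow> complex) \<Rightarrow> (real ^ 'd) set \<Rightarrow> (nat \<times> (int ^ 'd)) set \<Rightarrow>
     (nat \<times> (int ^ 'd) \<Rightarrow> real ^ 'd \<Rightarrow> real) \<Rightarrow> real \<Rightarrow> real \<Rightarrow> ennreal \<Rightarrow> (real ^ 'd \<Rightarrow> complex) set" where
  "rloc_space \<phi>0 D W \<phi> s p q =
     {f. f locally_integrable_on D \<and>
         (\<forall>w\<in>W. localized D (\<phi> w) f \<in> tl_space \<phi>0 s p q) \<and>
         rloc_norm \<phi>0 D W \<phi> s p q f < \<infinity>}"

definition tl_sigma :: "'d::finite itself \<Rightarrow> real \<Rightarrow> ennreal \<Rightarrow> real" where
  "tl_sigma _ p q = real CARD('d) * (1 / enn2real (min 1 (min (ennreal p) q)) - 1)"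

definition continuously_embedded ::
    "'a set \<Rightarrow> ('a \<Rightarrow> ennreal) \<Rightarrow> 'a set \<Rightarrow> ('a \<Rightarrow> ennreal) \<Rightarrow> bool" where
  "continuously_embedded X nX Y nY \<longleftrightarrow>
     X \<subseteq> Y \<and> (\<exists>C::real. \<forall>u\<in>X. nY u \<le> ennreal C * nX u)"

end

theory Submission
  imports Defs
begin

text \<open>
  The function is a sum of disjoint bumps \<open>c\<^sub>i \<psi> ((x - y) / r\<^sub>i)\<close>, where \<open>\<psi>\<close> is a fixed bump, \<open>r\<^sub>i\<close> runs
  through sparse dyadic scales, and \<open>y\<close> runs through \<open>N\<^sub>i \<ge> \<kappa> r\<^sub>i powr (- \<delta>)\<close> points at distance
  about \<open>r\<^sub>i\<close> from \<open>S\<close>. The \<open>p\<close>-th power of its Kondratiev norm is at most a multiple of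
  \<open>\<Sum>i. N\<^sub>i c\<^sub>i powr p * r\<^sub>i powr (d - a p)\<close>, and the \<open>\<tau>\<close>-th power of the \<open>L\<^sub>\<tau>\<close> norm of \<open>\<rho> powr (- m) u\<close> is
  at least a multiple of \<open>\<Sum>i. N\<^sub>i c\<^sub>i powr \<tau> * r\<^sub>i powr (d - m \<tau>)\<close>. If \<open>c\<^sub>i\<close> makes the \<open>i\<close>-th term of
  the first sum equal to \<open>(i + 1) powr (- p / \<tau>)\<close>, then that of the second sum is at least a
  multiple of \<open>1 / (i + 1)\<close>, because \<open>m - a \<ge> (d - \<delta>) (1 / \<tau> - 1 / p)\<close>.

  The second sum also bounds the refined localization norm from below. The Whitney cubes meeting
  a bump of radius \<open>r\<close> have side length about \<open>r\<close>, so their number is bounded, and none of them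
  meets another bump. Their weights add up to \<open>1\<close> on the bump, so at each frequency the
  Littlewood-Paley pieces of the localized functions add up to the piece of the bump. At a
  frequency of order \<open>1 / r\<close> the latter is a rescaled translate of a single nonzero function.
\<close>

subsection \<open>Calculus of smooth functions\<close>

text \<open>The lower bound has to hold for every \<open>\<tau> > 0\<close>, also where
  \<open>L_\<tau>\<close> has no triangle inequality. Pigeonhole replaces it: at each point one of
  at most \<open>N\<close> pieces has at least \<open>1 / N\<close> of the modulus of their sum.
  Hence the number of cubes per bump must be bounded uniformly, and no cube may serve two bumps, so
  that each localized norm is counted once. The latter is bought by sparseness: the separation
  \<open>M\<close> and the gap \<open>L\<close> between scales are chosen after \<open>C\<close> and
  the Whitney constants. A single frequency suffices, as the norm with \<open>q = 2\<close>
  dominates each entry. Which one is not explicit: \<open>\<phi>0\<close> is arbitrary, and the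
  Fourier transform of the bump is only known to be nonzero at \<open>0\<close>. So the frequency
  lies \<open>J\<close> dyadic steps below that of the bump, where the bump looks like a point mass.
  As to the exponents, \<open>N\<^sub>i\<close> enters the second sum with the positive power
  \<open>1 - \<tau> / p\<close>, so a lower bound for it is enough. The remaining power of
  \<open>r\<^sub>i \<le> 1\<close> has the exponent \<open>\<tau> ((d - \<delta>) (1 / \<tau> - 1 /
  p) - (m - a)) \<le> 0\<close>.\<close>

lemma partial_eq_derivative:
  assumes "(f has_derivative f') (at x)"
  shows "partial i f x = f' (axis i 1)"
proof -
  have 1: "((\<lambda>t::real. x + t *\<^sub>R axis i 1) has_derivative (\<lambda>t. t *\<^sub>R axis i 1)) (at 0)"
    by (auto intro!: derivative_eq_intros)
  have "((\<lambda>t. f (x + t *\<^sub>R axis i 1)) has_derivative (\<lambda>t. f' (t *\<^sub>R axis i 1))) (at 0)"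
    using has_derivative_compose[OF 1, of f f'] assms by simp
  then have "((\<lambda>t. f (x + t *\<^sub>R axis i 1)) has_vector_derivative f' (axis i 1)) (at 0)"
    unfolding has_vector_derivative_def
    using linear_scale[OF has_derivative_linear[OF assms]] by simp
  then show ?thesis
    unfolding partial_def by (rule vector_derivative_at)
qed

lemma partial_cong_open:
  assumes "open U" "x \<in> U" "\<And>y. y \<in> U \<Longrightarrow> f y = g y"
  shows "partial i f x = partial i g x"
proof -
  obtain e where e: "e > 0" "ball x e \<subseteq> U"
    using assms openE by blast
  have "f (x + t *\<^sub>R axis i 1) = g (x + t *\<^sub>R axis i 1)" if "t \<in> ball 0 e" for t :: real
    using that e(2) by (intro assms(3)) (auto simp: dist_norm subset_iff)
  then have "\<forall>\<^sub>F t in nhds 0. f (x + t *\<^sub>R axis i 1) = g (x + t *\<^sub>R axis i 1)"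
    unfolding eventually_nhds using e(1) by (intro exI[of _ "ball 0 e"]) auto
  then show ?thesis
    unfolding partial_def by (intro vector_derivative_cong_eq) (auto simp: eventually_at_filter elim: eventually_mono)
qed

lemma foldr_partial_cong_open:
  assumes "open U" "x \<in> U" "\<And>y. y \<in> U \<Longrightarrow> f y = g y"
  shows "foldr partial is f x = foldr partial is g x"
  using assms(2)
proof (induction "is" arbitrary: x)
  case Nil
  then show ?case using assms(3) by simp
next
  case (Cons i "is")
  then show ?case
    using partial_cong_open[OF assms(1) Cons.prems, of "foldr partial is f" "foldr partial is g"] by simp
qed

lemma smooth_on_differentiable_at:
  assumes "smooth_on U f" "open U" "x \<in> U"
  shows "foldr partial is f differentiable (at x)"
  using assms unfolding smooth_on_def
  by (metis differentiable_on_eq_differentiable_at)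

lemma smooth_on_differentiable:
  assumes "smooth_on U f" "open U" "x \<in> U"
  shows "f differentiable (at x)"
  using smooth_on_differentiable_at[OF assms, of "[]"] by simp

lemma smooth_on_continuous:
  assumes "smooth_on U f"
  shows "continuous_on U (foldr partial is f)"
  using assms unfolding smooth_on_def
  by (intro differentiable_imp_continuous_on) blast

lemma smooth_on_foldr_partial: "smooth_on U f \<Longrightarrow> smooth_on U (foldr partial is f)"
  unfolding smooth_on_def by (metis foldr_append o_apply)

lemma smooth_on_partial: "smooth_on U f \<Longrightarrow> smooth_on U (partial i f)"
  using smooth_on_foldr_partial[of U f "[i]"] by simp

lemma smooth_on_subset: "smooth_on U f \<Longrightarrow> V \<subseteq> U \<Longrightarrow> smooth_on V f"
  unfolding smooth_on_def by (blast intro: differentiable_on_subset)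

lemma differentiable_on_cong_open:
  assumes "open U" "\<And>x. x \<in> U \<Longrightarrow> f x = g x" "f differentiable_on U"
  shows "g differentiable_on U"
  unfolding differentiable_on_eq_differentiable_at[OF assms(1)]
proof
  fix x assume x: "x \<in> U"
  then obtain f' where "(f has_derivative f') (at x)"
    using assms(1,3) by (auto simp: differentiable_on_eq_differentiable_at differentiable_def)
  then have "(g has_derivative f') (at x)"
    using has_derivative_transform_within_open[OF _ assms(1) x, of f f' UNIV g] assms(2) by simp
  then show "g differentiable (at x)"
    by (auto simp: differentiable_def)
qed

lemma smooth_on_cong:
  assumes "open U" "\<And>x. x \<in> U \<Longrightarrow> f x = g x" "smooth_on U f"
  shows "smooth_on U g"
  unfolding smooth_on_def
proof
  fix "is"
  show "foldr partial is g differentiable_on U"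
    by (rule differentiable_on_cong_open[OF assms(1), of "foldr partial is f"])
      (use assms in \<open>auto simp: smooth_on_def intro: foldr_partial_cong_open\<close>)
qed

lemma smooth_on_local:
  assumes "\<And>x. x \<in> U \<Longrightarrow> \<exists>V. open V \<and> x \<in> V \<and> smooth_on V f"
  shows "smooth_on U f"
  unfolding smooth_on_def differentiable_on_def
  using assms smooth_on_differentiable_at differentiable_at_withinI by metis

text \<open>The Leibniz and chain rules express partial derivatives as sums of functions of the same
  kind, whence smoothness by induction on the order of differentiation.\<close>

inductive_set sums_of :: "('a \<Rightarrow> 'b::monoid_add) set \<Rightarrow> ('a \<Rightarrow> 'b) set" for B where
  sums_of_base: "b \<in> B \<Longrightarrow> b \<in> sums_of B"
| sums_of_add: "h \<in> sums_of B \<Longrightarrow> k \<in> sums_of B \<Longrightarrow> (\<lambda>x. h x + k x) \<in> sums_of B"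

lemma partial_add:
  assumes "f differentiable (at x)" "g differentiable (at x)"
  shows "partial i (\<lambda>x. f x + g x) x = partial i f x + partial i g x"
proof -
  obtain f' g' where f: "(f has_derivative f') (at x)" and g: "(g has_derivative g') (at x)"
    using assms by (auto simp: differentiable_def)
  show ?thesis
    using partial_eq_derivative[OF has_derivative_add[OF f g]]
      partial_eq_derivative[OF f] partial_eq_derivative[OF g] by simp
qed

text \<open>Derivatives of products and compositions are sums, so invariance of \<open>B\<close>
  itself under \<open>partial\<close> would be too much to ask. Invariance of its additive closure
  passes from \<open>B\<close> to sums by linearity, and then to all orders by induction. Equality
  on \<open>U\<close> is enough, since partial derivatives on an open set are local.\<close>

lemma smooth_on_sums_of:
  assumes U: "open U"
    and B: "\<And>b. b \<in> B \<Longrightarrow> b differentiable_on U"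
      "\<And>b i. b \<in> B \<Longrightarrow> \<exists>k\<in>sums_of B. \<forall>x\<in>U. partial i b x = k x"
    and h: "h \<in> sums_of B"
  shows "smooth_on U h"
proof -
  have diff: "k differentiable_on U" if "k \<in> sums_of B" for k
    using that by induction (auto intro: B differentiable_on_add)
  have part: "\<exists>l\<in>sums_of B. \<forall>x\<in>U. partial i k x = l x" if "k \<in> sums_of B" for i k
    using that
  proof induction
    case (sums_of_add h k)
    then obtain h' k' where *: "h' \<in> sums_of B" "k' \<in> sums_of B"
      "\<And>x. x \<in> U \<Longrightarrow> partial i h x = h' x" "\<And>x. x \<in> U \<Longrightarrow> partial i k x = k' x"
      by blast
    have "h differentiable (at x)" "k differentiable (at x)" if "x \<in> U" for x
      using diff sums_of_add.hyps that U by (auto simp: differentiable_on_eq_differentiable_at)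
    then show ?case
      using * by (intro bexI[of _ "\<lambda>x. h' x + k' x"]) (auto simp: partial_add intro: sums_of.sums_of_add)
  qed (use B in blast)
  have "\<exists>l\<in>sums_of B. \<forall>x\<in>U. foldr partial is h x = l x" for "is"
  proof (induction "is")
    case (Cons i "is")
    then obtain l where l: "l \<in> sums_of B" "\<And>x. x \<in> U \<Longrightarrow> foldr partial is h x = l x" by blast
    obtain l' where "l' \<in> sums_of B" "\<And>x. x \<in> U \<Longrightarrow> partial i l x = l' x"
      using part[OF l(1)] by blast
    then show ?case
      using partial_cong_open[OF U _ l(2)] by (intro bexI[of _ l']) auto
  qed (use h in auto)
  then show ?thesis
    unfolding smooth_on_def using differentiable_on_cong_open[OF U _ diff] by metis
qed

lemma smooth_on_add:
  assumes "open U" "smooth_on U f" "smooth_on U g"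
  shows "smooth_on U (\<lambda>x. f x + g x)"
  by (rule smooth_on_sums_of[of U "{f. smooth_on U f}"])
    (use assms in \<open>auto intro: sums_of.intros smooth_on_partial
       simp: differentiable_on_eq_differentiable_at smooth_on_differentiable\<close>)

lemma smooth_on_const:
  fixes c :: "'b::real_normed_vector"
  shows "smooth_on U (\<lambda>x::real^'d::finite. c)"
proof -
  have "smooth_on UNIV (\<lambda>x::real^'d. c)"
  proof (rule smooth_on_sums_of[of UNIV "{\<lambda>x. c, \<lambda>x. 0}"])
    fix b :: "real^'d \<Rightarrow> 'b" and i assume "b \<in> {\<lambda>x. c, \<lambda>x. 0}"
    then have "partial i b x = 0" for x
      using partial_eq_derivative[of b "\<lambda>_. 0" x i] by auto
    then show "\<exists>k\<in>sums_of {\<lambda>x. c, \<lambda>x. 0}. \<forall>x\<in>UNIV. partial i b x = k x"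
      by (intro bexI[of _ "\<lambda>x. 0"]) (auto intro: sums_of.intros)
  qed (auto intro: sums_of.intros)
  then show ?thesis by (rule smooth_on_subset) simp
qed

lemma smooth_on_coord: "smooth_on U (\<lambda>x. x $ k)"
proof -
  have "smooth_on UNIV (\<lambda>x::real^'a. x $ k)"
  \<comment> \<open>With all smooth functions adjoined to the base, only the first derivatives of
    the coordinate have to be examined.\<close>
  proof (rule smooth_on_sums_of[of UNIV "insert (\<lambda>x::real^'a. x $ k) {f. smooth_on UNIV f}"])
    fix b :: "real^'a \<Rightarrow> real" and i assume "b \<in> insert (\<lambda>x. x $ k) {f. smooth_on UNIV f}"
    then consider "b = (\<lambda>x. x $ k)" | "smooth_on UNIV b" by blast
    then have "smooth_on UNIV (partial i b)"
    proof cases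
      case 1
      have "partial i b = (\<lambda>x. axis i 1 $ k)"
        unfolding 1 by (intro ext partial_eq_derivative bounded_linear_imp_has_derivative bounded_linear_vec_nth)
      then show ?thesis by (simp add: smooth_on_const)
    qed (rule smooth_on_partial)
    then show "\<exists>l\<in>sums_of (insert (\<lambda>x. x $ k) {f. smooth_on UNIV f}). \<forall>x\<in>UNIV. partial i b x = l x"
      by (auto intro: sums_of.intros)
  qed (auto intro: sums_of.intros bounded_linear_imp_differentiable bounded_linear_vec_nth
      simp: differentiable_on_eq_differentiable_at smooth_on_differentiable)
  then show ?thesis by (rule smooth_on_subset) simp
qed

lemma partial_bounded_linear:
  assumes "bounded_linear L" "f differentiable (at x)"
  shows "partial i (\<lambda>x. L (f x)) x = L (partial i f x)"
proof -
  obtain f' where f: "(f has_derivative f') (at x)"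
    using assms by (auto simp: differentiable_def)
  show ?thesis
    using partial_eq_derivative[OF bounded_linear.has_derivative[OF assms(1) f]]
      partial_eq_derivative[OF f] by simp
qed

lemma smooth_on_bounded_linear:
  assumes "bounded_linear L" "open U" "smooth_on U f"
  shows "smooth_on U (\<lambda>x. L (f x))"
proof (rule smooth_on_sums_of[of U "(\<lambda>f x. L (f x)) ` {f. smooth_on U f}"])
  fix b assume "b \<in> (\<lambda>f x. L (f x)) ` {f. smooth_on U f}"
  then obtain f where f: "b = (\<lambda>x. L (f x))" "smooth_on U f" by blast
  show "b differentiable_on U"
    unfolding differentiable_on_eq_differentiable_at[OF assms(2)]
  proof
    fix x assume "x \<in> U"
    then obtain f' where "(f has_derivative f') (at x)"
      using smooth_on_differentiable[OF f(2) assms(2)] by (auto simp: differentiable_def)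
    from bounded_linear.has_derivative[OF assms(1) this]
    show "b differentiable (at x)"
      unfolding f by (auto simp: differentiable_def)
  qed
  show "\<exists>k\<in>sums_of ((\<lambda>f x. L (f x)) ` {f. smooth_on U f}). \<forall>x\<in>U. partial i b x = k x" for i
    using f assms by (intro bexI[of _ "\<lambda>x. L (partial i f x)"] sums_of_base)
      (auto intro: smooth_on_partial simp: partial_bounded_linear smooth_on_differentiable)
qed (use assms in \<open>auto intro: sums_of.intros\<close>)

lemma partial_mult:
  fixes f g :: "real ^ 'd::finite \<Rightarrow> 'b::real_normed_algebra"
  assumes "f differentiable (at x)" "g differentiable (at x)"
  shows "partial i (\<lambda>x. f x * g x) x = f x * partial i g x + partial i f x * g x"
proof -
  obtain f' g' where f: "(f has_derivative f') (at x)" and g: "(g has_derivative g') (at x)"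
    using assms by (auto simp: differentiable_def)
  show ?thesis
    using partial_eq_derivative[OF has_derivative_mult[OF f g]]
      partial_eq_derivative[OF f] partial_eq_derivative[OF g] by simp
qed

lemma smooth_on_mult:
  fixes f g :: "real ^ 'd::finite \<Rightarrow> 'b::real_normed_algebra"
  assumes "open U" "smooth_on U f" "smooth_on U g"
  shows "smooth_on U (\<lambda>x. f x * g x)"
proof -
  let ?B = "{\<lambda>x. f x * g x |f g :: real ^ 'd \<Rightarrow> 'b. smooth_on U f \<and> smooth_on U g}"
  show ?thesis
  proof (rule smooth_on_sums_of[of U ?B])
    fix b assume "b \<in> ?B"
    then obtain f g where f: "b = (\<lambda>x. f x * g x)" "smooth_on U f" "smooth_on U g" by blast
    show "b differentiable_on U"
      unfolding differentiable_on_eq_differentiable_at[OF assms(1)] f(1)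
    proof
      fix x assume x: "x \<in> U"
      obtain f' g' where "(f has_derivative f') (at x)" "(g has_derivative g') (at x)"
        using smooth_on_differentiable[OF f(2) assms(1) x] smooth_on_differentiable[OF f(3) assms(1) x]
        by (auto simp: differentiable_def)
      from has_derivative_mult[OF this] show "(\<lambda>x. f x * g x) differentiable at x"
        by (auto simp: differentiable_def)
    qed
    show "\<exists>k\<in>sums_of ?B. \<forall>x\<in>U. partial i b x = k x" for i
    proof (intro bexI ballI)
      show "partial i b x = f x * partial i g x + partial i f x * g x" if "x \<in> U" for x
        unfolding f(1)
        by (rule partial_mult[OF smooth_on_differentiable[OF f(2) assms(1) that]
              smooth_on_differentiable[OF f(3) assms(1) that]])
      show "(\<lambda>x. f x * partial i g x + partial i f x * g x) \<in> sums_of ?B"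
        using f(2,3) smooth_on_partial[OF f(2)] smooth_on_partial[OF f(3)]
        by (intro sums_of_add sums_of_base) blast+
    qed
  qed (use assms in \<open>auto intro: sums_of.intros\<close>)
qed

lemma smooth_on_prod:
  fixes f :: "'i \<Rightarrow> real ^ 'd::finite \<Rightarrow> 'b::{real_normed_algebra,comm_ring_1}"
  assumes "open U" "\<And>i. i \<in> I \<Longrightarrow> smooth_on U (f i)"
  shows "smooth_on U (\<lambda>x. \<Prod>i\<in>I. f i x)"
  using assms(2)
  by (induction I rule: infinite_finite_induct) (auto intro: smooth_on_mult smooth_on_const assms(1))

lemma smooth_on_affine:
  fixes f :: "real ^ 'd::finite \<Rightarrow> 'b::real_normed_vector"
  assumes "smooth_on UNIV f"
  shows "smooth_on UNIV (\<lambda>x. f (s *\<^sub>R (x - y)))"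
    and "foldr partial is (\<lambda>x. f (s *\<^sub>R (x - y))) x = s ^ length is *\<^sub>R foldr partial is f (s *\<^sub>R (x - y))"
proof -
  have der: "((\<lambda>x. c *\<^sub>R g (s *\<^sub>R (x - y))) has_derivative (\<lambda>h. c *\<^sub>R g' (s *\<^sub>R h))) (at x)"
    if "(g has_derivative g') (at (s *\<^sub>R (x - y)))" for g :: "real ^ 'd \<Rightarrow> 'b" and g' x c
  proof -
    have "((\<lambda>x. s *\<^sub>R (x - y)) has_derivative (\<lambda>h. s *\<^sub>R h)) (at x)"
      by (auto intro!: derivative_eq_intros)
    from has_derivative_compose[OF this that] show ?thesis
      by (intro has_derivative_scaleR_right)
  qed
  have eq: "foldr partial is (\<lambda>x. f (s *\<^sub>R (x - y))) = (\<lambda>x. s ^ length is *\<^sub>R foldr partial is f (s *\<^sub>R (x - y)))" for "is"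
  proof (induction "is")
    case (Cons i "is")
    show ?case
    proof
      fix x
      obtain g' where g': "(foldr partial is f has_derivative g') (at (s *\<^sub>R (x - y)))"
        using smooth_on_differentiable_at[OF assms] by (auto simp: differentiable_def)
      have "bounded_linear g'" using g' by (rule has_derivative_bounded_linear)
      then have lin: "g' (s *\<^sub>R h) = s *\<^sub>R g' h" for h
        by (simp add: bounded_linear.linear linear_scale)
      show "foldr partial (i # is) (\<lambda>x. f (s *\<^sub>R (x - y))) x =
          s ^ length (i # is) *\<^sub>R foldr partial (i # is) f (s *\<^sub>R (x - y))"
        using partial_eq_derivative[OF der[OF g', of "s ^ length is"], of i] partial_eq_derivative[OF g', of i]
        by (simp add: Cons lin)
    qed
  qed simp
  then show "foldr partial is (\<lambda>x. f (s *\<^sub>R (x - y))) x = s ^ length is *\<^sub>R foldr partial is f (s *\<^sub>R (x - y))"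
    by simp
  show "smooth_on UNIV (\<lambda>x. f (s *\<^sub>R (x - y)))"
    unfolding smooth_on_def eq
  proof (intro allI)
    fix "is"
    show "(\<lambda>x. s ^ length is *\<^sub>R foldr partial is f (s *\<^sub>R (x - y))) differentiable_on UNIV"
      unfolding differentiable_on_def
    proof
      fix x
      obtain g' where "(foldr partial is f has_derivative g') (at (s *\<^sub>R (x - y)))"
        using smooth_on_differentiable_at[OF assms] by (auto simp: differentiable_def)
      from der[OF this] show "(\<lambda>x. s ^ length is *\<^sub>R foldr partial is f (s *\<^sub>R (x - y))) differentiable (at x)"
        by (auto simp: differentiable_def)
    qed
  qed
qed

subsection \<open>Bump functions\<close>

text \<open>For \<open>k = 0\<close> this is the classical flat function
  \<open>exp (- (1 / t))\<close>. The powers of \<open>t\<close> are included because its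
  derivatives are linear combinations of such functions, so the family is closed under
  differentiation up to linear combinations.\<close>

definition flat :: "nat \<Rightarrow> real \<Rightarrow> real" where
  "flat k t = (if 0 < t then exp (- (1 / t)) / t ^ k else 0)"

lemma flat_tendsto_0: "((\<lambda>t. exp (- (1 / t)) / t ^ k) \<longlongrightarrow> 0) (at_right (0::real))"
proof -
  have "((\<lambda>x::real. x ^ k / exp x) \<longlongrightarrow> 0) at_top"
    by (rule tendsto_power_div_exp_0)
  from filterlim_compose[OF this filterlim_inverse_at_top_right]
  have "((\<lambda>t::real. inverse t ^ k / exp (inverse t)) \<longlongrightarrow> 0) (at_right 0)" .
  moreover have "inverse t ^ k / exp (inverse t) = exp (- (1 / t)) / t ^ k" for t :: real
    by (simp add: exp_minus field_simps)
  ultimately show ?thesis by simp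
qed

lemma flat_has_derivative:
  "(flat k has_real_derivative flat (k + 2) t - real k * flat (k + 1) t) (at t)"
proof -
  consider "t > 0" | "t < 0" | "t = 0" by linarith
  then show ?thesis
  proof cases
    case 1
    have "((\<lambda>t. inverse t ^ k) has_real_derivative real k * (- (inverse t ^ 2) * inverse t ^ (k - 1))) (at t)"
      using 1 DERIV_power[OF DERIV_inverse[of t], of k] by (simp add: power2_eq_square numeral_2_eq_2)
    moreover have "real k * (- (inverse t ^ 2) * inverse t ^ (k - 1)) = - real k * inverse t ^ (k + 1)"
      by (cases k) (simp_all add: power2_eq_square algebra_simps)
    ultimately have D1: "((\<lambda>t. inverse t ^ k) has_real_derivative - real k * inverse t ^ (k + 1)) (at t)"
      by (simp only:)
    have D2: "((\<lambda>t. exp (- (1 / t))) has_real_derivative exp (- (1 / t)) * inverse t ^ 2) (at t)"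
      using 1 by (auto intro!: derivative_eq_intros simp: field_simps power2_eq_square)
    have "((\<lambda>t. exp (- (1 / t)) * inverse t ^ k) has_real_derivative
        exp (- (1 / t)) / t ^ (k + 2) - real k * (exp (- (1 / t)) / t ^ (k + 1))) (at t)"
      using DERIV_mult'[OF D2 D1]
      by (simp add: divide_inverse power_inverse power_add algebra_simps power2_eq_square)
    then have "((\<lambda>t. exp (- (1 / t)) / t ^ k) has_real_derivative
        exp (- (1 / t)) / t ^ (k + 2) - real k * (exp (- (1 / t)) / t ^ (k + 1))) (at t)"
      by (simp add: divide_inverse power_inverse)
    then have "(flat k has_real_derivative
        exp (- (1 / t)) / t ^ (k + 2) - real k * (exp (- (1 / t)) / t ^ (k + 1))) (at t)"
      by (rule has_field_derivative_transform_within_open[of _ _ _ "{0<..}"]) (use 1 in \<open>auto simp: flat_def\<close>)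
    then show ?thesis using 1 by (simp add: flat_def)
  next
    case 2
    have "((\<lambda>_. 0) has_real_derivative 0) (at t)" by simp
    then have "(flat k has_real_derivative 0) (at t)"
      by (rule has_field_derivative_transform_within_open[of _ _ _ "{..<0}"]) (use 2 in \<open>auto simp: flat_def\<close>)
    then show ?thesis using 2 by (simp add: flat_def)
  next
    case 3
    \<comment> \<open>For \<open>h > 0\<close> the difference quotient at \<open>0\<close> is the
      expression in \<open>flat_tendsto_0\<close> with exponent \<open>Suc k\<close>; for
      \<open>h < 0\<close> it vanishes.\<close>
    have "((\<lambda>h. flat k h / h) \<longlongrightarrow> 0) (at_right 0)"
      by (rule Lim_transform_eventually[OF flat_tendsto_0[of "Suc k"]])
        (auto simp: eventually_at_filter flat_def)
    moreover have "((\<lambda>h. flat k h / h) \<longlongrightarrow> 0) (at_left 0)"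
      by (rule Lim_transform_eventually[OF tendsto_const])
        (auto simp: eventually_at_filter flat_def)
    ultimately have "((\<lambda>h. flat k h / h) \<longlongrightarrow> 0) (at 0)"
      by (rule filterlim_split_at[rotated])
    then show ?thesis
      using 3 by (simp add: DERIV_def flat_def)
  qed
qed

lemma flat_nonneg: "0 \<le> flat k t"
  by (simp add: flat_def)

text \<open>Differentiating \<open>g x * flat k (q x)\<close> produces terms of the same shape with
  exponents \<open>k\<close>, \<open>k + 1\<close> and \<open>k + 2\<close>. The base therefore runs
  over all smooth factors and all exponents.\<close>

lemma smooth_on_flat:
  assumes U: "open U" and q: "smooth_on U q"
  shows "smooth_on U (\<lambda>x. flat k (q x))"
proof -
  let ?B = "{\<lambda>x. g x * flat k (q x) |g k. smooth_on U g}"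
  have der: "((\<lambda>x. flat k (q x)) has_derivative (\<lambda>h. q' h * (flat (k + 2) (q x) - real k * flat (k + 1) (q x)))) (at x)"
    if "(q has_derivative q') (at x)" for q' x k
    using has_derivative_compose[OF that flat_has_derivative[of k "q x", unfolded has_field_derivative_def]]
    by (simp add: mult.commute)
  have diff: "(\<lambda>x. flat k (q x)) differentiable (at x)" if "x \<in> U" for x k
    using smooth_on_differentiable[OF q U that] der by (metis differentiable_def)
  have part: "partial i (\<lambda>x. flat k (q x)) x = partial i q x * (flat (k + 2) (q x) - real k * flat (k + 1) (q x))"
    if x: "x \<in> U" for i x k
  proof -
    obtain q' where q': "(q has_derivative q') (at x)"
      using smooth_on_differentiable[OF q U x] by (auto simp: differentiable_def)
    show ?thesis
      using partial_eq_derivative[OF der[OF q']] partial_eq_derivative[OF q'] by simp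
  qed
  have base: "(\<lambda>x. g x * flat k (q x)) \<in> sums_of ?B" if "smooth_on U g" for g k
    by (rule sums_of_base, intro CollectI exI[of _ g] exI[of _ k] conjI that refl)
  have "(\<lambda>x. 1 * flat k (q x)) \<in> sums_of ?B"
    by (rule base) (rule smooth_on_const)
  moreover have "smooth_on U h" if "h \<in> sums_of ?B" for h
  proof (rule smooth_on_sums_of[OF U _ _ that])
    fix b assume "b \<in> ?B"
    then obtain g k where g: "b = (\<lambda>x. g x * flat k (q x))" "smooth_on U g" by blast
    show "b differentiable_on U"
      unfolding differentiable_on_eq_differentiable_at[OF U] g(1)
      by (intro ballI differentiable_mult smooth_on_differentiable[OF g(2) U] diff)
    show "\<exists>k\<in>sums_of ?B. \<forall>x\<in>U. partial i b x = k x" for i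
    proof (intro bexI ballI)
      show "partial i b x = (g x * partial i q x) * flat (k + 2) (q x) +
         ((- real k * (g x * partial i q x)) * flat (k + 1) (q x) + partial i g x * flat k (q x))" if "x \<in> U" for x
        unfolding g partial_mult[OF smooth_on_differentiable[OF g(2) U that] diff[OF that]] part[OF that]
        by (simp add: algebra_simps)
      have "smooth_on U (\<lambda>x. g x * partial i q x)" "smooth_on U (\<lambda>x. - real k * (g x * partial i q x))"
        "smooth_on U (partial i g)"
        by (intro smooth_on_mult smooth_on_const smooth_on_partial U g q)+
      then show "(\<lambda>x. (g x * partial i q x) * flat (k + 2) (q x) +
         ((- real k * (g x * partial i q x)) * flat (k + 1) (q x) + partial i g x * flat k (q x))) \<in> sums_of ?B"
        by (intro sums_of_add base)
    qed
  qed
  ultimately show ?thesis by simp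
qed

text \<open>In each coordinate the quadratic is positive precisely between \<open>a\<close> and
  \<open>b\<close>, provided \<open>a \<le> b\<close> there. The factor \<open>n\<close> sharpens
  the bump: as it grows, the bump tends to the indicator of the open box from below, as the
  fundamental lemma requires.\<close>

definition box_bump :: "real \<Rightarrow> real ^ 'd::finite \<Rightarrow> real ^ 'd \<Rightarrow> real ^ 'd \<Rightarrow> real" where
  "box_bump n a b x = (\<Prod>k\<in>UNIV. flat 0 (n * ((x $ k - a $ k) * (b $ k - x $ k))))"

lemma smooth_on_box_bump: "smooth_on UNIV (box_bump n a b)"
proof -
  have "smooth_on UNIV (\<lambda>x::real^'a. n * ((x $ k + - a $ k) * (b $ k + (- 1) * x $ k)))" for k
    by (intro smooth_on_mult smooth_on_add smooth_on_const smooth_on_coord) auto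
  then show ?thesis
    unfolding box_bump_def by (intro smooth_on_prod smooth_on_flat) auto
qed

lemma box_bump_nonneg: "0 \<le> box_bump n a b x"
  unfolding box_bump_def by (intro prod_nonneg) (simp add: flat_nonneg)

lemma box_bump_le_1: "box_bump n a b x \<le> 1"
  unfolding box_bump_def by (intro prod_le_1) (auto simp: flat_def)

text \<open>The second hypothesis excludes inverted boxes: if \<open>b $ k < a $ k\<close>, the
  quadratic is positive between \<open>b $ k\<close> and \<open>a $ k\<close>, where both of its
  factors are negative.\<close>

lemma box_bump_pos_iff:
  assumes "n > 0" "x \<in> box a b \<or> (\<forall>k. a $ k \<le> b $ k)"
  shows "0 < box_bump n a b x \<longleftrightarrow> x \<in> box a b"
proof -
  have 1: "0 < flat 0 (n * ((x $ k - a $ k) * (b $ k - x $ k))) \<longleftrightarrow> a $ k < x $ k \<and> x $ k < b $ k" for k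
    using assms unfolding flat_def mem_box_cart
    by (smt (verit) div_by_1 exp_gt_zero mult_pos_pos power_0 zero_less_mult_iff)
  show ?thesis
  proof
    assume "0 < box_bump n a b x"
    then have "flat 0 (n * ((x $ k - a $ k) * (b $ k - x $ k))) \<noteq> 0" for k
      unfolding box_bump_def using prod_zero[of UNIV] by (metis (mono_tags, lifting) UNIV_I finite less_irrefl)
    then show "x \<in> box a b"
      using 1 flat_nonneg unfolding mem_box_cart by (metis order_le_less)
  qed (auto simp: box_bump_def mem_box_cart 1 intro!: prod_pos)
qed

lemma box_bump_tendsto:
  assumes "x \<in> box a b"
  shows "(\<lambda>n. box_bump (real n) a b x) \<longlonglongrightarrow> 1"
proof -
  have "(\<lambda>n. flat 0 (real n * ((x $ k - a $ k) * (b $ k - x $ k)))) \<longlonglongrightarrow> 1" for k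
  proof -
    define t where "t = (x $ k - a $ k) * (b $ k - x $ k)"
    have t: "t > 0" using assms by (simp add: mem_box_cart t_def)
    have "(\<lambda>n. exp (- (inverse (real n) * inverse t))) \<longlonglongrightarrow> exp (- (0 * inverse t))"
      by (intro tendsto_intros lim_inverse_n)
    then have "(\<lambda>n. exp (- (inverse (real n) * inverse t))) \<longlonglongrightarrow> 1" by simp
    then show ?thesis
      unfolding t_def[symmetric]
    proof (rule Lim_transform_eventually)
      show "\<forall>\<^sub>F n in sequentially. exp (- (inverse (real n) * inverse t)) = flat 0 (real n * t)"
        using eventually_gt_at_top[of 0]
        by eventually_elim (use t in \<open>auto simp: flat_def field_simps\<close>)
    qed
  qed
  then have "(\<lambda>n. box_bump (real n) a b x) \<longlonglongrightarrow> (\<Prod>k\<in>(UNIV::'a set). 1)"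
    unfolding box_bump_def by (intro tendsto_prod) auto
  then show ?thesis by simp
qed

lemma support_box_bump:
  assumes "n > 0" "\<And>k. a $ k \<le> b $ k"
  shows "support (box_bump n a b) \<subseteq> cbox a b"
proof -
  have "x \<in> box a b" if "box_bump n a b x \<noteq> 0" for x
    using that box_bump_pos_iff[of n x a b] box_bump_nonneg[of n a b x] assms by force
  then show ?thesis
    unfolding support_def using box_subset_cbox[of a b] by (intro closure_minimal) (auto simp del: box_subset_cbox)
qed

subsection \<open>Integration by parts\<close>

lemma support_subset: "{x. f x \<noteq> 0} \<subseteq> support f"
  unfolding support_def by (rule closure_subset)

lemma partial_eq_0_outside_support:
  assumes "x \<notin> support f"
  shows "partial i f x = 0"
proof -
  have "partial i f x = partial i (\<lambda>_. 0) x"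
    by (rule partial_cong_open[of "- support f"])
      (use assms support_subset[of f] in \<open>auto simp: support_def\<close>)
  also have "\<dots> = 0"
    using partial_eq_derivative[of "\<lambda>_. 0" "\<lambda>_. 0" x i] by simp
  finally show ?thesis .
qed

lemma support_partial: "support (partial i f) \<subseteq> support f"
proof -
  have "{x. partial i f x \<noteq> 0} \<subseteq> support f"
    using partial_eq_0_outside_support by blast
  then show ?thesis
    unfolding support_def[of "partial i f"] by (rule closure_minimal) (simp add: support_def)
qed

lemma support_foldr_partial: "support (foldr partial is f) \<subseteq> support f"
  by (induction "is") (use support_partial in force)+

lemma test_function_foldr_partial:
  assumes "test_function D \<psi>"
  shows "test_function D (foldr partial is \<psi>)"
proof -
  have "compact (support (foldr partial is \<psi>))"
    using assms compact_Int_closed[of "support \<psi>" "support (foldr partial is \<psi>)"]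
      support_foldr_partial[of "is" \<psi>]
    by (simp add: test_function_def Int_absorb1 support_def)
  then show ?thesis
    using assms support_foldr_partial[of "is" \<psi>] smooth_on_foldr_partial
    unfolding test_function_def by blast
qed

lemma integrable_lborel_continuous_compact_support:
  fixes f :: "'a::euclidean_space \<Rightarrow> 'b::{banach, second_countable_topology}"
  assumes "continuous_on UNIV f" "compact K" "\<And>x. x \<notin> K \<Longrightarrow> f x = 0"
  shows "integrable lborel f"
proof -
  have "integrable lborel (\<lambda>x. indicator K x *\<^sub>R f x)"
    using assms by (intro borel_integrable_compact) (auto intro: continuous_on_subset)
  also have "(\<lambda>x. indicator K x *\<^sub>R f x) = f"
    using assms(3) by (auto simp: indicator_def)
  finally show ?thesis .
qed

lemma bounded_continuous_compact_support:
  fixes f :: "'a::topological_space \<Rightarrow> 'b::real_normed_vector"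
  assumes "continuous_on UNIV f" "compact K" "\<And>x. x \<notin> K \<Longrightarrow> f x = 0"
  obtains B where "B > 0" "\<And>x. norm (f x) \<le> B"
proof -
  have "compact (f ` K)"
    using assms by (intro compact_continuous_image) (auto intro: continuous_on_subset)
  then obtain B where "\<And>y. y \<in> f ` K \<Longrightarrow> norm y \<le> B"
    using compact_imp_bounded bounded_iff by metis
  then have "norm (f x) \<le> max B 1" for x
    using assms(3)[of x] by (cases "x \<in> K") (auto simp: le_max_iff_disj)
  then show ?thesis by (intro that[of "max B 1"]) auto
qed

lemma absolutely_integrable_on_compact:
  fixes f :: "'a::euclidean_space \<Rightarrow> 'b::{euclidean_space}"
  assumes "compact K" "continuous_on K f"
  shows "f absolutely_integrable_on K"
proof -
  have "integrable lborel (\<lambda>x. indicator K x *\<^sub>R f x)"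
    by (rule borel_integrable_compact[OF assms])
  then show ?thesis
    unfolding set_integrable_def using integrable_completion borel_measurable_integrable by blast
qed

lemma continuous_on_locally_integrable: "continuous_on D f \<Longrightarrow> f locally_integrable_on D"
  unfolding locally_integrable_on_def
  by (auto intro: absolutely_integrable_on_compact continuous_on_subset)

lemma has_vector_derivative_partial:
  assumes "f differentiable (at (x + s *\<^sub>R axis i 1))"
  shows "((\<lambda>s. f (x + s *\<^sub>R axis i 1)) has_vector_derivative partial i f (x + s *\<^sub>R axis i 1)) (at s)"
proof -
  obtain f' where f': "(f has_derivative f') (at (x + s *\<^sub>R axis i 1))"
    using assms by (auto simp: differentiable_def)
  have 1: "((\<lambda>t::real. x + t *\<^sub>R axis i 1) has_derivative (\<lambda>t. t *\<^sub>R axis i 1)) (at s)"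
    by (auto intro!: derivative_eq_intros)
  show ?thesis
    using has_derivative_compose[OF 1 f'] linear_scale[OF has_derivative_linear[OF f']]
    by (simp add: has_vector_derivative_def partial_eq_derivative[OF f'])
qed

text \<open>Translation invariance makes the integral of every difference quotient of
  \<open>f\<close> vanish, and dominated convergence passes to the derivative.\<close>

lemma integral_partial_eq_0:
  fixes f :: "real ^ 'd::finite \<Rightarrow> complex"
  assumes f: "\<And>x. f differentiable (at x)" and c: "continuous_on UNIV (partial i f)"
    and K: "compact K" "\<And>x. x \<notin> K \<Longrightarrow> f x = 0" "\<And>x. x \<notin> K \<Longrightarrow> partial i f x = 0"
  shows "(LINT x|lborel. partial i f x) = 0"
proof -
  let ?e = "axis i 1 :: real ^ 'd"
  \<comment> \<open>Dominated convergence is about sequences, and steps of length at most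
    \<open>1\<close> keep all quotients supported in one compact set.\<close>
  define h where "h n = inverse (real (Suc n))" for n
  have h: "0 < h n" "h n \<le> 1" for n
    by (auto simp: h_def inverse_le_1_iff)
  have h0: "h \<longlonglongrightarrow> 0"
    unfolding h_def by (rule LIMSEQ_inverse_real_of_nat)
  define q where "q n x = (f (x + h n *\<^sub>R ?e) - f x) /\<^sub>R h n" for n x
  obtain B where B: "B > 0" "\<And>x. norm (partial i f x) \<le> B"
    using bounded_continuous_compact_support[OF c K(1,3)] by blast
  have cf: "continuous_on UNIV f"
    using f by (simp add: continuous_on_eq_continuous_within differentiable_imp_continuous_within)
  have fi: "integrable lborel f"
    by (rule integrable_lborel_continuous_compact_support[OF cf K(1,2)])
  have [measurable]: "f \<in> borel_measurable borel" "partial i f \<in> borel_measurable borel"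
    using cf c by (auto intro: borel_measurable_continuous_onI)
  have distr: "integrable lborel (\<lambda>x. f (x + v))" "(LINT x|lborel. f (x + v)) = (LINT x|lborel. f x)" for v
  proof -
    have "integrable (distr lborel borel ((+) v)) f"
      using fi by (simp add: lborel_distr_plus)
    then show "integrable lborel (\<lambda>x. f (x + v))"
      by (subst (asm) integrable_distr_eq) (auto simp: add.commute)
    have "(LINT x|lborel. f (v + x)) = (LINT x|distr lborel borel ((+) v). f x)"
      by (subst integral_distr) auto
    then show "(LINT x|lborel. f (x + v)) = (LINT x|lborel. f x)"
      by (simp add: lborel_distr_plus add.commute)
  qed
  have q0: "(LINT x|lborel. q n x) = 0" for n
    unfolding q_def using distr fi by (simp add: integral_diff)
  have lim: "(\<lambda>n. q n x) \<longlonglongrightarrow> partial i f x" for x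
  proof -
    have "((\<lambda>s. f (x + s *\<^sub>R ?e)) has_vector_derivative partial i f (x + 0 *\<^sub>R ?e)) (at 0)"
      by (rule has_vector_derivative_partial) (rule f)
    then have "((\<lambda>y. (f (x + y *\<^sub>R ?e) - f x - y *\<^sub>R partial i f x) /\<^sub>R norm y) \<longlongrightarrow> 0) (at 0)"
      by (simp add: has_vector_derivative_def has_derivative_def)
    moreover have "filterlim h (at 0) sequentially"
      using h0 less_imp_neq[OF h(1)] by (auto simp: filterlim_at)
    ultimately have "(\<lambda>n. (f (x + h n *\<^sub>R ?e) - f x - h n *\<^sub>R partial i f x) /\<^sub>R norm (h n)) \<longlonglongrightarrow> 0"
      by (rule filterlim_compose)
    moreover have "(f (x + h n *\<^sub>R ?e) - f x - h n *\<^sub>R partial i f x) /\<^sub>R norm (h n) = q n x - partial i f x" for n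
      using h(1)[of n] by (simp add: q_def scaleR_diff_right)
    ultimately show ?thesis
      by (simp add: LIM_zero_iff)
  qed
  \<comment> \<open>The points from which a step of length at most \<open>1\<close> in the direction
    \<open>?e\<close> can land in \<open>K\<close>.\<close>
  define K' where "K' = (\<lambda>(x, t). x - t *\<^sub>R ?e) ` (K \<times> {0..1})"
  have "compact K'"
    unfolding K'_def by (intro compact_continuous_image compact_Times K(1) continuous_intros)
      (auto simp: case_prod_beta intro!: continuous_intros)
  have bound: "norm (q n x) \<le> indicator (K \<union> K') x * B" for n x
  proof (cases "x \<in> K \<union> K'")
    case False
    have "x + h n *\<^sub>R ?e \<notin> K"
    proof
      assume "x + h n *\<^sub>R ?e \<in> K"
      then have "(x + h n *\<^sub>R ?e) - h n *\<^sub>R ?e \<in> K'"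
        unfolding K'_def using h[of n] by (intro image_eqI[of _ _ "(x + h n *\<^sub>R ?e, h n)"]) auto
      with False show False by simp
    qed
    with False show ?thesis by (simp add: q_def K)
  next
    case True
    have "norm (f (x + h n *\<^sub>R ?e) - f (x + 0 *\<^sub>R ?e)) \<le> B * norm (h n - 0)"
    proof (rule differentiable_bound[of UNIV])
      show "((\<lambda>s. f (x + s *\<^sub>R ?e)) has_derivative (\<lambda>h. h *\<^sub>R partial i f (x + s *\<^sub>R ?e))) (at s within UNIV)" for s
        using has_vector_derivative_partial[OF f] by (simp add: has_vector_derivative_def)
      show "onorm (\<lambda>h. h *\<^sub>R partial i f (x + s *\<^sub>R ?e)) \<le> B" for s
        using mult_right_mono[OF B(2)[of "x + s *\<^sub>R ?e"] abs_ge_zero]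
        by (intro onorm_le) (simp add: mult.commute)
    qed auto
    then have "norm (f (x + h n *\<^sub>R ?e) - f x) / h n \<le> B"
      using h(1)[of n] by (simp add: pos_divide_le_eq)
    moreover have "norm (q n x) = norm (f (x + h n *\<^sub>R ?e) - f x) / h n"
      using h(1)[of n] by (simp add: q_def divide_inverse mult.commute)
    ultimately show ?thesis using True by simp
  qed
  have "(\<lambda>n. LINT x|lborel. q n x) \<longlonglongrightarrow> (LINT x|lborel. partial i f x)"
  proof (rule integral_dominated_convergence)
    have "emeasure lborel (K \<union> K') < \<infinity>"
      using K(1) \<open>compact K'\<close> by (intro emeasure_compact_finite compact_Un)
    then show "integrable lborel (\<lambda>x. indicator (K \<union> K') x * B)"
      using K(1) \<open>compact K'\<close> by (intro integrable_mult_left integrable_real_indicator)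
        (auto simp: borel_closed compact_imp_closed)
    show "q n \<in> borel_measurable lborel" for n
      unfolding q_def by measurable
  qed (use lim bound in auto)
  then show ?thesis
    unfolding q0 using LIMSEQ_unique[of "\<lambda>n. 0" _ 0] by simp
qed

text \<open>The open sets \<open>D\<close> and \<open>- support \<psi>\<close> cover the space. On
  the first the function is a product of smooth functions, on the second it is zero. Nothing is
  assumed about \<open>u\<close> outside \<open>D\<close>.\<close>

lemma smooth_on_extend_by_zero:
  fixes u \<psi> :: "real ^ 'd::finite \<Rightarrow> 'b::real_normed_algebra"
  assumes "open D" "smooth_on D u" "smooth_on UNIV \<psi>" "support \<psi> \<subseteq> D"
  shows "smooth_on UNIV (\<lambda>x. if x \<in> D then u x * \<psi> x else 0)"
proof (rule smooth_on_local)
  let ?f = "\<lambda>x. if x \<in> D then u x * \<psi> x else 0"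
  fix x
  show "\<exists>V. open V \<and> x \<in> V \<and> smooth_on V ?f"
  proof (cases "x \<in> D")
    case True
    have "smooth_on D (\<lambda>x. u x * \<psi> x)"
      by (rule smooth_on_mult[OF assms(1,2) smooth_on_subset[OF assms(3) subset_UNIV]])
    then have "smooth_on D ?f"
      by (rule smooth_on_cong[OF assms(1), of "\<lambda>x. u x * \<psi> x" ?f, rotated]) simp
    then show ?thesis using True assms(1) by blast
  next
    case False
    have "\<psi> y = 0" if "y \<notin> support \<psi>" for y
      using support_subset[of \<psi>] that by blast
    then have "?f y = 0" if "y \<in> - support \<psi>" for y
      using that by simp
    moreover have "open (- support \<psi>)"
      by (simp add: support_def open_Compl)
    ultimately have "smooth_on (- support \<psi>) ?f"
      using smooth_on_cong[OF _ _ smooth_on_const[of "- support \<psi>" 0], of ?f] by simp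
    then show ?thesis
      using False assms(4) by (intro exI[of _ "- support \<psi>"]) (auto simp: support_def)
  qed
qed

lemma set_integral_continuous_compact_support:
  fixes f :: "real ^ 'd::finite \<Rightarrow> complex"
  assumes "open D" "continuous_on UNIV f" "\<And>x. x \<notin> D \<Longrightarrow> f x = 0" "\<And>x. x \<in> D \<Longrightarrow> g x = f x"
  shows "(LINT x:D|lebesgue. g x) = (LINT x|lborel. f x)"
proof -
  have "(LINT x:D|lebesgue. g x) = (LINT x|lebesgue. f x)"
    unfolding set_lebesgue_integral_def
    by (rule Bochner_Integration.integral_cong) (auto simp: assms(3,4) indicator_def)
  also have "\<dots> = (LINT x|lborel. f x)"
    using borel_measurable_continuous_onI[OF assms(2)] by (intro integral_completion) simp
  finally show ?thesis .
qed

text \<open>The product \<open>u x * \<psi> x\<close>, extended by zero, is smooth with compact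
  support, so its partial derivative integrates to zero. The product rule splits this
  integral.\<close>

lemma integration_by_parts:
  fixes u \<psi> :: "real ^ 'd::finite \<Rightarrow> complex"
  assumes D: "open D" and u: "smooth_on D u" and \<psi>: "test_function D \<psi>"
  shows "(LINT x:D|lebesgue. u x * partial i \<psi> x) = - (LINT x:D|lebesgue. partial i u x * \<psi> x)"
proof -
  have s: "smooth_on UNIV \<psi>" "compact (support \<psi>)" "support \<psi> \<subseteq> D"
    using \<psi> by (auto simp: test_function_def)
  have s': "smooth_on UNIV (partial i \<psi>)" "support (partial i \<psi>) \<subseteq> D"
    using s smooth_on_partial support_partial by blast+
  define f f1 f2 where "f = (\<lambda>x. if x \<in> D then u x * \<psi> x else 0)"
    and "f1 = (\<lambda>x. if x \<in> D then u x * partial i \<psi> x else 0)"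
    and "f2 = (\<lambda>x. if x \<in> D then partial i u x * \<psi> x else 0)"
  have sm: "smooth_on UNIV f" "smooth_on UNIV f1" "smooth_on UNIV f2"
    unfolding f_def f1_def f2_def
    by (intro smooth_on_extend_by_zero D u s s' smooth_on_partial)+
  have c: "continuous_on UNIV f" "continuous_on UNIV (partial i f)" "continuous_on UNIV f1" "continuous_on UNIV f2"
    using smooth_on_continuous[OF sm(1), of "[]"] smooth_on_continuous[OF sm(1), of "[i]"]
      smooth_on_continuous[OF sm(2), of "[]"] smooth_on_continuous[OF sm(3), of "[]"] by auto
  have z: "f x = 0" "f1 x = 0" "f2 x = 0" if "x \<notin> support \<psi>" for x
    using that support_subset[of \<psi>] support_subset[of "partial i \<psi>"] support_partial[of i \<psi>]
    by (auto simp: f_def f1_def f2_def)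
  have eq: "partial i f x = f1 x + f2 x" for x
  proof (cases "x \<in> D")
    case True
    have "partial i f x = partial i (\<lambda>x. u x * \<psi> x) x"
      by (rule partial_cong_open[OF D True]) (simp add: f_def)
    also have "\<dots> = u x * partial i \<psi> x + partial i u x * \<psi> x"
      by (intro partial_mult smooth_on_differentiable[OF u D True] smooth_on_differentiable[OF s(1)]) auto
    finally show ?thesis using True by (simp add: f1_def f2_def)
  next
    case False
    then have "x \<notin> support \<psi>" using s(3) by blast
    moreover have "support f \<subseteq> support \<psi>"
      unfolding support_def[of f] using z(1) by (intro closure_minimal) (auto simp: support_def)
    ultimately show ?thesis
      using z partial_eq_0_outside_support[of x f i] by (auto simp: subset_iff)
  qed
  have "0 = (LINT x|lborel. partial i f x)"
    by (rule integral_partial_eq_0[symmetric, OF _ c(2) s(2)])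
      (use sm(1) z eq in \<open>auto intro: smooth_on_differentiable\<close>)
  also have "\<dots> = (LINT x|lborel. f1 x) + (LINT x|lborel. f2 x)"
    unfolding eq by (intro Bochner_Integration.integral_add
        integrable_lborel_continuous_compact_support[OF _ s(2)] c z)
  also have "(LINT x|lborel. f1 x) = (LINT x:D|lebesgue. u x * partial i \<psi> x)"
    by (rule set_integral_continuous_compact_support[symmetric, OF D c(3)]) (auto simp: f1_def)
  also have "(LINT x|lborel. f2 x) = (LINT x:D|lebesgue. partial i u x * \<psi> x)"
    by (rule set_integral_continuous_compact_support[symmetric, OF D c(4)]) (auto simp: f2_def)
  finally show ?thesis by (simp add: eq_neg_iff_add_eq_0)
qed

text \<open>The derivative that was applied to \<open>\<psi>\<close> last is the first to be moved
  to \<open>u\<close>, which reverses the list.\<close>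

lemma integration_by_parts_iterated:
  fixes u \<psi> :: "real ^ 'd::finite \<Rightarrow> complex"
  assumes D: "open D" and u: "smooth_on D u" and \<psi>: "test_function D \<psi>"
  shows "(LINT x:D|lebesgue. u x * foldr partial is \<psi> x) =
    (-1) ^ length is * (LINT x:D|lebesgue. foldr partial (rev is) u x * \<psi> x)"
  using u
proof (induction "is" arbitrary: u)
  case (Cons i "is")
  have "(LINT x:D|lebesgue. u x * foldr partial (i # is) \<psi> x) = - (LINT x:D|lebesgue. partial i u x * foldr partial is \<psi> x)"
    using integration_by_parts[OF D Cons.prems test_function_foldr_partial[OF \<psi>], of i "is"] by simp
  then show ?case
    using Cons.IH[OF smooth_on_partial[OF Cons.prems], of i] by simp
qed simp

subsection \<open>Weak derivatives of smooth functions\<close>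

lemma ex_count_list: "\<exists>is. \<forall>i. count_list is i = (\<alpha> :: 'd::finite \<Rightarrow> nat) i"
proof -
  have "\<exists>is. \<forall>i. count_list is i = (if i \<in> A then \<alpha> i else 0)" if "finite A" for A
    using that
  proof induction
    case (insert j A)
    then obtain "is" where "\<forall>i. count_list is i = (if i \<in> A then \<alpha> i else 0)" by blast
    moreover have "count_list (replicate n j) i = (if i = j then n else 0)" for n i
      by (induction n) auto
    ultimately show ?case
      using insert.hyps by (intro exI[of _ "replicate (\<alpha> j) j @ is"]) auto
  next
    case empty
    show ?case by (rule exI[of _ "[]"]) simp
  qed
  from this[of UNIV] show ?thesis by simp
qed

definition multi_list :: "('d::finite \<Rightarrow> nat) \<Rightarrow> 'd list" where
  "multi_list \<alpha> = (SOME is. \<forall>i. count_list is i = \<alpha> i)"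

lemma length_multi_list: "length (multi_list \<alpha>) = multi_order \<alpha>"
proof -
  have "\<forall>i. count_list (multi_list \<alpha>) i = \<alpha> i"
    unfolding multi_list_def by (rule someI_ex) (rule ex_count_list)
  moreover have "length (multi_list \<alpha>) = (\<Sum>i\<in>UNIV. count_list (multi_list \<alpha>) i)"
    by (rule sum_count_set[symmetric]) auto
  ultimately show ?thesis by (simp add: multi_order_def)
qed

lemma multi_deriv_eq: "multi_deriv \<alpha> f = foldr partial (multi_list \<alpha>) f"
  by (simp add: multi_deriv_def multi_list_def)

text \<open>The derivatives are taken in the order opposite to that in \<^const>\<open>multi_deriv\<close>; this makes
  the symmetry of second derivatives unnecessary.\<close>

lemma has_weak_deriv_smooth:
  assumes "open D" "smooth_on D u"
  shows "has_weak_deriv D \<alpha> u (foldr partial (rev (multi_list \<alpha>)) u)"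
proof -
  have "continuous_on D u" "continuous_on D (foldr partial (rev (multi_list \<alpha>)) u)"
    using smooth_on_continuous[OF assms(2), of "[]"]
      smooth_on_continuous[OF assms(2), of "rev (multi_list \<alpha>)"] by auto
  then show ?thesis
    unfolding has_weak_deriv_def multi_deriv_eq
    using integration_by_parts_iterated[OF assms, of _ "multi_list \<alpha>"]
    by (simp add: length_multi_list continuous_on_locally_integrable)
qed

lemma test_function_box_bump:
  assumes "n > 0" "\<And>k. a $ k \<le> b $ k" "cbox a b \<subseteq> D"
  shows "test_function D (\<lambda>x. complex_of_real (box_bump n a b x))"
proof -
  have *: "support (\<lambda>x. complex_of_real (box_bump n a b x)) = support (box_bump n a b)"
    by (simp add: support_def)
  have "compact (support (box_bump n a b))"
    using compact_Int_closed[of "cbox a b" "support (box_bump n a b)"] support_box_bump[of n a b] assms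
    by (simp add: Int_absorb1 support_def)
  then show ?thesis
    unfolding test_function_def * using support_box_bump[of n a b] assms
    by (auto intro: smooth_on_bounded_linear[OF bounded_linear_of_real] smooth_on_box_bump)
qed

text \<open>On the support of \<open>\<psi>\<close>, a compact subset of \<open>D\<close>, the
  function \<open>h\<close> is integrable and \<open>\<psi>\<close> is bounded.\<close>

lemma locally_integrable_mult_test:
  assumes D: "open D" and h: "h locally_integrable_on D" and \<psi>: "test_function D \<psi>"
  shows "integrable lebesgue (\<lambda>x. indicator D x *\<^sub>R (h x * \<psi> x))"
proof -
  have s: "smooth_on UNIV \<psi>" "compact (support \<psi>)" "support \<psi> \<subseteq> D"
    using \<psi> by (auto simp: test_function_def)
  have c: "continuous_on UNIV \<psi>"
    using smooth_on_continuous[OF s(1), of "[]"] by simp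
  have z: "\<psi> x = 0" if "x \<notin> support \<psi>" for x
    using that support_subset[of \<psi>] by blast
  obtain B where B: "\<And>x. norm (\<psi> x) \<le> B"
    using bounded_continuous_compact_support[OF c s(2) z] by blast
  have hi: "integrable lebesgue (\<lambda>x. indicator (support \<psi>) x *\<^sub>R h x)"
    using h s by (simp add: locally_integrable_on_def set_integrable_def)
  have "integrable lebesgue (\<lambda>x. (indicator (support \<psi>) x *\<^sub>R h x) * \<psi> x)"
  proof (rule Bochner_Integration.integrable_bound)
    show "integrable lebesgue (\<lambda>x. B *\<^sub>R (indicator (support \<psi>) x *\<^sub>R h x))"
      using hi by (rule integrable_scaleR_right)
    show "(\<lambda>x. (indicator (support \<psi>) x *\<^sub>R h x) * \<psi> x) \<in> borel_measurable lebesgue"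
      using hi borel_measurable_continuous_onI[OF c]
      by (intro borel_measurable_times) (auto simp: measurable_completion)
    show "AE x in lebesgue. norm ((indicator (support \<psi>) x *\<^sub>R h x) * \<psi> x) \<le> norm (B *\<^sub>R (indicator (support \<psi>) x *\<^sub>R h x))"
      using order_trans[OF B abs_ge_self] by (intro AE_I2) (auto simp: norm_mult mult.commute indicator_def intro!: mult_right_mono)
  qed
  also have "(\<lambda>x. (indicator (support \<psi>) x *\<^sub>R h x) * \<psi> x) = (\<lambda>x. indicator D x *\<^sub>R (h x * \<psi> x))"
  proof
    show "(indicator (support \<psi>) x *\<^sub>R h x) * \<psi> x = indicator D x *\<^sub>R (h x * \<psi> x)" for x
      using z s(3) by (cases "x \<in> support \<psi>") (simp_all add: subset_iff)
  qed
  finally show ?thesis .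
qed

text \<open>The fundamental lemma of the calculus of variations: the hypothesis passes to indicators of
  boxes by dominated convergence, and then to all measurable sets.\<close>

lemma AE_eq_0_if_test_integrals_0:
  fixes h :: "real ^ 'd::finite \<Rightarrow> complex"
  assumes D: "open D" and h: "h locally_integrable_on D"
    and test: "\<And>\<psi>. test_function D \<psi> \<Longrightarrow> (LINT x:D|lebesgue. h x * \<psi> x) = 0"
  shows "AE x in lebesgue. x \<in> D \<longrightarrow> h x = 0"
proof -
  have box0: "(LINT x|lebesgue. indicator (box a b) x *\<^sub>R h x) = 0" if ab: "cbox a b \<subseteq> D" for a b
  proof (cases "\<forall>k. a $ k \<le> b $ k")
    case False
    then obtain k where "b $ k < a $ k" by (auto simp: not_le)
    then have "x \<notin> box a b" for x
      unfolding mem_box_cart by (metis less_trans less_asym)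
    then show ?thesis by simp
  next
    case True
    let ?g = "\<lambda>n x. indicator D x *\<^sub>R (h x * complex_of_real (box_bump (real (Suc n)) a b x))"
    have tf: "test_function D (\<lambda>x. complex_of_real (box_bump (real (Suc n)) a b x))" for n
      using True ab by (intro test_function_box_bump) auto
    have hi: "integrable lebesgue (\<lambda>x. indicator (cbox a b) x *\<^sub>R h x)"
      using h ab by (simp add: locally_integrable_on_def set_integrable_def)
    have z: "box_bump (real (Suc n)) a b x = 0" if "x \<notin> box a b" for n x
      using box_bump_pos_iff[of "real (Suc n)" x a b] box_bump_nonneg[of "real (Suc n)" a b x] True that by force
    have "(\<lambda>n. LINT x|lebesgue. ?g n x) \<longlonglongrightarrow> (LINT x|lebesgue. indicator (box a b) x *\<^sub>R h x)"
    proof (rule integral_dominated_convergence[where w = "\<lambda>x. norm (indicator (cbox a b) x *\<^sub>R h x)"])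
      have "(\<lambda>x. indicator (box a b) x *\<^sub>R (indicator (cbox a b) x *\<^sub>R h x)) \<in> borel_measurable lebesgue"
        using borel_measurable_integrable[OF hi] by (rule borel_measurable_scaleR[rotated]) (rule borel_measurable_indicator, simp)
      also have "(\<lambda>x. indicator (box a b) x *\<^sub>R (indicator (cbox a b) x *\<^sub>R h x)) = (\<lambda>x. indicator (box a b) x *\<^sub>R h x)"
      proof
        show "indicator (box a b) x *\<^sub>R (indicator (cbox a b) x *\<^sub>R h x) = indicator (box a b) x *\<^sub>R h x" for x
          using box_subset_cbox[of a b] by (cases "x \<in> box a b") (simp_all add: subset_iff)
      qed
      finally show "(\<lambda>x. indicator (box a b) x *\<^sub>R h x) \<in> borel_measurable lebesgue" .
      show "?g n \<in> borel_measurable lebesgue" for n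
        using locally_integrable_mult_test[OF D h tf] by simp
      show "AE x in lebesgue. (\<lambda>n. ?g n x) \<longlonglongrightarrow> indicator (box a b) x *\<^sub>R h x"
      proof (intro AE_I2)
        fix x
        show "(\<lambda>n. ?g n x) \<longlonglongrightarrow> indicator (box a b) x *\<^sub>R h x"
        proof (cases "x \<in> box a b")
          case True
          have "(\<lambda>n. h x * complex_of_real (box_bump (real (Suc n)) a b x)) \<longlonglongrightarrow> h x * complex_of_real 1"
            using LIMSEQ_Suc[OF box_bump_tendsto[OF True]] by (intro tendsto_intros)
          moreover have "x \<in> D" using True ab box_subset_cbox by blast
          ultimately show ?thesis using True by simp
        next
          case False
          show ?thesis by (simp only: z[OF False] indicator_simps(2)[OF False]) simp
        qed
      qed
      show "AE x in lebesgue. norm (?g n x) \<le> norm (indicator (cbox a b) x *\<^sub>R h x)" for n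
      proof (intro AE_I2)
        fix x
        show "norm (?g n x) \<le> norm (indicator (cbox a b) x *\<^sub>R h x)"
          using z[of x n] box_bump_le_1[of "real (Suc n)" a b x] box_bump_nonneg[of "real (Suc n)" a b x] box_subset_cbox[of a b]
          by (cases "x \<in> box a b") (auto simp: norm_mult indicator_def mult_left_le)
      qed
    qed (rule integrable_norm[OF hi])
    moreover have "(LINT x|lebesgue. ?g n x) = 0" for n
      using test[OF tf] by (simp add: set_lebesgue_integral_def)
    ultimately show ?thesis
      using LIMSEQ_unique[of "\<lambda>n. 0" _ 0] by simp
  qed
  have AE_box: "AE x in lebesgue. x \<in> cbox c d \<longrightarrow> h x = 0" if cd: "cbox c d \<subseteq> D" for c d
  proof -
    \<comment> \<open>Cut off to one box, \<open>h\<close> becomes integrable on the whole space,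
      and the integrals of \<open>f\<close> over boxes are integrals of \<open>h\<close> over boxes
      with closure inside \<open>D\<close>.\<close>
    define f where "f x = indicator (box c d) x *\<^sub>R h x" for x
    have "integrable lebesgue (\<lambda>x. indicator (box c d) x *\<^sub>R (indicator (cbox c d) x *\<^sub>R h x))"
    proof (rule integrable_mult_indicator)
      show "integrable lebesgue (\<lambda>x. indicator (cbox c d) x *\<^sub>R h x)"
        using h cd by (simp add: locally_integrable_on_def set_integrable_def)
    qed simp
    also have "(\<lambda>x. indicator (box c d) x *\<^sub>R (indicator (cbox c d) x *\<^sub>R h x)) = f"
    proof
      show "indicator (box c d) x *\<^sub>R (indicator (cbox c d) x *\<^sub>R h x) = f x" for x
        using box_subset_cbox[of c d] by (cases "x \<in> box c d") (simp_all add: subset_iff f_def)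
    qed
    finally have fi: "integrable lebesgue f" .
    have fi': "integrable lebesgue (\<lambda>x. indicator A x *\<^sub>R f x)" if "A \<in> sets lebesgue" for A
      using that fi by (rule integrable_mult_indicator)
    have b: "(LINT x|lebesgue. indicator (box a b) x *\<^sub>R f x) = 0" for a b
    proof -
      obtain a' b' where ab': "box a b \<inter> box c d = box a' b'"
        using box_Int_box by blast
      have "(LINT x|lebesgue. indicator (box a b) x *\<^sub>R f x) = (LINT x|lebesgue. indicator (box a' b') x *\<^sub>R h x)"
        unfolding f_def ab'[symmetric] by (simp add: indicator_inter_arith)
      also have "\<dots> = 0"
      proof (cases "box a' b' = {}")
        case False
        then have "cbox a' b' = closure (box a' b')" by simp
        also have "\<dots> \<subseteq> cbox c d"
          using ab' box_subset_cbox[of c d] by (intro closure_minimal) auto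
        finally show ?thesis using box0 cd by blast
      qed simp
      finally show ?thesis .
    qed
    have borel: "(LINT x|lebesgue. indicator A x *\<^sub>R f x) = 0" if "A \<in> sets borel" for A
    proof -
      \<comment> \<open>Boxes generate the Borel sets and are stable under intersection, so it is
        enough to pass to complements and to countable disjoint unions.\<close>
      let ?G = "range (\<lambda>(a, b). box a b :: (real ^ 'd) set)"
      have "Int_stable ?G"
        unfolding Int_stable_def by (auto simp: box_Int_box)
      moreover have "?G \<subseteq> Pow UNIV" by simp
      moreover have "A \<in> sigma_sets UNIV ?G"
        using that by (simp add: borel_eq_box)
      ultimately show ?thesis
      proof (induction rule: sigma_sets_induct_disjoint)
        case (compl A)
        then have A: "A \<in> sets lebesgue" by (simp add: borel_eq_box sets_completionI_sets)
        \<comment> \<open>The integral over the whole space is one over a box, because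
          \<open>f\<close> vanishes outside \<open>box c d\<close>.\<close>
        have "(LINT x|lebesgue. f x) = (LINT x|lebesgue. indicator (box c d) x *\<^sub>R f x)"
          by (rule Bochner_Integration.integral_cong) (auto simp: f_def indicator_def)
        then have "(LINT x|lebesgue. f x) = 0" using b by simp
        moreover have "(LINT x|lebesgue. indicator (UNIV - A) x *\<^sub>R f x) = (LINT x|lebesgue. f x - indicator A x *\<^sub>R f x)"
          by (rule Bochner_Integration.integral_cong) (auto simp: indicator_def)
        ultimately show ?case
          using compl by (simp add: Bochner_Integration.integral_diff[OF fi fi'[OF A]])
      next
        case (union A)
        have A: "A i \<in> sets lebesgue" for i
        proof -
          have "A i \<in> sigma_sets UNIV (range (\<lambda>(a, b). box a b))"
            using union(2) by blast
          then have "A i \<in> sets lborel" by (simp add: borel_eq_box)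
          then show ?thesis by (rule sets_completionI_sets)
        qed
        have "(LINT x:(\<Union>i. A i)|lebesgue. f x) = (\<Sum>i. (LINT x:(A i)|lebesgue. f x))"
          using union(1) A fi' by (intro lebesgue_integral_countable_add)
            (auto simp: disjoint_family_on_def set_integrable_def)
        then show ?case
          using union(3) by (simp add: set_lebesgue_integral_def)
      qed (use b in auto)
    qed
    have "AE x in lebesgue. f x = 0"
    proof (rule sigma_finite_measure.density_zero)
      show "sigma_finite_measure (lebesgue :: (real ^ 'd) measure)"
      proof
        obtain A :: "(real ^ 'd) set set" where "countable A" "A \<subseteq> sets lborel" "\<Union>A = space lborel"
          "\<forall>a\<in>A. emeasure lborel a \<noteq> \<infinity>"
          using lborel.sigma_finite_countable by blast
        then show "\<exists>A. countable A \<and> A \<subseteq> sets (lebesgue :: (real ^ 'd) measure) \<and>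
            \<Union>A = space (lebesgue :: (real ^ 'd) measure) \<and> (\<forall>a\<in>A. emeasure lebesgue a \<noteq> \<infinity>)"
          by (intro exI[of _ A]) (auto simp: subset_iff)
      qed
      show "set_lebesgue_integral lebesgue A f = 0" if A: "A \<in> sets lebesgue" for A
      proof -
        obtain S N N' where S: "A = S \<union> N" "N \<subseteq> N'" "N' \<in> null_sets lborel" "S \<in> sets lborel"
          using A by (rule sets_completionE)
        have "AE x in lebesgue. x \<notin> N'"
          using S(3) by (intro AE_not_in null_sets_completionI)
        then have "(LINT x|lebesgue. indicator A x *\<^sub>R f x) = (LINT x|lebesgue. indicator S x *\<^sub>R f x)"
          using S A fi'[of A] fi'[of S]
          by (intro integral_cong_AE) (auto simp: indicator_def sets_completionI_sets)
        then show ?thesis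
          using borel[of S] S(4) by (simp add: set_lebesgue_integral_def)
      qed
    qed (rule fi)
    moreover have "AE x in lebesgue. x \<notin> cbox c d - box c d"
      using negligible_frontier_interval[of c d] by (intro AE_not_in) (simp add: negligible_iff_null_sets)
    ultimately show ?thesis
      by eventually_elim (auto simp: f_def indicator_def split: if_splits)
  qed
  obtain \<D> where \<D>: "countable \<D>" "\<D> \<subseteq> Pow D" "\<And>X. X \<in> \<D> \<Longrightarrow> \<exists>a b. X = cbox a b" "\<Union>\<D> = D"
    using open_countable_Union_open_cbox[OF D] by metis
  have "AE x in lebesgue. \<forall>X\<in>\<D>. x \<in> X \<longrightarrow> h x = 0"
    using \<D> AE_box by (subst AE_ball_countable) force+
  then show ?thesis
    using \<D>(4) by (auto elim: eventually_mono)
qed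

text \<open>\<open>weak_deriv\<close> is an arbitrary choice among the weak derivatives, whence the
  equality almost everywhere. The difference of two candidates has vanishing integrals against all
  test functions.\<close>

lemma weak_deriv_smooth:
  assumes D: "open D" and u: "smooth_on D u"
  shows "AE x in lebesgue. x \<in> D \<longrightarrow> weak_deriv D \<alpha> u x = foldr partial (rev (multi_list \<alpha>)) u x"
proof -
  define v w where "v = foldr partial (rev (multi_list \<alpha>)) u" and "w = weak_deriv D \<alpha> u"
  have v: "has_weak_deriv D \<alpha> u v"
    unfolding v_def by (rule has_weak_deriv_smooth[OF assms])
  then have w: "has_weak_deriv D \<alpha> u w"
    unfolding w_def weak_deriv_def by (rule someI[of "has_weak_deriv D \<alpha> u"])
  have loc: "v locally_integrable_on D" "w locally_integrable_on D"
    using v w by (simp_all add: has_weak_deriv_def)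
  have "AE x in lebesgue. x \<in> D \<longrightarrow> w x - v x = 0"
  proof (rule AE_eq_0_if_test_integrals_0[OF D])
    show "(\<lambda>x. w x - v x) locally_integrable_on D"
      using loc by (simp add: locally_integrable_on_def)
    fix \<psi> assume \<psi>: "test_function D \<psi>"
    have "(LINT x:D|lebesgue. u x * multi_deriv \<alpha> \<psi> x) = (-1) ^ multi_order \<alpha> * (LINT x:D|lebesgue. g x * \<psi> x)"
      if "has_weak_deriv D \<alpha> u g" for g
      using that \<psi> by (simp add: has_weak_deriv_def)
    from this[OF v] this[OF w]
    have "(LINT x:D|lebesgue. w x * \<psi> x) = (LINT x:D|lebesgue. v x * \<psi> x)"
      by simp
    then show "(LINT x:D|lebesgue. (w x - v x) * \<psi> x) = 0"
      unfolding set_lebesgue_integral_def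
      using locally_integrable_mult_test[OF D loc(1) \<psi>] locally_integrable_mult_test[OF D loc(2) \<psi>]
      by (simp add: left_diff_distrib scaleR_diff_right)
  qed
  then show ?thesis
    unfolding v_def w_def by simp
qed

subsection \<open>Room for bumps near the singular set\<close>

lemma closed_coord_eq: "closed {x :: real ^ 'd::finite. x $ i = c}"
  by (rule closed_Collect_eq) (intro continuous_intros)+

text \<open>The dimension of \<open>S\<close> as seen from \<open>D\<close>: balls of radius
  comparable to their distance from \<open>S\<close>, as in a Whitney covering, and at least as many
  of them as a \<open>\<delta>\<close>-dimensional set has room for. \<open>C\<close> must not
  depend on the separation \<open>M\<close>, because \<open>M\<close> is later chosen large in terms
  of \<open>C\<close>; \<open>\<kappa>\<close> and \<open>r0\<close> may depend on it.\<close>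

definition bump_room :: "(real ^ 'd::finite) set \<Rightarrow> (real ^ 'd) set \<Rightarrow> nat \<Rightarrow> bool" where
  "bump_room D S \<delta> \<longleftrightarrow>
     (\<exists>C>0. \<forall>M>0. \<exists>\<kappa>>0. \<exists>r0>0. \<forall>r. 0 < r \<and> r \<le> r0 \<longrightarrow>
       (\<exists>X. finite X \<and> \<kappa> * r powr (- real \<delta>) \<le> real (card X) \<and>
          (\<forall>x\<in>X. ball x r \<subseteq> D \<and> (\<exists>s\<in>S. dist x s \<le> C * r)) \<and>
          (\<forall>x\<in>X. \<forall>y\<in>X. x \<noteq> y \<longrightarrow> M * r < dist x y)))"

text \<open>Only the coordinates in \<open>I\<close> of the anchor points \<open>s k\<close> are
  prescribed. This suits a polytope, where the anchors are merely known to exist in a slice. Two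
  anchors differ by at least \<open>h\<close> in some coordinate of \<open>I\<close>, and passing
  from \<open>s\<close> to \<open>x\<close> costs at most \<open>E\<close> at either end.\<close>

lemma separated_grid_points:
  fixes x s :: "('d::finite \<Rightarrow> nat) \<Rightarrow> real ^ 'd" and I :: "'d set" and n :: nat
  defines "G \<equiv> PiE I (\<lambda>_. {..<n})"
  assumes s: "\<And>k i. k \<in> G \<Longrightarrow> i \<in> I \<Longrightarrow> s k $ i = b $ i + h * real (k i)"
    and x: "\<And>k. k \<in> G \<Longrightarrow> dist (x k) (s k) \<le> E"
    and h: "M + 2 * E < h" "0 \<le> M" "0 \<le> E"
  shows "finite (x ` G)" "card (x ` G) = n ^ card I"
    "\<And>y z. \<lbrakk>y \<in> x ` G; z \<in> x ` G; y \<noteq> z\<rbrakk> \<Longrightarrow> M < dist y z"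
proof -
  have sep: "M < dist (x k) (x l)" if kl: "k \<in> G" "l \<in> G" "k \<noteq> l" for k l
  proof -
    obtain i where i: "i \<in> I" "k i \<noteq> l i"
      using kl(3) PiE_ext[OF kl(1,2)[unfolded G_def]] by blast
    have "1 \<le> \<bar>real (k i) - real (l i)\<bar>"
      using i(2) by linarith
    then have "h * 1 \<le> h * \<bar>real (k i) - real (l i)\<bar>"
      using h by (intro mult_left_mono) auto
    also have "\<dots> = \<bar>h * (real (k i) - real (l i))\<bar>"
      using h by (simp add: abs_mult)
    also have "\<dots> = \<bar>(s k - s l) $ i\<bar>"
      using s[OF kl(1) i(1)] s[OF kl(2) i(1)] by (simp add: algebra_simps)
    also have "\<dots> \<le> dist (s k) (s l)"
      unfolding dist_norm by (rule component_le_norm_cart)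
    also have "\<dots> \<le> dist (s k) (x k) + dist (x k) (x l) + dist (x l) (s l)"
      using dist_triangle[of "s k" "s l" "x k"] dist_triangle[of "x k" "s l" "x l"] by linarith
    also have "\<dots> \<le> 2 * E + dist (x k) (x l)"
      using x[OF kl(1)] x[OF kl(2)] by (simp add: dist_commute)
    finally show ?thesis using h by simp
  qed
  show fin: "finite (x ` G)"
    unfolding G_def by (intro finite_imageI finite_PiE) auto
  have "inj_on x G"
  proof (rule inj_onI)
    fix k l assume "k \<in> G" "l \<in> G" "x k = x l"
    then show "k = l" using sep[of k l] h(2) by fastforce
  qed
  then show "card (x ` G) = n ^ card I"
    by (simp add: card_image G_def card_PiE)
  show "M < dist y z" if "y \<in> x ` G" "z \<in> x ` G" "y \<noteq> z" for y z
    using that sep by blast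
qed

text \<open>The centres are the points of a grid in \<open>S\<close>, shifted by \<open>r\<close> in
  a coordinate direction normal to \<open>S\<close>.\<close>

lemma bump_room_subspace:
  fixes I :: "'d::finite set"
  assumes "card I < CARD('d)"
  defines "S \<equiv> {x :: real ^ 'd. \<forall>i. i \<notin> I \<longrightarrow> x $ i = 0}"
  shows "bump_room (- S) S (card I)"
proof -
  obtain j where j: "j \<notin> I"
    using assms(1) by (metis UNIV_eq_I less_irrefl)
  have "\<exists>X. finite X \<and> 1 * r powr (- real (card I)) \<le> real (card X) \<and>
          (\<forall>x\<in>X. ball x r \<subseteq> - S \<and> (\<exists>s\<in>S. dist x s \<le> 1 * r)) \<and>
          (\<forall>x\<in>X. \<forall>y\<in>X. x \<noteq> y \<longrightarrow> M * r < dist x y)"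
    if M: "M > 0" and r: "0 < r" for M r :: real
  proof -
    \<comment> \<open>The subspace imposes no bound on the extent of the grid: with this many points
      in each direction the count holds with \<open>\<kappa> = 1\<close>, whatever the
      spacing.\<close>
    define n where "n = nat \<lceil>1 / r\<rceil>"
    define G where "G = PiE I (\<lambda>_. {..<n})"
    \<comment> \<open>More than \<open>(M + 2) * r\<close>, which is the separation plus the two
      shifts by \<open>r\<close>.\<close>
    define h where "h = (M + 3) * r"
    define s :: "('d \<Rightarrow> nat) \<Rightarrow> real ^ 'd" where "s k = (\<chi> i. if i \<in> I then h * real (k i) else 0)" for k
    define x where "x k = s k + r *\<^sub>R axis j 1" for k
    have dxs: "dist (x k) (s k) \<le> r" for k
      using r by (simp add: x_def dist_norm norm_axis_1)
    have sS: "s k \<in> S" for k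
      by (simp add: s_def S_def)
    have rS: "ball (x k) r \<subseteq> - S" for k
    proof
      fix y assume y: "y \<in> ball (x k) r"
      show "y \<in> - S"
      proof
        assume "y \<in> S"
        then have "(x k - y) $ j = r"
          using j by (simp add: x_def s_def S_def)
        then have "r \<le> dist (x k) y"
          using component_le_norm_cart[of "x k - y" j] r by (simp add: dist_norm)
        then show False using y by simp
      qed
    qed
    have hM: "M * r + 2 * r < h"
      using r by (simp add: h_def algebra_simps)
    have "1 / r \<le> real n"
      unfolding n_def by linarith
    then have "(1 / r) ^ card I \<le> real n ^ card I"
      using r by (intro power_mono) auto
    moreover have "(1 / r) ^ card I = r powr (- real (card I))"
      using r by (simp add: powr_minus powr_realpow power_one_over inverse_eq_divide)
    moreover note grid = separated_grid_points[of I n s 0 h x r "M * r", folded G_def]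
    have "finite (x ` G)" "card (x ` G) = n ^ card I"
      "\<And>y z. y \<in> x ` G \<Longrightarrow> z \<in> x ` G \<Longrightarrow> y \<noteq> z \<Longrightarrow> M * r < dist y z"
      using grid hM dxs r M by (simp_all add: s_def)
    ultimately show ?thesis
    proof (intro exI[of _ "x ` G"] conjI ballI impI)
      fix y assume "y \<in> x ` G"
      then obtain k where "y = x k" by blast
      then show "ball y r \<subseteq> - S" "\<exists>s\<in>S. dist y s \<le> 1 * r"
        using rS[of k] dxs[of k] sS[of k] by auto
    qed auto
  qed
  then show ?thesis
    unfolding bump_room_def
    by (intro exI[of _ "1 :: real"] conjI allI impI exI[of _ "1 :: real"]) auto
qed

section \<open>Lineality spaces and the singular set of a polytope\<close>

lemma lineality_ball:
  assumes "v \<in> lineality P x"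
  shows "\<exists>e>0. \<forall>y\<in>ball x e. v \<in> lineality P y"
proof -
  obtain e where e: "e > 0"
    "\<And>y t. \<lbrakk>y \<in> ball x e; y + t *\<^sub>R v \<in> ball x e\<rbrakk> \<Longrightarrow> y + t *\<^sub>R v \<in> P \<longleftrightarrow> y \<in> P"
    using assms unfolding lineality_def by blast
  have "v \<in> lineality P y" if y: "y \<in> ball x e" for y
  proof -
    obtain f where "f > 0" "ball y f \<subseteq> ball x e"
      using y open_ball openE by blast
    then show ?thesis
      unfolding lineality_def using e(2) by blast
  qed
  then show ?thesis using e(1) by blast
qed

text \<open>A basis chosen from the lineality space consists of finitely many directions, each of
  which remains one at all points near \<open>x\<close>. Geometrically, only faces of at least the
  same dimension come near a relative interior point of a face.\<close>

lemma dim_lineality_lower_semicontinuous: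
  fixes x :: "real ^ 'd::finite"
  shows "\<exists>e>0. \<forall>y\<in>ball x e. dim (lineality P x) \<le> dim (lineality P y)"
proof -
  obtain B where B: "B \<subseteq> lineality P x" "independent B" "card B = dim (lineality P x)"
    using basis_exists by metis
  have "finite B" using B(2) by (rule independent_imp_finite)
  then have "\<exists>e>0. \<forall>y\<in>ball x e. B \<subseteq> lineality P y"
    using B(1)
  proof induction
    case empty
    show ?case by (intro exI[of _ 1]) auto
  next
    case (insert b B)
    then obtain e f where "e > 0" "\<forall>y\<in>ball x e. B \<subseteq> lineality P y"
      "f > 0" "\<forall>y\<in>ball x f. b \<in> lineality P y"
      using lineality_ball[of b P x] by auto
    then show ?case
      by (intro exI[of _ "min e f"]) auto
  qed
  then show ?thesis
    using B independent_card_le_dim by metis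
qed

text \<open>By semicontinuity the boundary points with lineality of codimension at least two form a
  closed set, so the components and closures in the definition of the faces add no further points to
  the union.\<close>

lemma singular_set_eq:
  fixes P :: "(real ^ 'd::finite) set"
  shows "singular_set P = {x \<in> frontier P. dim (lineality P x) + 2 \<le> CARD('d)}" (is "_ = ?A")
    and "closed (singular_set P)"
proof -
  have "open {x. \<not> dim (lineality P x) + 2 \<le> CARD('d)}"
    unfolding open_contains_ball
  proof
    fix x assume "x \<in> {x. \<not> dim (lineality P x) + 2 \<le> CARD('d)}"
    then show "\<exists>e>0. ball x e \<subseteq> {x. \<not> dim (lineality P x) + 2 \<le> CARD('d)}"
      using dim_lineality_lower_semicontinuous[of x P] by force
  qed
  then have "closed (frontier P - {x. \<not> dim (lineality P x) + 2 \<le> CARD('d)})"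
    by (intro closed_Diff) auto
  also have "frontier P - {x. \<not> dim (lineality P x) + 2 \<le> CARD('d)} = ?A" by blast
  finally have cl: "closed ?A" .
  show "singular_set P = ?A"
  proof
    have "closure C \<subseteq> ?A" if "k + 2 \<le> CARD('d)"
      "C \<in> components {x \<in> frontier P. dim (lineality P x) = k}" for C k
      using in_components_subset[OF that(2)] that(1) by (intro closure_minimal cl) auto
    then show "singular_set P \<subseteq> ?A"
      unfolding singular_set_def polytope_faces_def by blast
    show "?A \<subseteq> singular_set P"
    proof
      fix x assume x: "x \<in> ?A"
      let ?k = "dim (lineality P x)"
      let ?C = "connected_component_set {y \<in> frontier P. dim (lineality P y) = ?k} x"
      have "?C \<in> components {y \<in> frontier P. dim (lineality P y) = ?k}" "x \<in> ?C"
        using x by (auto simp: components_def connected_component_refl)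
      moreover have "x \<in> closure ?C"
        using \<open>x \<in> ?C\<close> closure_subset by blast
      ultimately show "x \<in> singular_set P"
        using x unfolding singular_set_def polytope_faces_def by blast
    qed
  qed
  then show "closed (singular_set P)" using cl by simp
qed

text \<open>A direction found by counting dimensions is only known to lie in the span of the
  lineality space. It still permits short moves from \<open>s\<close> inside
  \<open>closure P\<close>, and that is what the extremal argument below contradicts.\<close>

lemma closure_translate_span_lineality:
  assumes s: "s \<in> closure P" and v: "v \<in> span (lineality P s)"
  shows "\<exists>e>0. \<forall>t. \<bar>t\<bar> < e \<longrightarrow> s + t *\<^sub>R v \<in> closure P"
proof -
  have small: "\<exists>f>0. \<forall>y t. y \<in> ball s f \<and> \<bar>t\<bar> < f \<longrightarrow> y + t *\<^sub>R v \<in> ball s e" if "e > 0" for e and v :: "real ^ 'a"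
  proof -
    define f where "f = e / (2 * (norm v + 1))"
    have n: "0 < 2 * (norm v + 1)"
      using norm_ge_zero[of v] by (simp add: add_nonneg_pos del: norm_ge_zero)
    have f: "f > 0"
      unfolding f_def using that n by (rule divide_pos_pos)
    have "f * (2 * (norm v + 1)) = e"
      unfolding f_def using n by simp
    then have fe: "f + f * norm v = e / 2"
      by (simp add: algebra_simps)
    have "y + t *\<^sub>R v \<in> ball s e" if "y \<in> ball s f" "\<bar>t\<bar> < f" for y t
    proof -
      have "dist s (y + t *\<^sub>R v) \<le> dist s y + \<bar>t\<bar> * norm v"
        using dist_triangle[of s "y + t *\<^sub>R v" y] by (simp add: dist_norm)
      also have "\<dots> \<le> f + f * norm v"
        using that by (intro add_mono mult_right_mono) auto
      finally show ?thesis using fe \<open>e > 0\<close> by simp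
    qed
    then show ?thesis using f by blast
  qed
  \<comment> \<open>The condition is imposed at all starting points of \<open>closure P\<close> near
    \<open>s\<close>, not only at \<open>s\<close>, so that two translations can be performed one
    after the other. This makes \<open>W\<close> closed under addition.\<close>
  define W where "W = {v. \<exists>e>0. \<forall>y t. y \<in> ball s e \<and> y \<in> closure P \<and> \<bar>t\<bar> < e \<longrightarrow> y + t *\<^sub>R v \<in> closure P}"
  have lin: "v \<in> W" if v: "v \<in> lineality P s" for v
  proof -
    obtain e where e: "e > 0"
      "\<And>y t. \<lbrakk>y \<in> ball s e; y + t *\<^sub>R v \<in> ball s e\<rbrakk> \<Longrightarrow> y + t *\<^sub>R v \<in> P \<longleftrightarrow> y \<in> P"
      using v unfolding lineality_def by blast
    obtain f where f: "f > 0" "\<And>y t. y \<in> ball s f \<Longrightarrow> \<bar>t\<bar> < f \<Longrightarrow> y + t *\<^sub>R v \<in> ball s e"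
      using small[OF e(1)] by blast
    have "y + t *\<^sub>R v \<in> closure P" if y: "y \<in> ball s f" "y \<in> closure P" "\<bar>t\<bar> < f" for y t
    proof -
      obtain g where g: "\<And>n. g n \<in> P" "g \<longlonglongrightarrow> y"
        using y(2) unfolding closure_sequential by blast
      have lim: "(\<lambda>n. g n + t *\<^sub>R v) \<longlonglongrightarrow> y + t *\<^sub>R v"
        by (intro tendsto_intros g(2))
      have "y \<in> ball s e" using f(2)[of y 0] y f(1) by simp
      then have "\<forall>\<^sub>F n in sequentially. g n \<in> ball s e"
        using g(2) by (intro topological_tendstoD) auto
      moreover have "\<forall>\<^sub>F n in sequentially. g n + t *\<^sub>R v \<in> ball s e"
        using lim f(2)[OF y(1,3)] by (intro topological_tendstoD) auto
      ultimately have "\<forall>\<^sub>F n in sequentially. g n + t *\<^sub>R v \<in> closure P"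
        by eventually_elim (use e(2) g(1) closure_subset in blast)
      then show ?thesis
        using Lim_in_closed_set[OF closed_closure _ _ lim] by simp
    qed
    then show ?thesis unfolding W_def using f(1) by blast
  qed
  have "subspace W"
    unfolding subspace_def
  proof (intro conjI ballI allI)
    show "0 \<in> W" unfolding W_def by (auto intro: exI[of _ 1])
    fix v assume "v \<in> W"
    then obtain e where e: "e > 0"
      "\<And>y t. y \<in> ball s e \<Longrightarrow> y \<in> closure P \<Longrightarrow> \<bar>t\<bar> < e \<Longrightarrow> y + t *\<^sub>R v \<in> closure P"
      unfolding W_def by blast
    show "c *\<^sub>R v \<in> W" for c
    proof -
      define f where "f = e / (\<bar>c\<bar> + 1)"
      have f: "f > 0" "f \<le> e"
        using e(1) by (auto simp: f_def divide_le_eq algebra_simps)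
      have "\<bar>t * c\<bar> < e" if "\<bar>t\<bar> < f" for t
      proof -
        have "\<bar>t\<bar> * (\<bar>c\<bar> + 1) < e"
          using that by (simp add: f_def pos_less_divide_eq)
        then show ?thesis by (simp add: abs_mult algebra_simps)
      qed
      then have "y + t *\<^sub>R (c *\<^sub>R v) \<in> closure P" if "y \<in> ball s f" "y \<in> closure P" "\<bar>t\<bar> < f" for y t
        using e(2)[of y "t * c"] that f by simp
      then show ?thesis unfolding W_def using f(1) by blast
    qed
    fix w assume "w \<in> W"
    then obtain e' where e': "e' > 0"
      "\<And>y t. y \<in> ball s e' \<Longrightarrow> y \<in> closure P \<Longrightarrow> \<bar>t\<bar> < e' \<Longrightarrow> y + t *\<^sub>R w \<in> closure P"
      unfolding W_def by blast
    obtain f where f: "f > 0" "\<And>y t. y \<in> ball s f \<Longrightarrow> \<bar>t\<bar> < f \<Longrightarrow> y + t *\<^sub>R v \<in> ball s e'"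
      using small[OF e'(1)] by blast
    have "y + t *\<^sub>R (v + w) \<in> closure P"
      if "y \<in> ball s (min f (min e e'))" "y \<in> closure P" "\<bar>t\<bar> < min f (min e e')" for y t
      using e(2)[of y t] e'(2)[of "y + t *\<^sub>R v" t] f(2)[of y t] that by (simp add: algebra_simps)
    moreover have "min f (min e e') > 0" using e e' f by simp
    ultimately show "v + w \<in> W" unfolding W_def by blast
  qed
  then have "v \<in> W"
    using v lin span_minimal[of "lineality P s" W] by blast
  then obtain e where "e > 0" "\<And>t. \<bar>t\<bar> < e \<Longrightarrow> s \<in> ball s e \<Longrightarrow> s + t *\<^sub>R v \<in> closure P"
    using s unfolding W_def by blast
  then show ?thesis by auto
qed

text \<open>The point of largest norm on a two-dimensional coordinate slice is singular: otherwise the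
  lineality space, having codimension at most one, contains a direction of the slice, and a
  segment in this direction would reach points of larger norm.\<close>

lemma slice_meets_singular_set:
  fixes P :: "(real ^ 'd::finite) set"
  assumes P: "open P" "bounded P" and I: "card I + 2 = CARD('d)" and y: "y \<in> closure P"
  shows "\<exists>s\<in>singular_set P. \<forall>i\<in>I. s $ i = y $ i"
proof -
  define V where "V = {v :: real ^ 'd. \<forall>i. i \<notin> - I \<longrightarrow> v $ i = 0}"
  have dV: "dim V = 2"
  proof -
    have "card (- I) = 2"
      using I by (simp add: Compl_eq_Diff_UNIV card_Diff_subset)
    then show ?thesis
      unfolding V_def using dim_substandard_cart[of "- I", where ?'a = real]
      by (simp only: dim_vec_eq)
  qed
  have sV: "subspace V"
    by (auto simp: V_def subspace_def)
  define K where "K = closure P \<inter> {x. \<forall>i\<in>I. x $ i = y $ i}"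
  have "{x. \<forall>i\<in>I. x $ i = y $ i} = (\<Inter>i\<in>I. {x. x $ i = y $ i})" by auto
  then have "closed {x. \<forall>i\<in>I. x $ i = y $ i}"
    by (simp add: closed_INT closed_coord_eq)
  then have "compact K"
    unfolding K_def using P(2) by (intro compact_Int_closed) (auto simp: compact_closure)
  moreover have "K \<noteq> {}" using y by (auto simp: K_def)
  ultimately obtain s where s: "s \<in> K" "\<And>x. x \<in> K \<Longrightarrow> norm x \<le> norm s"
    using continuous_attains_sup[of K norm] continuous_on_norm_id by blast
  have no: False if v: "v \<in> V" "v \<noteq> 0" and e: "e > 0" "\<And>t. \<bar>t\<bar> < e \<Longrightarrow> s + t *\<^sub>R v \<in> closure P" for v e
  proof -
    define t where "t = e / 2"
    have t: "t > 0" using e by (simp add: t_def)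
    have "s + t *\<^sub>R v \<in> K" "s + (- t) *\<^sub>R v \<in> K"
      using e(2)[of t] e(2)[of "- t"] e(1) v(1) s(1) by (auto simp: K_def V_def t_def)
    \<comment> \<open>Adding the two inequalities gives
      \<open>norm (t *\<^sub>R v) ^ 2 \<le> 0\<close> by the parallelogram law.\<close>
    then have "norm (s + t *\<^sub>R v) ^ 2 \<le> norm s ^ 2" "norm (s + (- t) *\<^sub>R v) ^ 2 \<le> norm s ^ 2"
      using s(2) by (auto intro: power_mono)
    then have "norm (t *\<^sub>R v) ^ 2 \<le> 0"
      unfolding power2_norm_eq_inner by (simp add: inner_add_left inner_add_right inner_diff_left inner_diff_right inner_commute)
    then show False using t v(2) by simp
  qed
  have "s \<notin> P"
  proof
    assume "s \<in> P"
    obtain v where v: "v \<in> V" "v \<noteq> 0"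
      using dV by (metis dim_eq_0 subsetI singletonI zero_neq_numeral)
    obtain e where e: "e > 0" "ball s e \<subseteq> P"
      using P(1) \<open>s \<in> P\<close> openE by blast
    have "s + t *\<^sub>R v \<in> closure P" if "\<bar>t\<bar> < e / norm v" for t
    proof -
      have "s + t *\<^sub>R v \<in> ball s e"
        using that v(2) by (simp add: dist_norm pos_less_divide_eq)
      then show ?thesis using e(2) closure_subset by blast
    qed
    moreover have "e / norm v > 0" using e v by simp
    ultimately show False using no[OF v] by blast
  qed
  then have "s \<in> frontier P"
    using s(1) P(1) by (simp add: K_def frontier_def interior_open)
  moreover have "dim (lineality P s) + 2 \<le> CARD('d)"
  proof (rule ccontr)
    assume *: "\<not> ?thesis"
    let ?W = "span (lineality P s)"
    have "dim {x + y |x y. x \<in> V \<and> y \<in> ?W} + dim (V \<inter> ?W) = dim V + dim ?W"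
      by (rule dim_sums_Int) (auto simp: sV)
    moreover have "dim {x + y |x y. x \<in> V \<and> y \<in> ?W} \<le> CARD('d)"
      using dim_subset_UNIV[of "{x + y |x y. x \<in> V \<and> y \<in> ?W}"] by simp
    ultimately have "dim (V \<inter> ?W) \<noteq> 0"
      unfolding dim_span using * dV by linarith
    then have "\<not> V \<inter> ?W \<subseteq> {0}" by simp
    then obtain v where v: "v \<in> V" "v \<in> ?W" "v \<noteq> 0" by blast
    have "s \<in> closure P" using s(1) by (simp add: K_def)
    from closure_translate_span_lineality[OF this v(2)] show False
      using no[OF v(1,3)] by blast
  qed
  ultimately have "s \<in> singular_set P" by (simp add: singular_set_eq)
  then show ?thesis using s(1) by (auto simp: K_def)
qed

text \<open>An interior cone condition, valid at reentrant corners too: every point of the closure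
  belongs to a convex polytope with interior points, and a ball in that polytope can be shrunk
  towards the point by convexity. Finitely many polytopes give uniform constants.\<close>

lemma polytopal_interior_cone:
  fixes P :: "(real ^ 'd::finite) set"
  assumes "polytopal_domain P"
  shows "\<exists>C>0. \<exists>r0>0. \<forall>s\<in>closure P. \<forall>r. 0 < r \<and> r \<le> r0 \<longrightarrow> (\<exists>x. ball x r \<subseteq> P \<and> dist x s \<le> C * r)"
proof -
  obtain \<P> where \<P>: "finite \<P>" "\<And>K. K \<in> \<P> \<Longrightarrow> polytope K" "P = interior (\<Union>\<P>)"
    using assms unfolding polytopal_domain_def by blast
  define F where "F = {K\<in>\<P>. interior K \<noteq> {}}"
  have "finite F" using \<P>(1) by (simp add: F_def)
  have comp: "compact K" if "K \<in> \<P>" for K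
    using \<P>(2)[OF that] by (rule polytope_imp_compact)
  \<comment> \<open>Finitely many closed sets with empty interior have a union with empty interior.
    Hence the full-dimensional polytopes already cover \<open>P\<close>.\<close>
  have thin: "interior (\<Union>\<Q>) = {} \<and> closed (\<Union>\<Q>)" if "finite \<Q>" "\<Q> \<subseteq> \<P> - F" for \<Q>
    using that
  proof induction
    case (insert K \<Q>)
    then have "closed K" "interior K = {}"
      using comp compact_imp_closed by (auto simp: F_def)
    then show ?case
      using insert interior_closed_Un_empty_interior[of K "\<Union>\<Q>"] by (auto simp: closed_Un)
  qed simp
  have "P - \<Union>F \<subseteq> interior (\<Union>(\<P> - F))"
  proof (rule interior_maximal)
    show "P - \<Union>F \<subseteq> \<Union>(\<P> - F)"
      using \<P>(3) interior_subset by blast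
    have "closed (\<Union>F)"
      using \<open>finite F\<close> comp compact_imp_closed by (intro closed_Union) (auto simp: F_def)
    then show "open (P - \<Union>F)"
      using \<P>(3) by (intro open_Diff) auto
  qed
  then have "P \<subseteq> \<Union>F"
    using thin[of "\<P> - F"] \<P>(1) by auto
  then have clP: "closure P \<subseteq> \<Union>F"
    using \<open>finite F\<close> comp compact_imp_closed
    by (intro closure_minimal closed_Union) (auto simp: F_def)
  have one: "\<exists>C>0. \<exists>r0>0. \<forall>s\<in>K. \<forall>r. 0 < r \<and> r \<le> r0 \<longrightarrow> (\<exists>x. ball x r \<subseteq> P \<and> dist x s \<le> C * r)" if K: "K \<in> F" for K
  proof -
    obtain z R where z: "R > 0" "ball z R \<subseteq> K"
      using K by (auto simp: F_def) (metis ex_in_conv mem_interior)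
    have cK: "convex K" "bounded K"
      using K \<P>(2) comp by (auto simp: F_def polytope_imp_convex compact_imp_bounded)
    then obtain B0 where B0: "\<And>x. x \<in> K \<Longrightarrow> dist z x \<le> B0"
      using bounded_any_center[of K z] by blast
    define B where "B = max B0 1"
    have B: "B > 0" "\<And>x. x \<in> K \<Longrightarrow> dist z x \<le> B"
      using B0 by (auto simp: B_def le_max_iff_disj)
    have intK: "interior K \<subseteq> P"
      using K \<P>(3) by (auto simp: F_def intro: interior_mono[THEN subsetD])
    \<comment> \<open>The image of \<open>ball z R\<close> under the homothety with centre
      \<open>s\<close> and ratio \<open>r / R\<close>.\<close>
    have "ball (s + (r / R) *\<^sub>R (z - s)) r \<subseteq> P \<and> dist (s + (r / R) *\<^sub>R (z - s)) s \<le> (B / R) * r"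
      if s: "s \<in> K" and r: "0 < r" "r \<le> R" for s r
    proof
      let ?x = "s + (r / R) *\<^sub>R (z - s)"
      have "ball ?x r \<subseteq> K"
      proof
        fix w assume w: "w \<in> ball ?x r"
        define w' where "w' = z + (R / r) *\<^sub>R (w - ?x)"
        have "norm (w - ?x) < r"
          using w by (simp add: dist_norm norm_minus_commute)
        then have "(R / r) * norm (w - ?x) < (R / r) * r"
          using r z by (intro mult_strict_left_mono) auto
        then have "norm (w' - z) < R"
          using r z by (simp add: w'_def)
        then have "w' \<in> K" using z by (auto simp: dist_norm norm_minus_commute)
        then have "(1 - r / R) *\<^sub>R s + (r / R) *\<^sub>R w' \<in> K"
          using r z by (intro convexD[OF cK(1) s]) auto
        moreover have "(1 - r / R) *\<^sub>R s + (r / R) *\<^sub>R w' = w"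
          using r z by (simp add: w'_def algebra_simps)
        ultimately show "w \<in> K" by simp
      qed
      then show "ball ?x r \<subseteq> P"
        using intK interior_maximal[of "ball ?x r" K] by auto
      have "dist ?x s = (r / R) * dist z s"
        using r z by (simp add: dist_norm)
      also have "\<dots> \<le> (r / R) * B"
        using r z B(2)[OF s] by (intro mult_left_mono) auto
      finally show "dist ?x s \<le> (B / R) * r" by (simp add: mult.commute)
    qed
    moreover have "B / R > 0" using B z by simp
    ultimately show ?thesis using z(1) by blast
  qed
  have "\<exists>C>0. \<exists>r0>0. \<forall>s\<in>\<Union>H. \<forall>r. 0 < r \<and> r \<le> r0 \<longrightarrow> (\<exists>x. ball x r \<subseteq> P \<and> dist x s \<le> C * r)"
    if "finite H" "H \<subseteq> F" for H
    using that
  proof induction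
    case empty
    show ?case by (rule exI[of _ 1], rule conjI[OF zero_less_one], rule exI[of _ 1]) simp
  next
    case (insert K H)
    have "\<exists>C>0. \<exists>r0>0. \<forall>s\<in>\<Union>H. \<forall>r. 0 < r \<and> r \<le> r0 \<longrightarrow> (\<exists>x. ball x r \<subseteq> P \<and> dist x s \<le> C * r)"
      using insert.prems by (intro insert.IH) blast
    then obtain C r0 where C: "C > 0" "r0 > 0"
      "\<And>s r. s \<in> \<Union>H \<Longrightarrow> 0 < r \<Longrightarrow> r \<le> r0 \<Longrightarrow> \<exists>x. ball x r \<subseteq> P \<and> dist x s \<le> C * r" by blast
    have "K \<in> F" using insert.prems by simp
    from one[OF this] obtain C' r0' where C': "C' > 0" "r0' > 0"
      "\<forall>s\<in>K. \<forall>r. 0 < r \<and> r \<le> r0' \<longrightarrow> (\<exists>x. ball x r \<subseteq> P \<and> dist x s \<le> C' * r)"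
      by (elim exE conjE)
    have "\<exists>x. ball x r \<subseteq> P \<and> dist x s \<le> max C C' * r"
      if sr: "s \<in> \<Union>(insert K H)" "0 < r" "r \<le> min r0 r0'" for s r
    proof -
      have "C * r \<le> max C C' * r" "C' * r \<le> max C C' * r"
        using sr by (auto intro: mult_right_mono)
      then have mono: "\<exists>x. ball x r \<subseteq> P \<and> dist x s \<le> max C C' * r"
        if "\<exists>x. ball x r \<subseteq> P \<and> dist x s \<le> C * r \<or> ball x r \<subseteq> P \<and> dist x s \<le> C' * r"
        using that by (meson order_trans)
      consider "s \<in> \<Union>H" | "s \<in> K" using sr(1) by blast
      then show ?thesis
      proof cases
        case 1
        then show ?thesis using C(3)[of s r] sr mono by auto
      next
        case 2
        with C'(3) sr have "\<exists>x. ball x r \<subseteq> P \<and> dist x s \<le> C' * r" by simp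
        then show ?thesis using mono by blast
      qed
    qed
    moreover have "max C C' > 0" "min r0 r0' > 0" using C C' by auto
    ultimately show ?case by blast
  qed
  from this[OF \<open>finite F\<close>] clP show ?thesis
    by (metis order_refl subsetD)
qed

lemma polytopal_domain_open_bounded:
  assumes "polytopal_domain P"
  shows "open P" "bounded P" "P \<noteq> {}"
proof -
  obtain \<P> where \<P>: "finite \<P>" "\<And>K. K \<in> \<P> \<Longrightarrow> polytope K" "P = interior (\<Union>\<P>)" "P \<noteq> {}"
    using assms unfolding polytopal_domain_def by blast
  show "open P" "P \<noteq> {}" using \<P> by auto
  have "bounded (\<Union>\<P>)"
    using \<P> by (intro bounded_Union) (auto intro: polytope_imp_bounded)
  then show "bounded P"
    using \<P>(3) bounded_subset interior_subset by blast
qed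

text \<open>Instead of following a face, the grid is placed inside \<open>P\<close>, in a plane of
  dimension \<open>d - 2\<close>. The two-dimensional slice through a grid point meets the singular
  set in a point with the same \<open>I\<close>-coordinates, and the interior cone condition
  supplies a ball near that point. The separation survives because it is measured in the
  \<open>I\<close>-coordinates.\<close>

lemma bump_room_polytope:
  fixes P :: "(real ^ 'd::finite) set"
  assumes P: "polytopal_domain P" and d: "2 \<le> CARD('d)"
  shows "bump_room P (singular_set P) (CARD('d) - 2)"
proof -
  note oP = polytopal_domain_open_bounded[OF P]
  obtain I :: "'d set" where I: "card I = CARD('d) - 2"
    using obtain_subset_with_card_n[of "CARD('d) - 2" "UNIV :: 'd set"] by auto
  obtain C rC where C: "C > 0" "rC > 0"
    "\<And>s r. s \<in> closure P \<Longrightarrow> 0 < r \<Longrightarrow> r \<le> rC \<Longrightarrow> \<exists>x. ball x r \<subseteq> P \<and> dist x s \<le> C * r"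
    using polytopal_interior_cone[OF P] by blast
  obtain z R where z: "R > 0" "ball z R \<subseteq> P"
    using oP by (metis ex_in_conv openE)
  let ?d = "real CARD('d)"
  have "\<exists>X. finite X \<and> (R / (2 * ?d * (M + 2 * C + 1))) ^ card I * r powr (- real (card I)) \<le> real (card X) \<and>
          (\<forall>x\<in>X. ball x r \<subseteq> P \<and> (\<exists>s\<in>singular_set P. dist x s \<le> C * r)) \<and>
          (\<forall>x\<in>X. \<forall>y\<in>X. x \<noteq> y \<longrightarrow> M * r < dist x y)"
    if M: "M > 0" and r: "0 < r" "r \<le> min rC (R / (2 * ?d * (M + 2 * C + 1)))" for M r
  proof -
    \<comment> \<open>Larger than the separation \<open>M * r\<close> plus the distance
      \<open>C * r\<close> between anchor and centre, counted at both ends.\<close>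
    define h where "h = (M + 2 * C + 1) * r"
    have h0: "h > 0" using M C r by (simp add: h_def)
    have d0: "?d > 0" by simp
    \<comment> \<open>The largest number with \<open>d * h * n \<le> R\<close>; by the comparison of
      the norm with the sum of the coordinates, the grid then stays in
      \<open>ball z R\<close>.\<close>
    define n where "n = nat \<lfloor>R / (?d * h)\<rfloor>"
    define G where "G = PiE I (\<lambda>_. {..<n})"
    define q where "q k = z + (\<chi> i. if i \<in> I then h * real (k i) else 0)" for k
    have q: "q k \<in> P" if k: "k \<in> G" for k
    proof -
      have "norm (q k - z) \<le> (\<Sum>i\<in>UNIV. \<bar>(q k - z) $ i\<bar>)"
        by (rule norm_le_l1_cart)
      also have "\<dots> < (\<Sum>i\<in>(UNIV :: 'd set). h * real n)"
      proof (rule sum_strict_mono)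
        fix i :: 'd
        have n0: "0 < n"
        proof -
          have "2 * (?d * h) \<le> R"
            using r d0 M C by (simp add: h_def le_divide_eq mult_ac)
          moreover have "0 < ?d * h" using h0 d0 by (rule mult_pos_pos[rotated])
          ultimately have "?d * h \<le> R" by linarith
          then have "1 \<le> R / (?d * h)"
            using h0 d0 by (simp add: le_divide_eq)
          then show ?thesis by (simp add: n_def)
        qed
        have "k i < n" if "i \<in> I" using k that by (auto simp: G_def)
        then show "\<bar>(q k - z) $ i\<bar> < h * real n"
          using h0 n0 by (auto simp: q_def abs_mult)
      qed auto
      also have "\<dots> = ?d * h * real n" by simp
      also have "\<dots> \<le> ?d * h * (R / (?d * h))"
      proof (rule mult_left_mono)
        have "0 \<le> R / (?d * h)" using z h0 by simp
        then show "real n \<le> R / (?d * h)"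
          unfolding n_def by linarith
      qed (use h0 in simp)
      also have "\<dots> = R" using h0 by simp
      finally show ?thesis using z by (auto simp: dist_norm norm_minus_commute)
    qed
    have "\<exists>s. s \<in> singular_set P \<and> (\<forall>i\<in>I. s $ i = q k $ i)" if "k \<in> G" for k
      using slice_meets_singular_set[OF oP(1,2), of I "q k"] q[OF that] I d closure_subset by force
    then obtain s where s: "\<And>k. k \<in> G \<Longrightarrow> s k \<in> singular_set P" "\<And>k i. k \<in> G \<Longrightarrow> i \<in> I \<Longrightarrow> s k $ i = q k $ i"
      by metis
    have "\<exists>x. ball x r \<subseteq> P \<and> dist x (s k) \<le> C * r" if "k \<in> G" for k
    proof (rule C(3))
      have "s k \<in> frontier P" using s(1)[OF that] by (simp add: singular_set_eq)
      then show "s k \<in> closure P" by (simp add: frontier_def)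
    qed (use r in auto)
    then obtain x where x: "\<And>k. k \<in> G \<Longrightarrow> ball (x k) r \<subseteq> P" "\<And>k. k \<in> G \<Longrightarrow> dist (x k) (s k) \<le> C * r"
      by metis
    have "M * r + 2 * (C * r) < h" using r by (simp add: h_def algebra_simps)
    then have X: "finite (x ` G)" "card (x ` G) = n ^ card I"
      "\<And>y w. y \<in> x ` G \<Longrightarrow> w \<in> x ` G \<Longrightarrow> y \<noteq> w \<Longrightarrow> M * r < dist y w"
      using separated_grid_points[of I n s z h x "C * r" "M * r", folded G_def] s(2) x(2) M C r
      by (simp_all add: q_def)
    \<comment> \<open>The restriction on \<open>r\<close> makes \<open>R / (d * h)\<close> at least
      \<open>2\<close>, so rounding down loses at most a factor of two.\<close>
    have "R / (2 * (?d * h)) \<le> real n"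
    proof -
      have "2 * (?d * h) \<le> R"
        using r d0 M C by (simp add: h_def le_divide_eq mult_ac)
      then have "1 \<le> R / (2 * (?d * h))"
        using h0 d0 by (simp add: le_divide_eq)
      moreover have "R / (?d * h) = 2 * (R / (2 * (?d * h)))" by simp
      moreover have "y \<le> real (nat \<lfloor>x\<rfloor>)" if "1 \<le> y" "x = 2 * y" for x y :: real
        using that by linarith
      ultimately show ?thesis unfolding n_def by blast
    qed
    then have "(R / (2 * (?d * h))) ^ card I \<le> real n ^ card I"
      using z h0 by (intro power_mono) auto
    moreover have "(R / (2 * (?d * h))) ^ card I = (R / (2 * ?d * (M + 2 * C + 1))) ^ card I * r powr (- real (card I))"
    proof -
      have "R / (2 * (?d * h)) = (R / (2 * ?d * (M + 2 * C + 1))) * (1 / r)"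
        by (simp add: h_def mult_ac)
      moreover have "(1 / r) ^ card I = r powr (- real (card I))"
        using r by (simp add: powr_minus powr_realpow power_one_over inverse_eq_divide)
      ultimately show ?thesis
        by (simp only: power_mult_distrib)
    qed
    ultimately show ?thesis
    proof (intro exI[of _ "x ` G"] conjI ballI impI)
      fix y assume "y \<in> x ` G"
      then obtain k where "y = x k" "k \<in> G" by blast
      then show "ball y r \<subseteq> P" "\<exists>s\<in>singular_set P. dist y s \<le> C * r"
        using x(1)[of k] x(2)[of k] s(1)[of k] by auto
    qed (use X in simp_all)
  qed
  note X = this
  have pos: "R / (2 * ?d * (M + 2 * C + 1)) > 0" if "M > 0" for M
    using that z C by simp
  show ?thesis
    unfolding bump_room_def I[symmetric]
  proof (rule exI[of _ C], intro conjI allI impI C(1))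
    fix M :: real assume M: "M > 0"
    show "\<exists>\<kappa>>0. \<exists>r0>0. \<forall>r. 0 < r \<and> r \<le> r0 \<longrightarrow>
       (\<exists>X. finite X \<and> \<kappa> * r powr (- real (card I)) \<le> real (card X) \<and>
          (\<forall>x\<in>X. ball x r \<subseteq> P \<and> (\<exists>s\<in>singular_set P. dist x s \<le> C * r)) \<and>
          (\<forall>x\<in>X. \<forall>y\<in>X. x \<noteq> y \<longrightarrow> M * r < dist x y))"
    proof -
      have p: "(R / (2 * ?d * (M + 2 * C + 1))) ^ card I > 0" "min rC (R / (2 * ?d * (M + 2 * C + 1))) > 0"
        using pos[OF M] C(2) by auto
      show ?thesis
        by (rule exI, rule conjI[OF p(1)], rule exI, rule conjI[OF p(2)]) (use X[OF M] in blast)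
    qed
  qed
qed

lemma bump_room_mono:
  assumes "bump_room P S \<delta>" "P \<subseteq> D"
  shows "bump_room D S \<delta>"
proof -
  have *: "ball x r \<subseteq> P \<Longrightarrow> ball x r \<subseteq> D" for x r
    using assms(2) by blast
  show ?thesis
    using assms(1) unfolding bump_room_def
    by (elim ex_forward conj_forward all_forward imp_forward) (use * in blast)+
qed

lemma admissible_domain_bump_room:
  fixes D S :: "(real ^ 'd::finite) set"
  assumes "admissible_domain D S \<delta>"
  shows "open D" "S \<inter> D = {}" "bump_room D S \<delta>"
proof -
  have "open D \<and> S \<inter> D = {} \<and> bump_room D S \<delta>"
    using assms unfolding admissible_domain_def
  proof (elim disjE conjE exE)
    fix I :: "'d set"
    assume *: "\<delta> < CARD('d)" "card I = \<delta>" "S = {x. \<forall>i. i \<notin> I \<longrightarrow> x $ i = 0}" "D = - S"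
    have "S = (\<Inter>i\<in>-I. {x. x $ i = 0})" using *(3) by auto
    then have "closed S"
      by (simp add: closed_INT closed_coord_eq)
    then show ?thesis
      using * bump_room_subspace[of I] by (auto simp: open_Compl)
  next
    fix P
    assume *: "2 \<le> CARD('d)" "\<delta> = CARD('d) - 2" "polytopal_domain P" "S = singular_set P" "D = - S"
    \<comment> \<open>The balls found inside \<open>P\<close> serve for the larger domain
      \<open>- S\<close> as well.\<close>
    have "P \<subseteq> - S"
      using polytopal_domain_open_bounded(1)[OF *(3)] *(4)
      by (auto simp: singular_set_eq frontier_def interior_open)
    then have "bump_room D S \<delta>"
      using bump_room_polytope[OF *(3,1)] bump_room_mono unfolding *(2,4,5) by blast
    then show ?thesis
      using * singular_set_eq(2)[of P] by (auto simp: open_Compl)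
  next
    fix P
    assume *: "2 \<le> CARD('d)" "\<delta> = CARD('d) - 2" "polytopal_domain P" "S = singular_set P" "D = P"
    then show ?thesis
      using polytopal_domain_open_bounded(1)[OF *(3)] bump_room_polytope[OF *(3,1)]
      by (auto simp: singular_set_eq frontier_def interior_open)
  qed
  then show "open D" "S \<inter> D = {}" "bump_room D S \<delta>" by auto
qed

subsection \<open>Sums of rescaled bumps\<close>

text \<open>The half side \<open>1 / (2 d)\<close> puts the box into the ball of radius
  \<open>1 / 2\<close>. A bump of scale \<open>r\<close> then lives in
  \<open>cball y (r / 2)\<close>, and around each of its points there is still a ball of radius
  \<open>r / 2\<close> inside \<open>D\<close>.\<close>

definition unit_bump :: "real ^ 'd::finite \<Rightarrow> real" where
  "unit_bump = box_bump 1 (\<chi> k. - 1 / (2 * real CARD('d))) (\<chi> k. 1 / (2 * real CARD('d)))"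

lemma unit_bump_nonneg: "0 \<le> unit_bump x"
  unfolding unit_bump_def by (rule box_bump_nonneg)

lemma unit_bump_0: "0 < unit_bump 0"
  unfolding unit_bump_def by (subst box_bump_pos_iff) (auto simp: mem_box_cart)

lemma unit_bump_eq_0:
  fixes x :: "real ^ 'd::finite"
  assumes "1 / 2 \<le> norm x"
  shows "unit_bump x = 0"
proof (rule ccontr)
  assume "unit_bump x \<noteq> 0"
  then have "0 < unit_bump x" using unit_bump_nonneg[of x] by linarith
  then have x: "- 1 / (2 * real CARD('d)) < x $ k" "x $ k < 1 / (2 * real CARD('d))" for k
    unfolding unit_bump_def by (subst (asm) box_bump_pos_iff; auto simp: mem_box_cart)+
  have "norm x \<le> (\<Sum>k\<in>UNIV. \<bar>x $ k\<bar>)" by (rule norm_le_l1_cart)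
  also have "\<dots> < (\<Sum>k\<in>(UNIV :: 'd set). 1 / (2 * real CARD('d)))"
    using x by (intro sum_strict_mono) (auto simp: abs_less_iff minus_less_iff)
  also have "\<dots> = 1 / 2" by simp
  finally show False using assms by simp
qed

lemma smooth_on_unit_bump: "smooth_on UNIV unit_bump"
  unfolding unit_bump_def by (rule smooth_on_box_bump)

abbreviation cbump :: "real ^ 'd::finite \<Rightarrow> complex" where
  "cbump x \<equiv> complex_of_real (unit_bump x)"

lemma smooth_on_cbump: "smooth_on UNIV cbump"
  by (intro smooth_on_bounded_linear[OF bounded_linear_of_real] smooth_on_unit_bump) auto

lemma test_function_cbump: "test_function UNIV (cbump :: real ^ 'd::finite \<Rightarrow> complex)"
proof -
  have "support cbump \<subseteq> (cball 0 (1 / 2) :: (real ^ 'd) set)"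
    unfolding support_def
  proof (rule closure_minimal, rule subsetI)
    fix x :: "real ^ 'd" assume "x \<in> {x. cbump x \<noteq> 0}"
    then show "x \<in> cball 0 (1 / 2)" using unit_bump_eq_0[of x] by (cases "1 / 2 \<le> norm x") auto
  qed simp
  then have "compact (support (cbump :: real ^ 'd \<Rightarrow> complex))"
    using compact_Int_closed[of "cball 0 (1 / 2)" "support (cbump :: real ^ 'd \<Rightarrow> complex)"]
    by (simp add: Int_absorb1 support_def)
  then show ?thesis
    unfolding test_function_def using smooth_on_cbump by auto
qed

lemma cbump_derivative_bounded:
  obtains B where "B > 0" "\<And>x. norm (foldr partial is cbump x) \<le> B"
proof -
  have t: "test_function UNIV (foldr partial is cbump)"
    by (rule test_function_foldr_partial[OF test_function_cbump])
  have "continuous_on UNIV (foldr partial is cbump)"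
    by (rule smooth_on_continuous[OF smooth_on_cbump])
  then show ?thesis
  proof (rule bounded_continuous_compact_support)
    show "compact (support (foldr partial is cbump))"
      using t by (simp add: test_function_def)
    show "foldr partial is cbump x = 0" if "x \<notin> support (foldr partial is cbump)" for x
      using that support_subset[of "foldr partial is cbump"] by blast
  qed (rule that)
qed

text \<open>Powers of \<open>1 / 2\<close>, so that rescaling a bump shifts dyadic frequencies by an
  integer. The exponents grow in steps of \<open>L\<close>, and \<open>i + 1\<close> makes even the
  coarsest radius as small as desired when \<open>L\<close> is large.\<close>

definition rad :: "nat \<Rightarrow> nat \<Rightarrow> real" where
  "rad L i = (1 / 2) ^ (L * (i + 1))"

lemma rad_pos: "0 < rad L i" and rad_le_1: "rad L i \<le> 1"
  by (auto simp: rad_def power_le_one)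

lemma rad_Suc: "rad L i = 2 ^ L * rad L (Suc i)"
  by (simp add: rad_def power_add power_one_over)

lemma rad_mono: "i \<le> j \<Longrightarrow> rad L j \<le> rad L i"
  unfolding rad_def by (intro power_decreasing) auto

lemma rad_less:
  assumes "i < j"
  shows "2 ^ L * rad L j \<le> rad L i"
  using rad_mono[of "Suc i" j L] assms rad_Suc[of L i] by simp

lemma rad_tendsto_0: "L > 0 \<Longrightarrow> (\<lambda>i. rad L i) \<longlonglongrightarrow> 0"
proof -
  assume L: "L > 0"
  have "(\<lambda>i. ((1 / 2 :: real) ^ L) ^ Suc i) \<longlonglongrightarrow> 0"
    using L by (intro LIMSEQ_Suc LIMSEQ_power_zero) (simp add: power_less_one_iff)
  then show ?thesis by (simp add: rad_def flip: power_mult power_add)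
qed

text \<open>The exponent may have either sign: the estimate goes through \<open>B\<close> for
  \<open>t \<ge> 0\<close> and through \<open>A\<close> for \<open>t < 0\<close>, and the maximum
  covers both. It serves for the weight \<open>\<rho>\<close> raised to the order of the derivative
  minus \<open>a\<close>.\<close>

lemma powr_le_of_between:
  fixes A B r t z :: real
  assumes "0 < A" "0 < r" "A * r \<le> z" "z \<le> B * r"
  shows "z powr t \<le> max (A powr t) (B powr t) * r powr t"
proof -
  have "0 < A * r" using assms by simp
  then have z: "0 < z" using assms(3) by linarith
  have B: "0 < B"
    using z assms(2,4) by (metis less_le_trans zero_less_mult_pos2)
  show ?thesis
  proof (cases "0 \<le> t")
    case True
    have "z powr t \<le> (B * r) powr t"
      using z True assms by (intro powr_mono2) auto
    also have "\<dots> = B powr t * r powr t"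
      using B assms by (simp add: powr_mult)
    also have "\<dots> \<le> max (A powr t) (B powr t) * r powr t"
      by (intro mult_right_mono) auto
    finally show ?thesis .
  next
    case False
    have "z powr t \<le> (A * r) powr t"
      using \<open>0 < A * r\<close> False assms by (intro powr_mono2') auto
    also have "\<dots> = A powr t * r powr t"
      using assms by (simp add: powr_mult)
    also have "\<dots> \<le> max (A powr t) (B powr t) * r powr t"
      by (intro mult_right_mono) auto
    finally show ?thesis .
  qed
qed

lemma foldr_partial_0:
  fixes x :: "real ^ 'd::finite"
  shows "foldr partial is (\<lambda>_ :: real ^ 'd. 0 :: 'b::real_normed_vector) x = 0"
proof -
  have *: "partial i (\<lambda>_ :: real ^ 'd. 0 :: 'b) = (\<lambda>_. 0)" for i
    using partial_eq_derivative[of "\<lambda>_ :: real ^ 'd. 0 :: 'b" "\<lambda>_. 0" _ i] by (simp add: fun_eq_iff)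
  have "foldr partial is (\<lambda>_ :: real ^ 'd. 0 :: 'b) = (\<lambda>_. 0)"
    by (induction "is") (simp_all add: *)
  then show ?thesis by simp
qed

text \<open>The points of a bump of scale \<open>r\<close> have distance between
  \<open>r / 2\<close> and \<open>(C + 1) * r\<close> from \<open>S\<close>. The condition on
  \<open>L\<close> makes these ranges disjoint for different scales, and \<open>M \<ge> 1\<close>
  separates the bumps of one scale. The heights \<open>c\<close> remain arbitrary here; the
  exponents enter only through their choice.\<close>

locale bump_family =
  fixes D S :: "(real ^ 'd::finite) set" and C M :: real and L :: nat
    and X :: "nat \<Rightarrow> (real ^ 'd) set" and c :: "nat \<Rightarrow> real"
  assumes open_D: "open D" and S_disjoint: "S \<inter> D = {}"
    and C: "0 < C" and M: "1 \<le> M" and L: "2 * (C + 1) < 2 ^ L"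
    and c_pos: "0 < c i"
    and finite_X: "finite (X i)"
    and ball_X: "y \<in> X i \<Longrightarrow> ball y (rad L i) \<subseteq> D"
    and near_X: "y \<in> X i \<Longrightarrow> \<exists>s\<in>S. dist y s \<le> C * rad L i"
    and sep_X: "\<lbrakk>y \<in> X i; z \<in> X i; y \<noteq> z\<rbrakk> \<Longrightarrow> M * rad L i < dist y z"
begin

abbreviation r :: "nat \<Rightarrow> real" where "r \<equiv> rad L"

abbreviation Q :: "nat \<Rightarrow> real ^ 'd \<Rightarrow> (real ^ 'd) set" where "Q i y \<equiv> cball y (r i / 2)"

lemma L_pos: "0 < L"
proof (rule ccontr)
  assume "\<not> 0 < L"
  then show False using L C by simp
qed

lemma ball_Q:
  assumes "y \<in> X i" "x \<in> Q i y"
  shows "ball x (r i / 2) \<subseteq> D"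
proof -
  have "ball x (r i / 2) \<subseteq> ball y (r i)"
  proof
    fix z assume "z \<in> ball x (r i / 2)"
    then show "z \<in> ball y (r i)"
      using assms(2) dist_triangle[of y z x] by simp
  qed
  then show ?thesis using ball_X[OF assms(1)] by blast
qed

lemma Q_subset_D: "y \<in> X i \<Longrightarrow> Q i y \<subseteq> D"
proof
  fix x assume *: "y \<in> X i" "x \<in> Q i y"
  have "x \<in> ball x (r i / 2)" using rad_pos[of L i] by simp
  then show "x \<in> D" using ball_Q[OF *] by blast
qed

lemma near_Q:
  assumes "y \<in> X i" "x \<in> Q i y"
  shows "\<exists>s\<in>S. dist x s \<le> (C + 1) * r i"
proof -
  obtain s where s: "s \<in> S" "dist y s \<le> C * r i"
    using near_X[OF assms(1)] by blast
  have "dist x s \<le> C * r i + r i / 2"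
    using assms(2) s(2) dist_triangle[of x s y] by (simp add: dist_commute)
  also have "\<dots> \<le> (C + 1) * r i"
    using rad_pos[of L i] by (simp add: algebra_simps)
  finally show ?thesis using s(1) by blast
qed

lemma infdist_Q:
  assumes "y \<in> X i" "x \<in> Q i y"
  shows "r i / 2 \<le> infdist x S" "infdist x S \<le> (C + 1) * r i"
proof -
  obtain s where s: "s \<in> S" "dist x s \<le> (C + 1) * r i"
    using near_Q[OF assms] by blast
  show "infdist x S \<le> (C + 1) * r i"
    using infdist_le[OF s(1), of x] s(2) by linarith
  have "r i / 2 \<le> dist x s'" if "s' \<in> S" for s'
    using ball_Q[OF assms] that S_disjoint by (meson disjoint_iff mem_ball not_le subsetD)
  then have "r i / 2 \<le> (INF s'\<in>S. dist x s')"
    using s(1) by (intro cINF_greatest) blast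
  then show "r i / 2 \<le> infdist x S"
    using s(1) infdist_notempty[of S x] by (metis empty_iff)
qed

lemma Q_unique:
  assumes "y \<in> X i" "x \<in> Q i y" "z \<in> X j" "x \<in> Q j z"
  shows "i = j" "y = z"
proof -
  have no: False if "i < j" "r i / 2 \<le> (C + 1) * r j" for i j
  proof -
    have "2 ^ L * r j \<le> 2 * (C + 1) * r j"
      using rad_less[OF that(1), of L] that(2) by (simp add: algebra_simps)
    then show False using L rad_pos[of L j] by simp
  qed
  show ij: "i = j"
  proof (rule ccontr)
    assume "i \<noteq> j"
    then have "i < j \<or> j < i" by linarith
    moreover have "r i / 2 \<le> (C + 1) * r j" "r j / 2 \<le> (C + 1) * r i"
      using infdist_Q[OF assms(1,2)] infdist_Q[OF assms(3,4)] by linarith+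
    ultimately show False using no by blast
  qed
  show "y = z"
  proof (rule ccontr)
    assume "y \<noteq> z"
    then have "M * r i < dist y z"
      using sep_X[of y i z] assms ij by simp
    also have "\<dots> \<le> r i"
      using assms(2,4) ij dist_triangle[of y z x] by (simp add: dist_commute)
    finally show False using M rad_pos[of L i] by simp
  qed
qed

definition bump :: "nat \<Rightarrow> real ^ 'd \<Rightarrow> real ^ 'd \<Rightarrow> complex" where
  "bump i y x = of_real (c i) * cbump ((1 / r i) *\<^sub>R (x - y))"

lemma bump_eq_0:
  assumes "x \<notin> Q i y"
  shows "bump i y x = 0"
proof -
  have "r i / 2 \<le> norm (x - y)"
    using assms by (simp add: dist_norm norm_minus_commute)
  then have "1 / 2 \<le> norm ((1 / r i) *\<^sub>R (x - y))"
    using rad_pos[of L i] by (simp add: pos_le_divide_eq)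
  from unit_bump_eq_0[OF this] show ?thesis
    by (simp add: bump_def)
qed

lemma foldr_partial_bump:
  "foldr partial is (bump i y) x = of_real (c i * (1 / r i) ^ length is) * foldr partial is cbump ((1 / r i) *\<^sub>R (x - y))"
proof -
  let ?g = "\<lambda>x. cbump ((1 / r i) *\<^sub>R (x - y))"
  have g: "smooth_on UNIV ?g" by (rule smooth_on_affine[OF smooth_on_cbump])
  have "foldr partial is (bump i y) = (\<lambda>x. of_real (c i) * foldr partial is ?g x)"
  proof (induction "is")
    case (Cons j "is")
    have "bounded_linear (\<lambda>z. of_real (c i) * z :: complex)"
      by (rule bounded_linear_mult_right)
    then have "partial j (\<lambda>x. of_real (c i) * foldr partial is ?g x) x = of_real (c i) * partial j (foldr partial is ?g) x" for x
      by (rule partial_bounded_linear) (use smooth_on_differentiable_at[OF g] in auto)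
    then show ?case using Cons by auto
  qed (simp add: bump_def fun_eq_iff)
  moreover have "foldr partial is ?g x = (1 / r i) ^ length is *\<^sub>R foldr partial is cbump ((1 / r i) *\<^sub>R (x - y))"
    by (rule smooth_on_affine(2)[OF smooth_on_cbump])
  ultimately show ?thesis
    by (simp add: scaleR_conv_of_real)
qed

lemma smooth_on_bump: "smooth_on UNIV (bump i y)"
  unfolding bump_def[abs_def]
  by (intro smooth_on_bounded_linear[OF bounded_linear_mult_right] smooth_on_affine(1)[OF smooth_on_cbump]) auto

text \<open>The sum has at most one term, since the balls \<open>Q i y\<close> are pairwise disjoint.\<close>

definition bump_sum :: "real ^ 'd \<Rightarrow> complex" where
  "bump_sum x = (\<Sum>(i, y) | y \<in> X i \<and> x \<in> Q i y. bump i y x)"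

lemma bump_sum_eq:
  assumes "y \<in> X i" "x \<in> Q i y"
  shows "bump_sum x = bump i y x"
proof -
  have "(j, z) = (i, y)" if "z \<in> X j" "x \<in> Q j z" for j z
    using Q_unique[OF assms that] by simp
  then have "{(j, z). z \<in> X j \<and> x \<in> Q j z} = {(i, y)}"
    using assms by blast
  then have "bump_sum x = (\<Sum>(i, y)\<in>{(i, y)}. bump i y x)"
    unfolding bump_sum_def by (simp only:)
  then show ?thesis by simp
qed

lemma bump_sum_eq_0:
  assumes "\<And>i y. y \<in> X i \<Longrightarrow> x \<notin> Q i y"
  shows "bump_sum x = 0"
proof -
  have "{(j, z). z \<in> X j \<and> x \<in> Q j z} = {}"
    using assms by blast
  then show ?thesis by (simp only: bump_sum_def sum.empty)
qed

text \<open>Local finiteness in \<open>D\<close>. If \<open>ball x e \<subseteq> D\<close>, a bump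
  of scale \<open>r\<close> that comes within \<open>e / 2\<close> of \<open>x\<close> has a point
  there whose distance from \<open>S\<close> is at least \<open>e / 2\<close> and at most
  \<open>(C + 1) * r\<close>. This leaves finitely many bumps, and those not containing
  \<open>x\<close> have a closed union that can be removed.\<close>

lemma neighbourhood_without_other_bumps:
  assumes "x \<in> D"
  obtains V where "open V" "x \<in> V" "\<And>i y z. \<lbrakk>y \<in> X i; z \<in> V; z \<in> Q i y\<rbrakk> \<Longrightarrow> x \<in> Q i y"
proof -
  obtain e where e: "e > 0" "ball x e \<subseteq> D"
    using assms open_D openE by blast
  define T where "T = (SIGMA i : {i. e / (2 * (C + 1)) \<le> r i}. X i)"
  have "e / (2 * (C + 1)) > 0" using e C by simp
  then have "\<forall>\<^sub>F i in sequentially. r i < e / (2 * (C + 1))"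
    using rad_tendsto_0[OF L_pos] by (intro order_tendstoD)
  then have "finite {i. e / (2 * (C + 1)) \<le> r i}"
    by (simp only: eventually_cofinite cofinite_eq_sequentially[symmetric] not_less)
  then have fT: "finite T"
    unfolding T_def by (intro finite_SigmaI finite_X)
  define V where "V = ball x (e / 2) - (\<Union>(i, y)\<in>{(i, y)\<in>T. x \<notin> Q i y}. Q i y)"
  have "open V"
    unfolding V_def using fT
    by (intro open_Diff closed_UN) (auto intro: finite_subset[OF _ fT])
  moreover have "x \<in> V" using e by (auto simp: V_def)
  moreover have "x \<in> Q i y" if yz: "y \<in> X i" "z \<in> V" "z \<in> Q i y" for i y z
  proof -
    obtain s where s: "s \<in> S" "dist z s \<le> (C + 1) * r i"
      using near_Q[OF yz(1,3)] by blast
    then have "s \<notin> ball x e" using e(2) S_disjoint by blast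
    moreover have "dist x z < e / 2" using yz(2) by (simp add: V_def)
    ultimately have "e / 2 \<le> (C + 1) * r i"
      using s(2) dist_triangle[of x s z] by (simp add: dist_commute)
    then have "(i, y) \<in> T"
      using yz(1) C by (simp add: T_def field_simps)
    then show ?thesis using yz(2,3) by (auto simp: V_def)
  qed
  ultimately show ?thesis by (rule that)
qed

lemma bump_sum_locally:
  assumes "x \<in> D"
  shows "\<lbrakk>y \<in> X i; x \<in> Q i y\<rbrakk> \<Longrightarrow> \<exists>V. open V \<and> x \<in> V \<and> (\<forall>z\<in>V. bump_sum z = bump i y z)"
    and "(\<And>i y. y \<in> X i \<Longrightarrow> x \<notin> Q i y) \<Longrightarrow> \<exists>V. open V \<and> x \<in> V \<and> (\<forall>z\<in>V. bump_sum z = 0)"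
proof -
  obtain V where V: "open V" "x \<in> V" "\<And>i y z. \<lbrakk>y \<in> X i; z \<in> V; z \<in> Q i y\<rbrakk> \<Longrightarrow> x \<in> Q i y"
    using neighbourhood_without_other_bumps[OF assms] by blast
  show "\<exists>V. open V \<and> x \<in> V \<and> (\<forall>z\<in>V. bump_sum z = bump i y z)" if xy: "y \<in> X i" "x \<in> Q i y"
  proof (intro exI[of _ V] conjI V ballI)
    fix z assume z: "z \<in> V"
    show "bump_sum z = bump i y z"
    proof (cases "z \<in> Q i y")
      case True
      then show ?thesis by (rule bump_sum_eq[OF xy(1)])
    next
      case False
      have "z \<notin> Q j y'" if "y' \<in> X j" for j y'
        using V(3)[OF that z] Q_unique[OF xy that] False by blast
      then show ?thesis
        using bump_sum_eq_0 bump_eq_0[OF False] by simp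
    qed
  qed
  show "\<exists>V. open V \<and> x \<in> V \<and> (\<forall>z\<in>V. bump_sum z = 0)" if "\<And>i y. y \<in> X i \<Longrightarrow> x \<notin> Q i y"
    proof (intro exI[of _ V] conjI V ballI)
    fix z assume z: "z \<in> V"
    show "bump_sum z = 0"
      by (rule bump_sum_eq_0) (use V(3)[OF _ z] that in blast)
  qed
qed

lemma smooth_on_bump_sum: "smooth_on D bump_sum"
proof (rule smooth_on_local)
  fix x assume x: "x \<in> D"
  show "\<exists>V. open V \<and> x \<in> V \<and> smooth_on V bump_sum"
  proof (cases "\<exists>i y. y \<in> X i \<and> x \<in> Q i y")
    case True
    then obtain i y where "y \<in> X i" "x \<in> Q i y" by blast
    from bump_sum_locally(1)[OF x this]
    obtain V where V0: "open V \<and> x \<in> V \<and> (\<forall>z\<in>V. bump_sum z = bump i y z)" by (rule exE)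
    then have V: "open V" "x \<in> V" "\<And>z. z \<in> V \<Longrightarrow> bump_sum z = bump i y z" by simp_all
    have "smooth_on V bump_sum"
      by (rule smooth_on_cong[OF V(1) V(3)[symmetric] smooth_on_subset[OF smooth_on_bump subset_UNIV]])
    then show ?thesis using V by blast
  next
    case False
    then have no: "x \<notin> Q i y" if "y \<in> X i" for i y using that by blast
    from bump_sum_locally(2)[OF x no]
    obtain V where V0: "open V \<and> x \<in> V \<and> (\<forall>z\<in>V. bump_sum z = 0)" by (rule exE)
    then have V: "open V" "x \<in> V" "\<And>z. z \<in> V \<Longrightarrow> bump_sum z = 0" by simp_all
    have "smooth_on V bump_sum"
      by (rule smooth_on_cong[OF V(1) V(3)[symmetric] smooth_on_const])
    then show ?thesis using V by blast
  qed
qed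

lemma foldr_partial_bump_sum:
  assumes "x \<in> D"
  shows "\<lbrakk>y \<in> X i; x \<in> Q i y\<rbrakk> \<Longrightarrow> foldr partial is bump_sum x = foldr partial is (bump i y) x"
    and "(\<And>i y. y \<in> X i \<Longrightarrow> x \<notin> Q i y) \<Longrightarrow> foldr partial is bump_sum x = 0"
proof -
  show "foldr partial is bump_sum x = foldr partial is (bump i y) x" if "y \<in> X i" "x \<in> Q i y"
  proof -
    from bump_sum_locally(1)[OF assms \<open>y \<in> X i\<close> \<open>x \<in> Q i y\<close>]
    obtain V where V0: "open V \<and> x \<in> V \<and> (\<forall>z\<in>V. bump_sum z = bump i y z)" by (rule exE)
    then have V: "open V" "x \<in> V" "\<And>z. z \<in> V \<Longrightarrow> bump_sum z = bump i y z" by simp_all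
    show ?thesis by (rule foldr_partial_cong_open[OF V])
  qed
  show "foldr partial is bump_sum x = 0" if no: "\<And>i y. y \<in> X i \<Longrightarrow> x \<notin> Q i y"
  proof -
    from bump_sum_locally(2)[OF assms no]
    obtain V where V0: "open V \<and> x \<in> V \<and> (\<forall>z\<in>V. bump_sum z = 0)" by (rule exE)
    then have V: "open V" "x \<in> V" "\<And>z. z \<in> V \<Longrightarrow> bump_sum z = 0" by simp_all
    have "foldr partial is bump_sum x = foldr partial is (\<lambda>_. 0) x"
      by (rule foldr_partial_cong_open[OF V])
    then show ?thesis by (simp only: foldr_partial_0)
  qed
qed

lemma regularized_distance_Q:
  assumes "regularized_distance D S \<rho>"
  obtains A B where "0 < A" "0 < B"
    "\<And>i y x. \<lbrakk>y \<in> X i; x \<in> Q i y\<rbrakk> \<Longrightarrow> A * r i \<le> \<rho> x \<and> \<rho> x \<le> B * r i"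
proof -
  obtain c1 c2 where c12: "0 < c1" "0 < c2"
    "\<And>x. x \<in> D \<Longrightarrow> c1 * min 1 (infdist x S) \<le> \<rho> x \<and> \<rho> x \<le> c2 * min 1 (infdist x S)"
    using assms unfolding regularized_distance_def by blast
  show ?thesis
  proof (rule that[of "c1 / 2" "c2 * (C + 1)"])
    fix i y x assume *: "y \<in> X i" "x \<in> Q i y"
    have "r i / 2 \<le> min 1 (infdist x S)"
      using infdist_Q(1)[OF *] rad_le_1[of L i] rad_pos[of L i] by linarith
    then have "c1 * (r i / 2) \<le> c1 * min 1 (infdist x S)"
      using c12 by (intro mult_left_mono) auto
    moreover have "c2 * min 1 (infdist x S) \<le> c2 * ((C + 1) * r i)"
      using infdist_Q(2)[OF *] c12 by (intro mult_left_mono) auto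
    moreover have "x \<in> D" using Q_subset_D * by blast
    ultimately show "c1 / 2 * r i \<le> \<rho> x \<and> \<rho> x \<le> c2 * (C + 1) * r i"
      using c12(3)[of x] by simp
  qed (use c12 C in auto)
qed

text \<open>\<open>B i y\<close> is the whole ball \<open>Q i y\<close> in the upper estimate of the
  Kondratiev norm, and a smaller concentric ball, on which the bump is large, in the lower estimate
  of the weighted norm.\<close>

lemma suminf_indicator_bumps:
  fixes f :: "nat \<Rightarrow> ennreal"
  assumes "\<And>i y. y \<in> X i \<Longrightarrow> B i y \<subseteq> Q i y"
  shows "\<lbrakk>y \<in> X i; x \<in> B i y\<rbrakk> \<Longrightarrow> (\<Sum>j. \<Sum>z\<in>X j. f j * indicator (B j z) x) = f i"
    and "(\<And>i y. y \<in> X i \<Longrightarrow> x \<notin> B i y) \<Longrightarrow> (\<Sum>j. \<Sum>z\<in>X j. f j * indicator (B j z) x) = 0"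
proof -
  show "(\<Sum>j. \<Sum>z\<in>X j. f j * indicator (B j z) x) = f i" if xy: "y \<in> X i" "x \<in> B i y"
  proof -
    have *: "x \<notin> B j z" if "z \<in> X j" "(j, z) \<noteq> (i, y)" for j z
      using Q_unique[of y i x z j] assms xy that by blast
    have "(\<Sum>j. \<Sum>z\<in>X j. f j * indicator (B j z) x) = (\<Sum>j\<in>{i}. \<Sum>z\<in>X j. f j * indicator (B j z) x)"
      using * by (intro suminf_finite) (auto intro!: sum.neutral)
    also have "\<dots> = (\<Sum>z\<in>X i. f i * indicator (B i z) x)"
      by simp
    also have "\<dots> = (\<Sum>z\<in>{y}. f i * indicator (B i z) x)"
      using * finite_X[of i] xy by (intro sum.mono_neutral_right ballI) auto
    finally show ?thesis using xy by simp
  qed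
  show "(\<Sum>j. \<Sum>z\<in>X j. f j * indicator (B j z) x) = 0" if "\<And>i y. y \<in> X i \<Longrightarrow> x \<notin> B i y"
    using that by simp
qed

lemma nn_integral_suminf_indicator_bumps:
  fixes f :: "nat \<Rightarrow> real"
  assumes "\<And>i y. y \<in> X i \<Longrightarrow> B i y \<in> sets borel" and "\<And>i. 0 \<le> f i"
    and "\<And>i y. y \<in> X i \<Longrightarrow> emeasure lborel (B i y) = ennreal (v * r i ^ CARD('d))" and "0 \<le> v"
  shows "(\<integral>\<^sup>+x. (\<Sum>j. \<Sum>z\<in>X j. ennreal (f j) * indicator (B j z) x) \<partial>lebesgue) =
    (\<Sum>j. ennreal (v * (real (card (X j)) * f j * r j ^ CARD('d))))"
proof -
  have [measurable]: "B j z \<in> sets lebesgue" if "z \<in> X j" for j z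
    using assms(1)[OF that] by (intro sets_completionI_sets) simp
  have "(\<integral>\<^sup>+x. (\<Sum>j. \<Sum>z\<in>X j. ennreal (f j) * indicator (B j z) x) \<partial>lebesgue) =
      (\<Sum>j. \<Sum>z\<in>X j. \<integral>\<^sup>+x. ennreal (f j) * indicator (B j z) x \<partial>lebesgue)"
    by (simp add: nn_integral_suminf nn_integral_sum)
  also have "\<dots> = (\<Sum>j. \<Sum>z\<in>X j. ennreal (f j * (v * r j ^ CARD('d))))"
    using assms by (intro suminf_cong sum.cong refl)
      (simp add: nn_integral_cmult ennreal_mult rad_pos less_imp_le)
  also have "\<dots> = (\<Sum>j. ennreal (v * (real (card (X j)) * f j * r j ^ CARD('d))))"
  proof (intro suminf_cong)
    fix j
    have "0 \<le> f j * (v * r j ^ CARD('d))"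
      using assms(2,4) rad_pos[of L j] by simp
    then show "(\<Sum>z\<in>X j. ennreal (f j * (v * r j ^ CARD('d)))) = ennreal (v * (real (card (X j)) * f j * r j ^ CARD('d)))"
      by (subst sum_ennreal) (simp_all add: mult_ac)
  qed
  finally show ?thesis .
qed

end

section \<open>The Kondratiev norm and the weighted norm of the bump sum\<close>

lemma epowr_less_top: "x < \<infinity> \<Longrightarrow> epowr x q < \<infinity>"
  by (auto simp: epowr_def)

context bump_family
begin

text \<open>A derivative of order \<open>k\<close> of a bump is of size
  \<open>c i * r i powr (- k)\<close>, and the weight belonging to it is of size
  \<open>r i powr (k - a)\<close>. The order cancels, so every term of the norm obeys the same bound
  \<open>c i * r i powr (- a)\<close> up to a constant.\<close>

lemma bump_sum_in_kondratiev_space: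
  assumes \<rho>: "regularized_distance D S \<rho>" and p: "1 < p"
    and sm: "summable (\<lambda>i. real (card (X i)) * c i powr p * r i powr (real CARD('d) - a * p))"
  shows "bump_sum \<in> kondratiev_space D \<rho> m a p"
proof -
  obtain A B where AB: "0 < A" "0 < B"
    "\<And>i y x. \<lbrakk>y \<in> X i; x \<in> Q i y\<rbrakk> \<Longrightarrow> A * r i \<le> \<rho> x \<and> \<rho> x \<le> B * r i"
    using regularized_distance_Q[OF \<rho>] by blast
  have fin: "(\<integral>\<^sup>+x\<in>D. ennreal (norm (\<rho> x powr (real (multi_order \<alpha>) - a) *\<^sub>R weak_deriv D \<alpha> bump_sum x) powr p) \<partial>lebesgue) < \<infinity>" for \<alpha>
  proof -
    define js where "js = rev (multi_list \<alpha>)"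
    have ljs: "length js = multi_order \<alpha>" by (simp add: js_def length_multi_list)
    define t where "t = real (multi_order \<alpha>) - a"
    obtain b where b: "b > 0" "\<And>x. norm (foldr partial js cbump x) \<le> b"
      using cbump_derivative_bounded[of js] by blast
    \<comment> \<open>\<open>A\<close> and \<open>B\<close> compare \<open>\<rho>\<close> with the
      scale, and \<open>b\<close> bounds the derivative of the unit bump.\<close>
    define E where "E = max (A powr t) (B powr t) * b"
    have E: "0 \<le> E" using b(1) by (simp add: E_def le_max_iff_disj)
    let ?f = "\<lambda>i. (E * c i * r i powr (- a)) powr p"
    have bound: "norm (\<rho> x powr t *\<^sub>R foldr partial js bump_sum x) powr p \<le> ?f i"
      if xy: "y \<in> X i" "x \<in> Q i y" for x i y
    proof (rule powr_mono2)
      have x: "x \<in> D" using Q_subset_D xy by blast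
      have "norm (foldr partial js bump_sum x) = c i * (1 / r i) ^ length js * norm (foldr partial js cbump ((1 / r i) *\<^sub>R (x - y)))"
        unfolding foldr_partial_bump_sum(1)[OF x xy] foldr_partial_bump
        using c_pos[of i] rad_pos[of L i] by (simp add: norm_mult norm_power norm_divide)
      also have "\<dots> \<le> c i * (1 / r i) ^ length js * b"
        using b c_pos[of i] rad_pos[of L i] by (intro mult_left_mono) auto
      also have "(1 / r i) ^ length js = r i powr (- real (multi_order \<alpha>))"
        using rad_pos[of L i] by (simp add: ljs powr_minus powr_realpow power_one_over inverse_eq_divide)
      finally have 1: "norm (foldr partial js bump_sum x) \<le> c i * r i powr (- real (multi_order \<alpha>)) * b" .
      have 2: "\<rho> x powr t \<le> max (A powr t) (B powr t) * r i powr t"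
        using AB(3)[OF xy] by (intro powr_le_of_between AB rad_pos) auto
      have "norm (\<rho> x powr t *\<^sub>R foldr partial js bump_sum x) = \<rho> x powr t * norm (foldr partial js bump_sum x)"
        by simp
      also have "\<dots> \<le> (max (A powr t) (B powr t) * r i powr t) * (c i * r i powr (- real (multi_order \<alpha>)) * b)"
        by (intro mult_mono 1 2) (auto simp: le_max_iff_disj)
      also have "\<dots> = E * c i * (r i powr t * r i powr (- real (multi_order \<alpha>)))"
        by (simp add: E_def mult_ac)
      also have "r i powr t * r i powr (- real (multi_order \<alpha>)) = r i powr (- a)"
        by (simp add: t_def flip: powr_add)
      finally show "norm (\<rho> x powr t *\<^sub>R foldr partial js bump_sum x) \<le> E * c i * r i powr (- a)" .
    qed (use p in auto)
    have "(\<integral>\<^sup>+x\<in>D. ennreal (norm (\<rho> x powr (real (multi_order \<alpha>) - a) *\<^sub>R weak_deriv D \<alpha> bump_sum x) powr p) \<partial>lebesgue)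
       \<le> (\<integral>\<^sup>+x. (\<Sum>j. \<Sum>z\<in>X j. ennreal (?f j) * indicator (Q j z) x) \<partial>lebesgue)"
    proof (rule nn_integral_mono_AE)
      have "AE x in lebesgue. x \<in> D \<longrightarrow> weak_deriv D \<alpha> bump_sum x = foldr partial js bump_sum x"
        unfolding js_def by (rule weak_deriv_smooth[OF open_D smooth_on_bump_sum])
      then show "AE x in lebesgue. ennreal (norm (\<rho> x powr (real (multi_order \<alpha>) - a) *\<^sub>R weak_deriv D \<alpha> bump_sum x) powr p) * indicator D x
          \<le> (\<Sum>j. \<Sum>z\<in>X j. ennreal (?f j) * indicator (Q j z) x)"
      proof eventually_elim
        case (elim x)
        show ?case
        proof (cases "x \<in> D \<and> (\<exists>i y. y \<in> X i \<and> x \<in> Q i y)")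
          case True
          then obtain i y where xy: "y \<in> X i" "x \<in> Q i y" by blast
          have "(\<Sum>j. \<Sum>z\<in>X j. ennreal (?f j) * indicator (Q j z) x) = ennreal (?f i)"
            by (rule suminf_indicator_bumps(1)[of Q, OF subset_refl xy])
          then show ?thesis
            using True bound[OF xy] elim by (simp add: t_def ennreal_leI)
        next
          case False
          then show ?thesis
            using elim foldr_partial_bump_sum(2)[of x js] p by (cases "x \<in> D") auto
        qed
      qed
    qed
    also have "\<dots> = (\<Sum>j. ennreal (unit_ball_vol (real CARD('d)) / 2 ^ CARD('d) * (real (card (X j)) * ?f j * r j ^ CARD('d))))"
      using rad_pos[of L]
      by (intro nn_integral_suminf_indicator_bumps) (auto simp: emeasure_cball less_imp_le power_divide)
    also have "\<dots> < \<infinity>"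
    proof -
      have "summable (\<lambda>j. unit_ball_vol (real CARD('d)) / 2 ^ CARD('d) * E powr p *
          (real (card (X j)) * c j powr p * r j powr (real CARD('d) - a * p)))"
        by (intro summable_mult sm)
      also have "(\<lambda>j. unit_ball_vol (real CARD('d)) / 2 ^ CARD('d) * E powr p *
          (real (card (X j)) * c j powr p * r j powr (real CARD('d) - a * p))) =
        (\<lambda>j. unit_ball_vol (real CARD('d)) / 2 ^ CARD('d) * (real (card (X j)) * ?f j * r j ^ CARD('d)))"
      proof
        fix j
        have "?f j * r j ^ CARD('d) = E powr p * c j powr p * r j powr (real CARD('d) - a * p)"
        proof -
          have "?f j = E powr p * c j powr p * r j powr (- a * p)"
            using E c_pos[of j] rad_pos[of L j] by (simp only: powr_mult powr_powr)
          moreover have "r j ^ CARD('d) = r j powr real CARD('d)"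
            using rad_pos[of L j] by (simp add: powr_realpow)
          moreover have "r j powr (- a * p) * r j powr real CARD('d) = r j powr (real CARD('d) - a * p)"
            by (simp flip: powr_add)
          ultimately show ?thesis by (simp only: mult.assoc)
        qed
        then show "unit_ball_vol (real CARD('d)) / 2 ^ CARD('d) * E powr p *
          (real (card (X j)) * c j powr p * r j powr (real CARD('d) - a * p)) =
          unit_ball_vol (real CARD('d)) / 2 ^ CARD('d) * (real (card (X j)) * ?f j * r j ^ CARD('d))"
          by (simp add: mult_ac)
      qed
      finally have "summable (\<lambda>j. unit_ball_vol (real CARD('d)) / 2 ^ CARD('d) * (real (card (X j)) * ?f j * r j ^ CARD('d)))" .
      then have "(\<Sum>j. ennreal (unit_ball_vol (real CARD('d)) / 2 ^ CARD('d) * (real (card (X j)) * ?f j * r j ^ CARD('d)))) \<noteq> top"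
        by (rule ennreal_suminf_neq_top) (simp add: less_imp_le[OF rad_pos])
      then show ?thesis by (simp add: less_top)
    qed
    finally show ?thesis .
  qed
  have "kondratiev_norm D \<rho> m a p bump_sum < \<infinity>"
    unfolding kondratiev_norm_def
  proof (rule epowr_less_top)
    let ?A = "{\<alpha> :: 'd \<Rightarrow> nat. multi_order \<alpha> \<le> m}"
    show "(\<Sum>\<alpha> | multi_order \<alpha> \<le> m. \<integral>\<^sup>+x\<in>D. ennreal (norm (\<rho> x powr (real (multi_order \<alpha>) - a) *\<^sub>R weak_deriv D \<alpha> bump_sum x) powr p) \<partial>lebesgue) < \<infinity>"
      using fin by (cases "finite ?A") (simp_all add: ennreal_sum_less_top less_top sum.infinite)
  qed
  then show ?thesis
    unfolding kondratiev_space_def using has_weak_deriv_smooth[OF open_D smooth_on_bump_sum] by blast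
qed

text \<open>Near its centre, on a fixed fraction of its volume, a bump exceeds half of its central
  value, and there the weight is at least a multiple of \<open>r i powr (- m)\<close>.\<close>

lemma Lp_norm_bump_sum_infinite:
  assumes \<rho>: "regularized_distance D S \<rho>" and \<tau>: "0 < \<tau>"
    and div: "\<not> summable (\<lambda>i. real (card (X i)) * c i powr \<tau> * r i powr (real CARD('d) - real m * \<tau>))"
  shows "Lp_norm D \<tau> (\<lambda>x. ennreal (norm (\<rho> x powr (- real m) *\<^sub>R bump_sum x))) = \<infinity>"
proof -
  obtain A B where AB: "0 < A" "0 < B"
    "\<And>i y x. \<lbrakk>y \<in> X i; x \<in> Q i y\<rbrakk> \<Longrightarrow> A * r i \<le> \<rho> x \<and> \<rho> x \<le> B * r i"
    using regularized_distance_Q[OF \<rho>] by blast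
  have "continuous_on UNIV (unit_bump :: real ^ 'd \<Rightarrow> real)"
    using smooth_on_continuous[OF smooth_on_unit_bump, of "[]"] by simp
  then have "open ((unit_bump :: real ^ 'd \<Rightarrow> real) -` {unit_bump (0 :: real ^ 'd) / 2 <..})"
    by (rule open_vimage[OF open_greaterThan])
  moreover have "0 \<in> (unit_bump :: real ^ 'd \<Rightarrow> real) -` {unit_bump (0 :: real ^ 'd) / 2 <..}"
    using unit_bump_0 by simp
  ultimately obtain e0 where e0: "e0 > 0"
    "ball 0 e0 \<subseteq> (unit_bump :: real ^ 'd \<Rightarrow> real) -` {unit_bump (0 :: real ^ 'd) / 2 <..}"
    by (rule openE)
  \<comment> \<open>\<open>e0\<close> comes from continuity at the centre; \<open>1 / 2\<close>
    keeps the ball inside \<open>Q i y\<close>.\<close>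
  define e where "e = min e0 (1 / 2)"
  have e: "0 < e" "e \<le> 1 / 2" "\<And>x :: real ^ 'd. norm x < e \<Longrightarrow> unit_bump (0 :: real ^ 'd) / 2 < unit_bump x"
    using e0 by (auto simp: e_def subset_iff dist_norm)
  let ?B = "\<lambda>i y. ball y (e * r i)"
  have BQ: "?B i y \<subseteq> Q i y" for i y
  proof
    fix x assume "x \<in> ?B i y"
    moreover have "e * r i \<le> 1 / 2 * r i"
      using mult_right_mono[OF e(2), of "r i"] rad_pos[of L i] by simp
    ultimately show "x \<in> Q i y" by simp
  qed
  \<comment> \<open>The exponent is not positive, so it is the upper bound \<open>B\<close> for
    \<open>\<rho>\<close> that bounds the weight from below.\<close>
  define k where "k = B powr (- real m) * (unit_bump (0 :: real ^ 'd) / 2)"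
  have k: "0 < k" using AB unit_bump_0[where 'a = 'd] by (simp add: k_def)
  let ?f = "\<lambda>i. (k * c i * r i powr (- real m)) powr \<tau>"
  have lower: "?f i \<le> norm (\<rho> x powr (- real m) *\<^sub>R bump_sum x) powr \<tau>"
    if xy: "y \<in> X i" "x \<in> ?B i y" for x i y
  proof (rule powr_mono2)
    have Q: "x \<in> Q i y" using BQ xy by blast
    have "norm ((1 / r i) *\<^sub>R (x - y)) < e"
    proof -
      have "norm ((1 / r i) *\<^sub>R (x - y)) = norm (x - y) / r i"
        using rad_pos[of L i] by (simp only: norm_scaleR) simp
      then show ?thesis
        using xy(2) rad_pos[of L i] by (simp add: dist_norm norm_minus_commute pos_divide_less_eq)
    qed
    then have "unit_bump (0 :: real ^ 'd) / 2 \<le> unit_bump ((1 / r i) *\<^sub>R (x - y))"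
      using e(3) by (simp add: less_imp_le)
    then have "c i * (unit_bump (0 :: real ^ 'd) / 2) \<le> c i * unit_bump ((1 / r i) *\<^sub>R (x - y))"
      using c_pos[of i] by (intro mult_left_mono) auto
    also have "\<dots> = norm (bump_sum x)"
      unfolding bump_sum_eq[OF xy(1) Q] bump_def
      using c_pos[of i] by (simp only: norm_mult norm_of_real abs_of_pos abs_of_nonneg[OF unit_bump_nonneg])
    finally have 1: "c i * (unit_bump (0 :: real ^ 'd) / 2) \<le> norm (bump_sum x)" .
    have \<rho>x: "0 < \<rho> x" "\<rho> x \<le> B * r i"
      using AB(1) AB(3)[OF xy(1) Q] mult_pos_pos[OF AB(1) rad_pos[of L i]] by auto
    then have "(B * r i) powr (- real m) \<le> \<rho> x powr (- real m)"
      by (intro powr_mono2') auto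
    then have 2: "B powr (- real m) * r i powr (- real m) \<le> \<rho> x powr (- real m)"
      using AB(2) rad_pos[of L i] by (simp add: powr_mult)
    have "(B powr (- real m) * r i powr (- real m)) * (c i * (unit_bump (0 :: real ^ 'd) / 2)) \<le>
        \<rho> x powr (- real m) * norm (bump_sum x)"
      using c_pos[of i] unit_bump_nonneg[of "0 :: real ^ 'd"] by (intro mult_mono 1 2) (auto simp: less_imp_le)
    then show "k * c i * r i powr (- real m) \<le> norm (\<rho> x powr (- real m) *\<^sub>R bump_sum x)"
      by (simp add: k_def mult_ac)
    show "0 \<le> k * c i * r i powr (- real m)"
      using k c_pos[of i] by simp
  qed (use \<tau> in simp)
  have "(\<Sum>j. ennreal (unit_ball_vol (real CARD('d)) * e ^ CARD('d) * (real (card (X j)) * ?f j * r j ^ CARD('d)))) =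
      (\<integral>\<^sup>+x. (\<Sum>j. \<Sum>z\<in>X j. ennreal (?f j) * indicator (?B j z) x) \<partial>lebesgue)"
    using rad_pos[of L] e
    by (intro nn_integral_suminf_indicator_bumps[symmetric])
      (auto simp: emeasure_ball less_imp_le power_mult_distrib)
  also have "\<dots> \<le> (\<integral>\<^sup>+x\<in>D. epowr (ennreal (norm (\<rho> x powr (- real m) *\<^sub>R bump_sum x))) \<tau> \<partial>lebesgue)"
  proof (rule nn_integral_mono)
    fix x
    show "(\<Sum>j. \<Sum>z\<in>X j. ennreal (?f j) * indicator (?B j z) x) \<le>
        epowr (ennreal (norm (\<rho> x powr (- real m) *\<^sub>R bump_sum x))) \<tau> * indicator D x"
    proof (cases "\<exists>i y. y \<in> X i \<and> x \<in> ?B i y")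
      case True
      then obtain i y where xy: "y \<in> X i" "x \<in> ?B i y" by blast
      have "(\<Sum>j. \<Sum>z\<in>X j. ennreal (?f j) * indicator (?B j z) x) = ennreal (?f i)"
        by (rule suminf_indicator_bumps(1)[of ?B, OF BQ xy])
      moreover have "x \<in> D" using xy BQ Q_subset_D by blast
      ultimately show ?thesis
        using lower[OF xy] by (simp add: epowr_def ennreal_leI)
    next
      case False
      then have "(\<Sum>j. \<Sum>z\<in>X j. ennreal (?f j) * indicator (?B j z) x) = 0"
        by (intro suminf_indicator_bumps(2)[of ?B, OF BQ]) blast
      then show ?thesis by simp
    qed
  qed
  finally have le: "(\<Sum>j. ennreal (unit_ball_vol (real CARD('d)) * e ^ CARD('d) * (real (card (X j)) * ?f j * r j ^ CARD('d)))) \<le>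
      (\<integral>\<^sup>+x\<in>D. epowr (ennreal (norm (\<rho> x powr (- real m) *\<^sub>R bump_sum x))) \<tau> \<partial>lebesgue)" .
  have eq: "unit_ball_vol (real CARD('d)) * e ^ CARD('d) * (real (card (X j)) * ?f j * r j ^ CARD('d)) =
      (unit_ball_vol (real CARD('d)) * e ^ CARD('d) * k powr \<tau>) *
      (real (card (X j)) * c j powr \<tau> * r j powr (real CARD('d) - real m * \<tau>))" for j
  proof -
    have "?f j * r j ^ CARD('d) = k powr \<tau> * c j powr \<tau> * r j powr (real CARD('d) - real m * \<tau>)"
    proof -
      have "?f j = k powr \<tau> * c j powr \<tau> * r j powr (- real m * \<tau>)"
        using k c_pos[of j] rad_pos[of L j] by (simp only: powr_mult powr_powr)
      moreover have "r j ^ CARD('d) = r j powr real CARD('d)"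
        using rad_pos[of L j] by (simp add: powr_realpow)
      moreover have "r j powr (- real m * \<tau>) * r j powr real CARD('d) = r j powr (real CARD('d) - real m * \<tau>)"
        by (simp flip: powr_add)
      ultimately show ?thesis by (simp only: mult.assoc)
    qed
    then show ?thesis by (simp add: mult_ac)
  qed
  have pos: "unit_ball_vol (real CARD('d)) * e ^ CARD('d) * k powr \<tau> > 0"
    using e k by simp
  have "(\<Sum>j. ennreal (unit_ball_vol (real CARD('d)) * e ^ CARD('d) * (real (card (X j)) * ?f j * r j ^ CARD('d)))) = top"
  proof (rule ccontr)
    assume "\<not> ?thesis"
    then have "summable (\<lambda>j. (unit_ball_vol (real CARD('d)) * e ^ CARD('d) * k powr \<tau>) *
      (real (card (X j)) * c j powr \<tau> * r j powr (real CARD('d) - real m * \<tau>)))"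
      unfolding eq using pos by (intro summable_suminf_not_top) (auto simp: mult_nonneg_nonneg less_imp_le)
    from summable_mult_D[OF this less_imp_neq[OF pos, symmetric]] div show False by blast
  qed
  then have "(\<integral>\<^sup>+x\<in>D. epowr (ennreal (norm (\<rho> x powr (- real m) *\<^sub>R bump_sum x))) \<tau> \<partial>lebesgue) = top"
    using le by (simp add: top_unique)
  then show ?thesis by (simp add: Lp_norm_def epowr_def)
qed

end

subsection \<open>Choice of the coefficients\<close>

lemma bump_coefficients:
  fixes d \<delta> p \<tau> a m :: real and N r :: "nat \<Rightarrow> real"
  assumes p: "0 < p" and \<tau>: "0 < \<tau>" "\<tau> < p" and \<kappa>: "0 < \<kappa>"
    and r: "\<And>i. 0 < r i" "\<And>i. r i \<le> 1"
    and N: "\<And>i. \<kappa> * r i powr (- \<delta>) \<le> N i"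
    and crit: "(d - \<delta>) * (1 / \<tau> - 1 / p) \<le> m - a"
  obtains c where "\<And>i. 0 < c i" "summable (\<lambda>i. N i * c i powr p * r i powr (d - a * p))"
    "\<not> summable (\<lambda>i. N i * c i powr \<tau> * r i powr (d - m * \<tau>))"
proof -
  have N0: "0 < N i" for i
  proof -
    have "0 < r i powr (- \<delta>)" using r(1)[of i] by simp
    then have "0 < \<kappa> * r i powr (- \<delta>)" using \<kappa> by (rule mult_pos_pos[rotated])
    then show ?thesis using N[of i] by linarith
  qed
  \<comment> \<open>The series converges because \<open>p / \<tau> > 1\<close>, while raising its
    terms to the power \<open>\<tau> / p\<close> produces the harmonic series.\<close>
  define s where "s i = real (Suc i) powr (- p / \<tau>)" for i
  define c where "c i = (s i / (N i * r i powr (d - a * p))) powr (1 / p)" for i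
  have s0: "0 < s i" for i by (simp add: s_def)
  have c0: "0 < c i" for i
    using s0[of i] N0[of i] r(1)[of i] by (simp add: c_def)
  have cp: "N i * c i powr p * r i powr (d - a * p) = s i" for i
    using s0[of i] N0[of i] r(1)[of i] p by (simp add: c_def powr_powr)
  have "summable s"
    unfolding s_def[abs_def] using p \<tau>
    by (subst summable_Suc_iff[of "\<lambda>i. real i powr (- p / \<tau>)"]) (simp add: summable_real_powr_iff)
  then have 1: "summable (\<lambda>i. N i * c i powr p * r i powr (d - a * p))"
    by (simp only: cp)
  have low: "\<kappa> powr (1 - \<tau> / p) * (real (Suc i) powr (- 1)) \<le> N i * c i powr \<tau> * r i powr (d - m * \<tau>)" for i
  proof -
    have "c i powr \<tau> = (s i / (N i * r i powr (d - a * p))) powr (\<tau> / p)"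
      by (simp add: c_def powr_powr)
    also have "\<dots> = s i powr (\<tau> / p) * N i powr (- \<tau> / p) * r i powr (- (d - a * p) * (\<tau> / p))"
    proof -
      have "s i / (N i * r i powr (d - a * p)) = s i * N i powr (- 1) * r i powr (- (d - a * p))"
        using N0[of i] r(1)[of i] by (simp only: powr_minus powr_one divide_inverse inverse_mult_distrib mult_ac less_imp_le)
      moreover have "(- 1) * (\<tau> / p) = - \<tau> / p" by simp
      ultimately show ?thesis
        using s0[of i] N0[of i] r(1)[of i] by (simp only: powr_mult powr_powr)
    qed
    also have "s i powr (\<tau> / p) = real (Suc i) powr (- 1)"
      using p \<tau> by (simp add: s_def powr_powr)
    finally have c\<tau>: "c i powr \<tau> = real (Suc i) powr (- 1) * N i powr (- \<tau> / p) * r i powr (- (d - a * p) * (\<tau> / p))" .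
    have "\<kappa> powr (1 - \<tau> / p) * r i powr (- \<delta> * (1 - \<tau> / p)) = (\<kappa> * r i powr (- \<delta>)) powr (1 - \<tau> / p)"
      using \<kappa> r(1)[of i] by (simp add: powr_mult powr_powr)
    \<comment> \<open>\<open>1 - \<tau> / p\<close> is positive, so the lower bound on
      \<open>N i\<close> may be raised to this power.\<close>
    also have "\<dots> \<le> N i powr (1 - \<tau> / p)"
      using N[of i] \<kappa> \<tau> p by (intro powr_mono2) auto
    also have "\<dots> = N i * N i powr (- \<tau> / p)"
    proof -
      have "1 - \<tau> / p = 1 + - \<tau> / p" by simp
      then show ?thesis using N0[of i] by (simp only: powr_add powr_one less_imp_le)
    qed
    finally have N1: "\<kappa> powr (1 - \<tau> / p) * r i powr (- \<delta> * (1 - \<tau> / p)) \<le> N i * N i powr (- \<tau> / p)" .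
    \<comment> \<open>The total exponent of \<open>r i\<close>. It is not positive by
      \<open>crit\<close>, and \<open>r i \<le> 1\<close>, so the power is at least
      \<open>1\<close>.\<close>
    define q where "q = - \<delta> * (1 - \<tau> / p) + (- (d - a * p) * (\<tau> / p) + (d - m * \<tau>))"
    have "q = \<tau> * ((d - \<delta>) * (1 / \<tau> - 1 / p) - (m - a))"
      using p \<tau> by (simp add: q_def field_simps)
    then have "q \<le> 0" using crit \<tau> by (simp add: mult_le_0_iff)
    then have "1 \<le> r i powr q"
      using r[of i] powr_mono'[of q 0 "r i"] by simp
    then have "\<kappa> powr (1 - \<tau> / p) * real (Suc i) powr (- 1) \<le> \<kappa> powr (1 - \<tau> / p) * real (Suc i) powr (- 1) * r i powr q"
      using mult_left_mono[of 1 "r i powr q" "\<kappa> powr (1 - \<tau> / p) * real (Suc i) powr (- 1)"] by simp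
    also have "\<dots> = (\<kappa> powr (1 - \<tau> / p) * r i powr (- \<delta> * (1 - \<tau> / p))) *
        (real (Suc i) powr (- 1) * r i powr (- (d - a * p) * (\<tau> / p)) * r i powr (d - m * \<tau>))"
      unfolding q_def powr_add by (simp only: mult_ac)
    also have "\<dots> \<le> (N i * N i powr (- \<tau> / p)) *
        (real (Suc i) powr (- 1) * r i powr (- (d - a * p) * (\<tau> / p)) * r i powr (d - m * \<tau>))"
      by (intro mult_right_mono N1) simp
    also have "\<dots> = N i * c i powr \<tau> * r i powr (d - m * \<tau>)"
      unfolding c\<tau> by (simp only: mult_ac)
    finally show ?thesis .
  qed
  have "\<not> summable (\<lambda>i. N i * c i powr \<tau> * r i powr (d - m * \<tau>))"
  proof
    assume "summable (\<lambda>i. N i * c i powr \<tau> * r i powr (d - m * \<tau>))"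
    then have "summable (\<lambda>i. \<kappa> powr (1 - \<tau> / p) * (real (Suc i) powr (- 1)))"
    proof (rule summable_comparison_test'[where N = 0])
      fix i :: nat
      have "0 \<le> \<kappa> powr (1 - \<tau> / p) * (real (Suc i) powr (- 1))" by simp
      then show "norm (\<kappa> powr (1 - \<tau> / p) * (real (Suc i) powr (- 1))) \<le> N i * c i powr \<tau> * r i powr (d - m * \<tau>)"
        using low[of i] by (simp only: real_norm_def abs_of_nonneg)
    qed
    then have "summable (\<lambda>i. real (Suc i) powr (- 1))"
      by (rule summable_mult_D) (use \<kappa> in simp)
    then have "summable (\<lambda>i. real i powr (- 1))"
      by (subst (asm) summable_Suc_iff[of "\<lambda>i. real i powr (- 1)"])
    then show False using summable_real_powr_iff[of "- 1"] by (simp only: less_irrefl)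
  qed
  with c0 1 show ?thesis by (rule that)
qed

text \<open>The constant \<open>C\<close> comes first, since \<open>M\<close> and \<open>L0\<close> are later chosen in terms of it.\<close>

lemma bump_family_exists:
  fixes D S :: "(real ^ 'd::finite) set"
  assumes D: "open D" "S \<inter> D = {}" and room: "bump_room D S \<delta>"
    and p: "0 < p" and \<tau>: "0 < \<tau>" "\<tau> < p"
    and crit: "(real CARD('d) - real \<delta>) * (1 / \<tau> - 1 / p) \<le> real m - a"
  shows "\<exists>C>0. \<forall>M\<ge>1. \<forall>L0. \<exists>L\<ge>L0. \<exists>X c. bump_family D S C M L X c \<and>
    summable (\<lambda>i. real (card (X i)) * c i powr p * rad L i powr (real CARD('d) - a * p)) \<and>
    \<not> summable (\<lambda>i. real (card (X i)) * c i powr \<tau> * rad L i powr (real CARD('d) - real m * \<tau>))"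
proof -
  obtain C where C: "C > 0"
    and room': "\<And>M. M > 0 \<Longrightarrow> \<exists>\<kappa>>0. \<exists>r0>0. \<forall>r. 0 < r \<and> r \<le> r0 \<longrightarrow>
       (\<exists>X. finite X \<and> \<kappa> * r powr (- real \<delta>) \<le> real (card X) \<and>
          (\<forall>x\<in>X. ball x r \<subseteq> D \<and> (\<exists>s\<in>S. dist x s \<le> C * r)) \<and>
          (\<forall>x\<in>X. \<forall>y\<in>X. x \<noteq> y \<longrightarrow> M * r < dist x y))"
    using room unfolding bump_room_def by blast
  have "\<exists>L\<ge>L0. \<exists>X c. bump_family D S C M L X c \<and>
    summable (\<lambda>i. real (card (X i)) * c i powr p * rad L i powr (real CARD('d) - a * p)) \<and>
    \<not> summable (\<lambda>i. real (card (X i)) * c i powr \<tau> * rad L i powr (real CARD('d) - real m * \<tau>))"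
    if M: "M \<ge> 1" for M :: real and L0 :: nat
  proof -
    have "M > 0" using M by simp
    from room'[OF this] obtain \<kappa> r0 where \<kappa>: "\<kappa> > 0" "r0 > 0"
      and ex: "\<forall>r. 0 < r \<and> r \<le> r0 \<longrightarrow>
       (\<exists>X. finite X \<and> \<kappa> * r powr (- real \<delta>) \<le> real (card X) \<and>
          (\<forall>x\<in>X. ball x r \<subseteq> D \<and> (\<exists>s\<in>S. dist x s \<le> C * r)) \<and>
          (\<forall>x\<in>X. \<forall>y\<in>X. x \<noteq> y \<longrightarrow> M * r < dist x y))"
      by (elim exE conjE)
    obtain L1 :: nat where L1: "2 * (C + 1) < 2 ^ L1"
      using real_arch_pow[of 2 "2 * (C + 1)"] by auto
    obtain L2 :: nat where L2: "(1 / 2) ^ L2 < r0"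
      using real_arch_pow_inv[OF \<kappa>(2), of "1 / 2"] by auto
    \<comment> \<open>\<open>L0\<close> is demanded by the caller, \<open>L1\<close> separates the
      scales, and \<open>L2\<close> brings all radii below \<open>r0\<close>.\<close>
    define L where "L = max L0 (max L1 L2)"
    have L: "2 * (C + 1) < 2 ^ L"
    proof -
      have "(2 :: real) ^ L1 \<le> 2 ^ L"
        by (rule power_increasing) (auto simp: L_def)
      then show ?thesis using L1 by linarith
    qed
    have rr: "0 < rad L i" "rad L i \<le> r0" for i
    proof -
      have "L2 \<le> L * (i + 1)"
        by (simp add: L_def)
      then have "rad L i \<le> (1 / 2) ^ L2"
        unfolding rad_def by (intro power_decreasing) auto
      then show "rad L i \<le> r0" using L2 by simp
    qed (rule rad_pos)
    have "\<forall>i. \<exists>X. finite X \<and> \<kappa> * rad L i powr (- real \<delta>) \<le> real (card X) \<and>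
          (\<forall>x\<in>X. ball x (rad L i) \<subseteq> D \<and> (\<exists>s\<in>S. dist x s \<le> C * rad L i)) \<and>
          (\<forall>x\<in>X. \<forall>y\<in>X. x \<noteq> y \<longrightarrow> M * rad L i < dist x y)"
      using ex rr by simp
    then obtain X where X: "\<And>i. finite (X i) \<and> \<kappa> * rad L i powr (- real \<delta>) \<le> real (card (X i)) \<and>
          (\<forall>x\<in>X i. ball x (rad L i) \<subseteq> D \<and> (\<exists>s\<in>S. dist x s \<le> C * rad L i)) \<and>
          (\<forall>x\<in>X i. \<forall>y\<in>X i. x \<noteq> y \<longrightarrow> M * rad L i < dist x y)"
      by (rule choice[THEN exE]) blast
    obtain c where c: "\<And>i. 0 < c i"
      "summable (\<lambda>i. real (card (X i)) * c i powr p * rad L i powr (real CARD('d) - a * p))"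
      "\<not> summable (\<lambda>i. real (card (X i)) * c i powr \<tau> * rad L i powr (real CARD('d) - real m * \<tau>))"
      by (rule bump_coefficients[where r = "rad L" and N = "\<lambda>i. real (card (X i))", OF p \<tau> \<kappa>(1) rad_pos rad_le_1 _ crit])
        (use X in auto)
    have "bump_family D S C M L X c"
      using D C M L c(1) X by unfold_locales auto
    then show ?thesis
      using c by (intro exI[of _ L] conjI exI[of _ X] exI[of _ c]) (auto simp: L_def)
  qed
  then show ?thesis using C by blast
qed

subsection \<open>Oscillatory integrals\<close>

lemma lborel_integral_affine:
  fixes f :: "'a::euclidean_space \<Rightarrow> 'b::{banach, second_countable_topology}"
  assumes [measurable]: "f \<in> borel_measurable borel" and c: "c \<noteq> 0"
  shows "(LINT x|lborel. f x) = \<bar>c\<bar> ^ DIM('a) *\<^sub>R (LINT x|lborel. f (t + c *\<^sub>R x))"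
proof -
  have "(LINT x|lborel. f x) = (LINT x|density (distr lborel borel (\<lambda>x. t + c *\<^sub>R x)) (\<lambda>_. ennreal (\<bar>c\<bar> ^ DIM('a))). f x)"
    using lborel_affine[OF c, of t] by (simp add: ennreal_power)
  also have "\<dots> = (LINT x|distr lborel borel (\<lambda>x. t + c *\<^sub>R x). \<bar>c\<bar> ^ DIM('a) *\<^sub>R f x)"
    by (subst integral_density) auto
  also have "\<dots> = (LINT x|lborel. \<bar>c\<bar> ^ DIM('a) *\<^sub>R f (t + c *\<^sub>R x))"
    by (subst integral_distr) auto
  finally show ?thesis by simp
qed

lemma nn_integral_lborel_affine:
  fixes f :: "'a::euclidean_space \<Rightarrow> ennreal"
  assumes [measurable]: "f \<in> borel_measurable borel" and c: "c \<noteq> 0"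
  shows "(\<integral>\<^sup>+x. f x \<partial>lborel) = ennreal (\<bar>c\<bar> ^ DIM('a)) * (\<integral>\<^sup>+x. f (t + c *\<^sub>R x) \<partial>lborel)"
proof -
  have "(\<integral>\<^sup>+x. f x \<partial>lborel) = (\<integral>\<^sup>+x. f x \<partial>density (distr lborel borel (\<lambda>x. t + c *\<^sub>R x)) (\<lambda>_. ennreal (\<bar>c\<bar> ^ DIM('a))))"
    using lborel_affine[OF c, of t] by (simp add: ennreal_power)
  also have "\<dots> = (\<integral>\<^sup>+x. ennreal (\<bar>c\<bar> ^ DIM('a)) * f x \<partial>distr lborel borel (\<lambda>x. t + c *\<^sub>R x))"
    by (subst nn_integral_density) auto
  also have "\<dots> = (\<integral>\<^sup>+x. ennreal (\<bar>c\<bar> ^ DIM('a)) * f (t + c *\<^sub>R x) \<partial>lborel)"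
    by (subst nn_integral_distr) auto
  finally show ?thesis by (simp add: nn_integral_cmult)
qed

text \<open>The Fourier integral without its normalization. The parameter \<open>s\<close> is
  \<open>- \<i>\<close> for the transform and \<open>\<i>\<close> for its inverse, so that one proof
  covers both; \<open>Re s = 0\<close> gives the exponential modulus one.\<close>

definition osc :: "complex \<Rightarrow> ('a::euclidean_space \<Rightarrow> complex) \<Rightarrow> 'a \<Rightarrow> complex" where
  "osc s h \<xi> = (LINT x|lborel. exp (s * of_real (x \<bullet> \<xi>)) * h x)"

lemma borel_measurable_exp_inner [measurable]:
  "(\<lambda>x. exp (s * complex_of_real (x \<bullet> \<xi>))) \<in> borel_measurable borel"
  by (intro borel_measurable_continuous_onI continuous_intros)

lemma integrable_osc:
  assumes "integrable lborel h" "Re s = 0"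
  shows "integrable lborel (\<lambda>x. exp (s * of_real (x \<bullet> \<xi>)) * h x)"
proof (rule Bochner_Integration.integrable_bound[OF assms(1)])
  have "h \<in> borel_measurable borel"
    using borel_measurable_integrable[OF assms(1)] by simp
  then show "(\<lambda>x. exp (s * of_real (x \<bullet> \<xi>)) * h x) \<in> borel_measurable lborel"
    by simp
qed (simp add: norm_mult assms(2))

lemma norm_osc_le:
  assumes "Re s = 0"
  shows "norm (osc s h \<xi>) \<le> (LINT x|lborel. norm (h x))"
  using integral_norm_bound[of lborel "\<lambda>x. exp (s * of_real (x \<bullet> \<xi>)) * h x"]
  by (simp add: osc_def norm_mult assms)

lemma continuous_on_osc:
  assumes h: "integrable lborel h" and s: "Re s = 0"
  shows "continuous_on UNIV (osc s h)"
  unfolding continuous_on_sequentially comp_def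
proof (intro ballI allI impI)
  fix u :: "nat \<Rightarrow> 'a" and \<xi> assume u: "(\<forall>n. u n \<in> UNIV) \<and> u \<longlonglongrightarrow> \<xi>"
  show "(\<lambda>n. osc s h (u n)) \<longlonglongrightarrow> osc s h \<xi>"
    unfolding osc_def
  proof (rule integral_dominated_convergence[where w = "\<lambda>x. norm (h x)"])
    show "AE x in lborel. (\<lambda>n. exp (s * of_real (x \<bullet> u n)) * h x) \<longlonglongrightarrow> exp (s * of_real (x \<bullet> \<xi>)) * h x"
      using u by (intro AE_I2 tendsto_intros) auto
    show "integrable lborel (\<lambda>x. norm (h x))"
      using h by (rule integrable_norm)
    show "AE x in lborel. norm (exp (s * of_real (x \<bullet> u n)) * h x) \<le> norm (h x)" for n
      by (simp add: norm_mult s)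
    show "(\<lambda>x. exp (s * of_real (x \<bullet> \<xi>)) * h x) \<in> borel_measurable lborel"
      using integrable_osc[OF h s] by (rule borel_measurable_integrable)
    show "(\<lambda>x. exp (s * of_real (x \<bullet> u n)) * h x) \<in> borel_measurable lborel" for n
      using integrable_osc[OF h s] by (rule borel_measurable_integrable)
  qed
qed

text \<open>Both sides are iterated integrals of
  \<open>exp (s * of_real (y \<bullet> x)) * (h x * k y)\<close>, which is absolutely integrable on
  the product space because the exponential has modulus one.\<close>

lemma osc_multiplication_formula:
  assumes h: "integrable lborel h" and k: "integrable lborel k" and s: "Re s = 0"
  shows "(LINT x|lborel. h x * osc s k x) = (LINT x|lborel. osc s h x * k x)"
proof -
  define F where "F x y = exp (s * of_real (y \<bullet> x)) * (h x * k y)" for x y :: 'a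
  have [measurable]: "h \<in> borel_measurable borel" "k \<in> borel_measurable borel"
    using borel_measurable_integrable[OF h] borel_measurable_integrable[OF k] by simp_all
  have "continuous_on UNIV (\<lambda>z :: 'a \<times> 'a. exp (s * complex_of_real (snd z \<bullet> fst z)))"
    by (intro continuous_intros)
  then have [measurable]: "(\<lambda>z :: 'a \<times> 'a. exp (s * complex_of_real (snd z \<bullet> fst z))) \<in> borel_measurable (borel \<Otimes>\<^sub>M borel)"
    unfolding borel_prod by (rule borel_measurable_continuous_onI)
  have meas: "case_prod F \<in> borel_measurable (lborel \<Otimes>\<^sub>M lborel)"
    unfolding F_def case_prod_beta by measurable
  have nF: "norm (F x y) = norm (h x) * norm (k y)" for x y
    by (simp add: F_def norm_mult s)
  have "integrable (lborel \<Otimes>\<^sub>M lborel) (case_prod F)"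
  proof (rule lborel_pair.Fubini_integrable[OF meas])
    show "integrable lborel (\<lambda>x. LINT y|lborel. norm (case_prod F (x, y)))"
      using h by (simp add: nF)
    show "AE x in lborel. integrable lborel (\<lambda>y. case_prod F (x, y))"
    proof (intro AE_I2)
      fix x
      have "integrable lborel (\<lambda>y. h x * (exp (s * of_real (y \<bullet> x)) * k y))"
        by (intro integrable_mult_right integrable_osc k s)
      then show "integrable lborel (\<lambda>y. case_prod F (x, y))"
        by (simp add: F_def mult_ac)
    qed
  qed
  from lborel_pair.Fubini_integral[OF this]
  have "(LINT y|lborel. LINT x|lborel. F x y) = (LINT x|lborel. LINT y|lborel. F x y)" .
  moreover have "(LINT x|lborel. F x y) = osc s h y * k y" for y
  proof -
    have "(LINT x|lborel. F x y) = (LINT x|lborel. exp (s * of_real (x \<bullet> y)) * h x * k y)"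
      by (simp add: F_def inner_commute mult_ac)
    then show ?thesis by (simp add: osc_def)
  qed
  moreover have "(LINT y|lborel. F x y) = h x * osc s k x" for x
  proof -
    have "(LINT y|lborel. F x y) = (LINT y|lborel. h x * (exp (s * of_real (y \<bullet> x)) * k y))"
      by (simp add: F_def mult_ac)
    then show ?thesis by (simp add: osc_def)
  qed
  ultimately show ?thesis by simp
qed

lemma fourier_eq_osc:
  fixes \<psi> :: "real ^ 'd::finite \<Rightarrow> complex"
  assumes [measurable]: "\<psi> \<in> borel_measurable borel"
  shows "fourier \<psi> = (\<lambda>\<xi>. of_real ((2 * pi) powr (- real CARD('d) / 2)) * osc (- \<i>) \<psi> \<xi>)"
    and "inv_fourier \<psi> = (\<lambda>\<xi>. of_real ((2 * pi) powr (- real CARD('d) / 2)) * osc \<i> \<psi> \<xi>)"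
proof -
  have "(LINT x|lebesgue. exp (- \<i> * of_real (x \<bullet> \<xi>)) * \<psi> x) = osc (- \<i>) \<psi> \<xi>" for \<xi>
    unfolding osc_def by (rule integral_completion) measurable
  then show "fourier \<psi> = (\<lambda>\<xi>. of_real ((2 * pi) powr (- real CARD('d) / 2)) * osc (- \<i>) \<psi> \<xi>)"
    by (simp add: fourier_def[abs_def])
  have "(LINT x|lebesgue. exp (\<i> * of_real (\<xi> \<bullet> x)) * \<psi> x) = osc \<i> \<psi> \<xi>" for \<xi>
    unfolding osc_def inner_commute[of \<xi>] by (rule integral_completion) measurable
  then show "inv_fourier \<psi> = (\<lambda>\<xi>. of_real ((2 * pi) powr (- real CARD('d) / 2)) * osc \<i> \<psi> \<xi>)"
    by (simp add: inv_fourier_def[abs_def])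
qed

lemma fourier_continuous_bounded:
  fixes h :: "real ^ 'd::finite \<Rightarrow> complex"
  assumes "integrable lborel h"
  shows "continuous_on UNIV (fourier h)" "continuous_on UNIV (inv_fourier h)"
    "\<exists>B. \<forall>x. norm (fourier h x) \<le> B" "\<exists>B. \<forall>x. norm (inv_fourier h x) \<le> B"
proof -
  have m: "h \<in> borel_measurable borel"
    using borel_measurable_integrable[OF assms] by simp
  show "continuous_on UNIV (fourier h)" "continuous_on UNIV (inv_fourier h)"
    unfolding fourier_eq_osc[OF m]
    by (intro continuous_on_mult_left continuous_on_osc[OF assms]; simp)+
  let ?\<kappa> = "(2 * pi) powr (- real CARD('d) / 2)"
  have "norm (of_real ?\<kappa> * osc s h x) \<le> ?\<kappa> * (LINT x|lborel. norm (h x))" if "Re s = 0" for s x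
    using mult_left_mono[OF norm_osc_le[OF that, of h x], of ?\<kappa>] by (simp add: norm_mult)
  then show "\<exists>B. \<forall>x. norm (fourier h x) \<le> B" "\<exists>B. \<forall>x. norm (inv_fourier h x) \<le> B"
    unfolding fourier_eq_osc[OF m]
    by (intro exI[of _ "?\<kappa> * (LINT x|lborel. norm (h x))"] allI; simp)+
qed

lemma fourier_multiplication_formula:
  fixes h k :: "real ^ 'd::finite \<Rightarrow> complex"
  assumes h: "integrable lborel h" and k: "integrable lborel k"
  shows "(LINT x|lborel. h x * fourier k x) = (LINT x|lborel. fourier h x * k x)"
    and "(LINT x|lborel. h x * inv_fourier k x) = (LINT x|lborel. inv_fourier h x * k x)"
proof -
  have m: "h \<in> borel_measurable borel" "k \<in> borel_measurable borel"
    using borel_measurable_integrable[OF h] borel_measurable_integrable[OF k] by simp_all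
  let ?\<kappa> = "complex_of_real ((2 * pi) powr (- real CARD('d) / 2))"
  have "(LINT x|lborel. h x * (?\<kappa> * osc s k x)) = (LINT x|lborel. (?\<kappa> * osc s h x) * k x)" if "Re s = 0" for s
  proof -
    have "(LINT x|lborel. h x * (?\<kappa> * osc s k x)) = (LINT x|lborel. ?\<kappa> * (h x * osc s k x))"
      by (simp only: mult_ac)
    also have "\<dots> = ?\<kappa> * (LINT x|lborel. osc s h x * k x)"
      by (simp add: osc_multiplication_formula[OF h k that])
    also have "\<dots> = (LINT x|lborel. ?\<kappa> * (osc s h x * k x))"
      by simp
    finally show ?thesis by (simp only: mult.assoc)
  qed
  then show "(LINT x|lborel. h x * fourier k x) = (LINT x|lborel. fourier h x * k x)"
    "(LINT x|lborel. h x * inv_fourier k x) = (LINT x|lborel. inv_fourier h x * k x)"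
    unfolding fourier_eq_osc[OF m(1)] fourier_eq_osc[OF m(2)] by simp_all
qed

subsection \<open>Schwartz functions\<close>

lemma finite_multi_order_le: "finite {\<alpha> :: 'd::finite \<Rightarrow> nat. multi_order \<alpha> \<le> N}"
proof -
  have "{\<alpha> :: 'd \<Rightarrow> nat. multi_order \<alpha> \<le> N} \<subseteq> PiE UNIV (\<lambda>_. {..N})"
  proof
    fix \<alpha> :: "'d \<Rightarrow> nat" assume "\<alpha> \<in> {\<alpha>. multi_order \<alpha> \<le> N}"
    moreover have "\<alpha> i \<le> multi_order \<alpha>" for i
      unfolding multi_order_def by (rule member_le_sum) auto
    ultimately show "\<alpha> \<in> PiE UNIV (\<lambda>_. {..N})"
      by (auto intro: order_trans)
  qed
  moreover have "finite (PiE (UNIV :: 'd set) (\<lambda>_. {..N}))"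
    by (rule finite_PiE) simp_all
  ultimately show ?thesis by (rule finite_subset)
qed

lemma multi_deriv_0: "multi_deriv (\<lambda>_. 0) f = f"
proof -
  have "multi_list (\<lambda>_ :: 'a. 0) = []"
    using length_multi_list[of "\<lambda>_ :: 'a. 0"] by (simp add: multi_order_def)
  then show ?thesis by (simp add: multi_deriv_eq)
qed

lemma schwartz_space_continuous:
  assumes "\<psi> \<in> schwartz_space"
  shows "continuous_on UNIV \<psi>"
proof -
  have "smooth_on UNIV \<psi>" using assms by (simp add: schwartz_space_def)
  from smooth_on_continuous[OF this, of "[]"] show ?thesis by simp
qed

lemma schwartz_space_decay:
  assumes "\<psi> \<in> schwartz_space"
  obtains K where "0 \<le> K" "\<And>x. (1 + norm x) ^ N * norm (\<psi> x) \<le> K"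
proof -
  have fin: "schwartz_seminorm N \<psi> < top"
    using assms by (simp add: schwartz_space_def)
  define K where "K = enn2real (schwartz_seminorm N \<psi>)"
  have "(1 + norm x) ^ N * norm (\<psi> x) \<le> K" for x
  proof -
    have "norm (\<psi> x) = norm (multi_deriv (\<lambda>_. 0) \<psi> x)"
      by (simp add: multi_deriv_0)
    also have "\<dots> \<le> (\<Sum>\<alpha> | multi_order \<alpha> \<le> N. norm (multi_deriv \<alpha> \<psi> x))"
    proof (rule member_le_sum[of "\<lambda>_. 0" "{\<alpha>. multi_order \<alpha> \<le> N}" "\<lambda>\<alpha>. norm (multi_deriv \<alpha> \<psi> x)"])
      show "(\<lambda>_. 0) \<in> {\<alpha> :: 'a \<Rightarrow> nat. multi_order \<alpha> \<le> N}" by (simp add: multi_order_def)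
    qed (simp_all add: finite_multi_order_le)
    finally have "(1 + norm x) ^ N * norm (\<psi> x) \<le> (1 + norm x) ^ N * (\<Sum>\<alpha> | multi_order \<alpha> \<le> N. norm (multi_deriv \<alpha> \<psi> x))"
      by (intro mult_left_mono) auto
    moreover have "ennreal ((1 + norm x) ^ N * (\<Sum>\<alpha> | multi_order \<alpha> \<le> N. norm (multi_deriv \<alpha> \<psi> x))) \<le> ennreal K"
    proof -
      have "ennreal ((1 + norm x) ^ N * (\<Sum>\<alpha> | multi_order \<alpha> \<le> N. norm (multi_deriv \<alpha> \<psi> x))) \<le> schwartz_seminorm N \<psi>"
        unfolding schwartz_seminorm_def by (rule SUP_upper) simp
      also have "\<dots> = ennreal K"
        using fin by (simp add: K_def)
      finally show ?thesis .
    qed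
    ultimately show ?thesis
      by (simp add: K_def)
  qed
  then show ?thesis by (intro that[of K]) (simp_all add: K_def)
qed

text \<open>Where the norm lies between \<open>n\<close> and \<open>n + 1\<close>, decay of order
  \<open>d + 2\<close> bounds the function by a multiple of \<open>(1 + n) ^ - (d + 2)\<close>. The
  surrounding ball of radius \<open>n + 1\<close> has volume of order \<open>(n + 1) ^ d\<close>,
  and a series of inverse squares remains.\<close>

lemma schwartz_space_integrable:
  fixes \<psi> :: "real ^ 'd::finite \<Rightarrow> complex"
  assumes "\<psi> \<in> schwartz_space"
  shows "integrable lborel \<psi>"
proof (rule integrableI_bounded)
  show "\<psi> \<in> borel_measurable lborel"
    using borel_measurable_continuous_onI[OF schwartz_space_continuous[OF assms]] by simp
  let ?N = "CARD('d) + 2"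
  let ?V = "unit_ball_vol (real CARD('d))"
  obtain K where K: "0 \<le> K" "\<And>x. (1 + norm x) ^ ?N * norm (\<psi> x) \<le> K"
    using schwartz_space_decay[OF assms, of ?N] by blast
  let ?f = "\<lambda>n. K / (1 + real n) ^ ?N"
  have "(\<integral>\<^sup>+x. ennreal (norm (\<psi> x)) \<partial>lborel) \<le> (\<integral>\<^sup>+x. (\<Sum>n. ennreal (?f n) * indicator (cball (0 :: real ^ 'd) (real n + 1)) x) \<partial>lborel)"
  proof (rule nn_integral_mono)
    fix x :: "real ^ 'd"
    define n where "n = nat \<lfloor>norm x\<rfloor>"
    have n: "real n \<le> norm x" "norm x \<le> real n + 1"
    proof -
      have "real (nat \<lfloor>t\<rfloor>) \<le> t \<and> t \<le> real (nat \<lfloor>t\<rfloor>) + 1" if "0 \<le> t" for t :: real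
        using that by linarith
      then show "real n \<le> norm x" "norm x \<le> real n + 1"
        unfolding n_def by simp_all
    qed
    have "(1 + real n) ^ ?N * norm (\<psi> x) \<le> (1 + norm x) ^ ?N * norm (\<psi> x)"
      using n by (intro mult_right_mono power_mono) auto
    also have "\<dots> \<le> K" by (rule K(2))
    finally have "norm (\<psi> x) \<le> ?f n"
      by (simp add: pos_le_divide_eq mult.commute)
    then have "ennreal (norm (\<psi> x)) \<le> ennreal (?f n) * indicator (cball 0 (real n + 1)) x"
      using n by (simp add: ennreal_leI)
    also have "\<dots> \<le> (\<Sum>n. ennreal (?f n) * indicator (cball 0 (real n + 1)) x)"
    proof -
      have "F n \<le> (\<Sum>n. F n)" for F :: "nat \<Rightarrow> ennreal"
        using sum_le_suminf[of F "{n}"] by simp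
      then show ?thesis .
    qed
    finally show "ennreal (norm (\<psi> x)) \<le> (\<Sum>n. ennreal (?f n) * indicator (cball 0 (real n + 1)) x)" .
  qed
  also have "\<dots> = (\<Sum>n. ennreal (?f n) * emeasure lborel (cball (0 :: real ^ 'd) (real n + 1)))"
  proof (subst nn_integral_suminf)
    show "(\<lambda>x. ennreal (?f n) * indicator (cball (0 :: real ^ 'd) (real n + 1)) x) \<in> borel_measurable lborel" for n
      by (intro borel_measurable_times_ennreal borel_measurable_const borel_measurable_indicator) simp
    show "(\<Sum>n. \<integral>\<^sup>+x. ennreal (?f n) * indicator (cball (0 :: real ^ 'd) (real n + 1)) x \<partial>lborel) =
        (\<Sum>n. ennreal (?f n) * emeasure lborel (cball (0 :: real ^ 'd) (real n + 1)))"
      by (intro suminf_cong nn_integral_cmult_indicator) simp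
  qed
  also have "\<dots> = (\<Sum>n. ennreal (K * ?V * inverse (real (Suc n) ^ 2)))"
  proof (intro suminf_cong)
    fix n
    have "ennreal (?f n) * emeasure lborel (cball (0 :: real ^ 'd) (real n + 1)) = ennreal (?f n * (?V * (real n + 1) ^ CARD('d)))"
    proof -
      have "emeasure lborel (cball (0 :: real ^ 'd) (real n + 1)) = ennreal (?V * (real n + 1) ^ CARD('d))"
        by (simp add: emeasure_cball)
      moreover have "0 \<le> ?f n" using K(1) by simp
      ultimately show ?thesis by (simp only: ennreal_mult')
    qed
    also have "?f n * (?V * (real n + 1) ^ CARD('d)) = K * ?V * inverse (real (Suc n) ^ 2)"
    proof -
      have "(1 + real n) ^ ?N = (real n + 1) ^ CARD('d) * real (Suc n) ^ 2"
        by (simp only: power_add add.commute of_nat_Suc)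
      then show ?thesis by (simp add: divide_inverse)
    qed
    finally show "ennreal (?f n) * emeasure lborel (cball (0 :: real ^ 'd) (real n + 1)) = ennreal (K * ?V * inverse (real (Suc n) ^ 2))" .
  qed
  also have "\<dots> < top"
  proof -
    have "summable (\<lambda>n. inverse (real n ^ 2))"
      by (rule inverse_power_summable) simp
    then have "summable (\<lambda>n. inverse (real (Suc n) ^ 2))"
      by (subst summable_Suc_iff[of "\<lambda>n. inverse (real n ^ 2)"])
    then have "summable (\<lambda>n. K * ?V * inverse (real (Suc n) ^ 2))"
      by (rule summable_mult)
    then have "(\<Sum>n. ennreal (K * ?V * inverse (real (Suc n) ^ 2))) \<noteq> top"
      using K by (intro ennreal_suminf_neq_top) auto
    then show ?thesis by (simp add: less_top)
  qed
  finally show "(\<integral>\<^sup>+x. ennreal (norm (\<psi> x)) \<partial>lborel) < \<infinity>" by simp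
qed

lemma test_function_schwartz:
  assumes "test_function UNIV \<psi>"
  shows "\<psi> \<in> schwartz_space"
proof -
  have s: "smooth_on UNIV \<psi>" "compact (support \<psi>)"
    using assms by (auto simp: test_function_def)
  have "schwartz_seminorm N \<psi> < \<infinity>" for N
  proof -
    define f where "f x = (1 + norm x) ^ N * (\<Sum>\<alpha> | multi_order \<alpha> \<le> N. norm (multi_deriv \<alpha> \<psi> x))" for x
    have "continuous_on UNIV f"
      unfolding f_def multi_deriv_eq by (intro continuous_intros smooth_on_continuous[OF s(1)])
    moreover have "f x = 0" if "x \<notin> support \<psi>" for x
    proof -
      have "multi_deriv \<alpha> \<psi> x = 0" for \<alpha>
        using that support_foldr_partial[of "multi_list \<alpha>" \<psi>] support_subset[of "foldr partial (multi_list \<alpha>) \<psi>"]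
        unfolding multi_deriv_eq by blast
      then show ?thesis by (simp add: f_def)
    qed
    ultimately obtain B where B: "\<And>x. norm (f x) \<le> B"
      using bounded_continuous_compact_support[OF _ s(2)] by metis
    have "schwartz_seminorm N \<psi> \<le> ennreal B"
      unfolding schwartz_seminorm_def f_def[symmetric]
      using B by (intro SUP_least ennreal_leI) (simp add: abs_le_D1)
    then show ?thesis by (simp add: le_less_trans)
  qed
  then show ?thesis using s by (simp add: schwartz_space_def)
qed

lemma continuous_eq_0_if_AE_eq_0:
  fixes f :: "'a::euclidean_space \<Rightarrow> 'b::real_normed_vector"
  assumes c: "continuous_on UNIV f" and ae: "AE x in lebesgue. f x = 0"
  shows "f x = 0"
proof -
  have o: "open {x. f x \<noteq> 0}"
    by (rule open_Collect_neq[OF c continuous_on_const])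
  then have "{x. f x \<noteq> 0} \<in> null_sets lebesgue"
    using ae by (subst AE_iff_null_sets) auto
  then have "{x. f x \<noteq> 0} = {}"
    using open_not_negligible[OF o] by (auto simp: negligible_iff_null_sets)
  then show ?thesis by blast
qed

lemma continuous_eq_0_if_test_integrals_0:
  fixes h :: "real ^ 'd::finite \<Rightarrow> complex"
  assumes c: "continuous_on UNIV h"
    and test: "\<And>\<psi>. test_function UNIV \<psi> \<Longrightarrow> (LINT x|lebesgue. h x * \<psi> x) = 0"
  shows "h x = 0"
proof -
  have "AE x in lebesgue. x \<in> UNIV \<longrightarrow> h x = 0"
    by (rule AE_eq_0_if_test_integrals_0)
      (use c test in \<open>auto intro: continuous_on_locally_integrable simp: set_lebesgue_integral_def\<close>)
  then have "AE x in lebesgue. h x = 0" by simp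
  then show ?thesis by (rule continuous_eq_0_if_AE_eq_0[OF c])
qed

section \<open>Littlewood-Paley pieces of compactly supported functions\<close>

lemma lp_generator_continuous:
  "lp_generator \<phi>0 \<Longrightarrow> continuous_on UNIV \<phi>0"
  by (simp add: lp_generator_def schwartz_space_continuous)

text \<open>Bounded support makes the products with Fourier transforms integrable. The radius is
  twice that given by the support condition on \<open>\<phi>0\<close>.\<close>

lemma dyadic_resolution_continuous_support:
  assumes "lp_generator \<phi>0"
  shows "continuous_on UNIV (dyadic_resolution \<phi>0 j)"
    and "x \<notin> cball 0 (3 * 2 powr real j) \<Longrightarrow> dyadic_resolution \<phi>0 j x = 0"
proof -
  have c: "continuous_on S (\<lambda>x. \<phi>0 (f x))" if "continuous_on S f" for S and f :: "real ^ 'a \<Rightarrow> real ^ 'a"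
    using continuous_on_compose2[OF lp_generator_continuous[OF assms] that] by simp
  show "continuous_on UNIV (dyadic_resolution \<phi>0 j)"
    unfolding dyadic_resolution_def[abs_def] Let_def
    by (cases "j = 0") (auto intro!: continuous_intros c lp_generator_continuous[OF assms])
  have z: "\<phi>0 x = 0" if "3 / 2 \<le> norm x" for x
    using assms that by (simp add: lp_generator_def)
  show "dyadic_resolution \<phi>0 j x = 0" if x: "x \<notin> cball 0 (3 * 2 powr real j)"
  proof (cases "j = 0")
    case True
    then show ?thesis using x by (auto simp: dyadic_resolution_def intro!: z)
  next
    case False
    have "2 powr (1 - real j) * (3 * 2 powr real j) \<le> 2 powr (1 - real j) * norm x"
      using x by (intro mult_left_mono) auto
    also have "2 powr (1 - real j) * (3 * 2 powr real j) = 6"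
      by (simp add: powr_diff)
    finally have "6 \<le> norm ((2 powr (1 - real j)) *\<^sub>R x)" by simp
    then have "\<phi>0 ((2 powr (1 - real j)) *\<^sub>R x) = 0" "\<phi>0 ((1 / 2) *\<^sub>R ((2 powr (1 - real j)) *\<^sub>R x)) = 0"
      by (intro z; simp)+
    then show ?thesis
      using False by (simp add: dyadic_resolution_def Let_def)
  qed
qed

lemma integrable_mult_bounded_continuous:
  fixes f g :: "'a::euclidean_space \<Rightarrow> complex"
  assumes "continuous_on UNIV f" "\<exists>B. \<forall>x. norm (f x) \<le> B" "integrable lborel g"
  shows "integrable lborel (\<lambda>x. f x * g x)"
proof -
  obtain B where B: "\<And>x. norm (f x) \<le> B" using assms(2) by blast
  have [measurable]: "f \<in> borel_measurable borel" "g \<in> borel_measurable borel"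
    using borel_measurable_continuous_onI[OF assms(1)] borel_measurable_integrable[OF assms(3)] by simp_all
  show ?thesis
  proof (rule Bochner_Integration.integrable_bound)
    show "integrable lborel (\<lambda>x. B *\<^sub>R g x)"
      using assms(3) by (rule integrable_scaleR_right)
    have "norm (f x) * norm (g x) \<le> \<bar>B\<bar> * norm (g x)" for x
      using order_trans[OF B abs_ge_self] by (intro mult_right_mono) auto
    then show "AE x in lborel. norm (f x * g x) \<le> norm (B *\<^sub>R g x)"
      by (simp add: norm_mult)
  qed measurable
qed

text \<open>The multiplication formula, used once for each transform, moves both of them from the
  Schwartz function to \<open>g\<close>. This exhibits a continuous function with the defining
  property of the piece. It is the only one, since continuous functions with equal integrals against
  test functions coincide.\<close>

lemma lp_piece_function_distr:
  fixes g :: "real ^ 'd::finite \<Rightarrow> complex"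
  assumes \<phi>0: "lp_generator \<phi>0" and g: "continuous_on UNIV g" "compact K" "\<And>x. x \<notin> K \<Longrightarrow> g x = 0"
  shows "lp_piece \<phi>0 j (function_distr g) = inv_fourier (\<lambda>\<xi>. dyadic_resolution \<phi>0 j \<xi> * fourier g \<xi>)" (is "_ = ?G")
    and "continuous_on UNIV (inv_fourier (\<lambda>\<xi>. dyadic_resolution \<phi>0 j \<xi> * fourier g \<xi>))"
proof -
  let ?\<phi> = "dyadic_resolution \<phi>0 j"
  note \<phi> = dyadic_resolution_continuous_support[OF \<phi>0, where j = j]
  have gi: "integrable lborel g"
    by (rule integrable_lborel_continuous_compact_support[OF g])
  note Fg = fourier_continuous_bounded[OF gi]
  have k: "integrable lborel (\<lambda>\<xi>. ?\<phi> \<xi> * fourier g \<xi>)"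
    by (rule integrable_lborel_continuous_compact_support[of _ "cball 0 (3 * 2 powr real j)"])
      (use \<phi> Fg in \<open>auto intro: continuous_intros\<close>)
  note G = fourier_continuous_bounded[OF k]
  show cG: "continuous_on UNIV ?G" by (rule G(2))
  have P: "integrable lebesgue (\<lambda>x. ?G x * \<psi> x) \<and>
      function_distr ?G \<psi> = distr_inv_fourier (distr_mult ?\<phi> (distr_fourier (function_distr g))) \<psi>"
    if \<psi>: "\<psi> \<in> schwartz_space" for \<psi>
  proof
    have \<psi>i: "integrable lborel \<psi>" by (rule schwartz_space_integrable[OF \<psi>])
    have m: "\<psi> \<in> borel_measurable borel" "?G \<in> borel_measurable borel"
      using borel_measurable_integrable[OF \<psi>i] borel_measurable_continuous_onI[OF cG] by simp_all
    have i: "integrable lborel (\<lambda>x. ?G x * \<psi> x)"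
      by (rule integrable_mult_bounded_continuous[OF cG G(4) \<psi>i])
    show "integrable lebesgue (\<lambda>x. ?G x * \<psi> x)"
      using i borel_measurable_integrable[OF i] integrable_completion by blast
    note F\<psi> = fourier_continuous_bounded[OF \<psi>i]
    have l: "integrable lborel (\<lambda>x. ?\<phi> x * inv_fourier \<psi> x)"
      by (rule integrable_lborel_continuous_compact_support[of _ "cball 0 (3 * 2 powr real j)"])
        (use \<phi> F\<psi> in \<open>auto intro: continuous_intros\<close>)
    note Fl = fourier_continuous_bounded[OF l]
    have "function_distr ?G \<psi> = (LINT x|lborel. ?G x * \<psi> x)"
      unfolding function_distr_def by (rule integral_completion) (use m in simp)
    also have "\<dots> = (LINT x|lborel. (?\<phi> x * fourier g x) * inv_fourier \<psi> x)"
      by (rule fourier_multiplication_formula(2)[OF k \<psi>i, symmetric])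
    also have "\<dots> = (LINT x|lborel. fourier g x * (?\<phi> x * inv_fourier \<psi> x))"
      by (simp only: mult_ac)
    also have "\<dots> = (LINT x|lborel. g x * fourier (\<lambda>x. ?\<phi> x * inv_fourier \<psi> x) x)"
      by (rule fourier_multiplication_formula(1)[OF gi l, symmetric])
    also have "\<dots> = (LINT x|lebesgue. g x * fourier (\<lambda>x. ?\<phi> x * inv_fourier \<psi> x) x)"
      by (rule integral_completion[symmetric])
        (use borel_measurable_continuous_onI[OF g(1)] borel_measurable_continuous_onI[OF Fl(1)] in simp)
    finally show "function_distr ?G \<psi> = distr_inv_fourier (distr_mult ?\<phi> (distr_fourier (function_distr g))) \<psi>"
      by (simp add: distr_inv_fourier_def distr_mult_def distr_fourier_def function_distr_def)
  qed
  show "lp_piece \<phi>0 j (function_distr g) = ?G"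
    unfolding lp_piece_def
  proof (rule the_equality)
    show "continuous_on UNIV ?G \<and> (\<forall>\<psi>\<in>schwartz_space. integrable lebesgue (\<lambda>x. ?G x * \<psi> x) \<and>
        function_distr ?G \<psi> = distr_inv_fourier (distr_mult ?\<phi> (distr_fourier (function_distr g))) \<psi>)"
      using cG P by blast
    fix H assume H: "continuous_on UNIV H \<and> (\<forall>\<psi>\<in>schwartz_space. integrable lebesgue (\<lambda>x. H x * \<psi> x) \<and>
        function_distr H \<psi> = distr_inv_fourier (distr_mult ?\<phi> (distr_fourier (function_distr g))) \<psi>)"
    have "H x - ?G x = 0" for x
    proof (rule continuous_eq_0_if_test_integrals_0[of "\<lambda>x. H x - ?G x"])
      show "continuous_on UNIV (\<lambda>x. H x - ?G x)"
        using H cG by (intro continuous_intros) auto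
      fix \<psi> :: "real ^ 'd \<Rightarrow> complex" assume "test_function UNIV \<psi>"
      then have \<psi>: "\<psi> \<in> schwartz_space" by (rule test_function_schwartz)
      have *: "integrable lebesgue (\<lambda>x. H x * \<psi> x)" "integrable lebesgue (\<lambda>x. ?G x * \<psi> x)"
        "function_distr H \<psi> = function_distr ?G \<psi>"
        using H P[OF \<psi>] \<psi> by simp_all
      then show "(LINT x|lebesgue. (H x - ?G x) * \<psi> x) = 0"
        by (simp add: left_diff_distrib function_distr_def)
    qed
    then show "H = ?G" by (intro ext) simp
  qed
qed

subsection \<open>Injectivity of the Fourier transform\<close>

text \<open>The finite linear combinations of characters. Characters multiply to characters, so the
  real-valued members form a ring to which the Stone-Weierstrass theorem applies.\<close>

inductive_set trig_sums :: "('a::euclidean_space \<Rightarrow> complex) set" where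
  trig_exp: "(\<lambda>\<xi>. c * exp (\<i> * of_real (\<xi> \<bullet> x))) \<in> trig_sums"
| trig_add: "f \<in> trig_sums \<Longrightarrow> g \<in> trig_sums \<Longrightarrow> (\<lambda>\<xi>. f \<xi> + g \<xi>) \<in> trig_sums"

lemma trig_sums_mult:
  assumes "f \<in> trig_sums" "g \<in> trig_sums"
  shows "(\<lambda>\<xi>. f \<xi> * g \<xi>) \<in> trig_sums"
  using assms(1)
proof induction
  case (trig_exp c x)
  show ?case
    using assms(2)
  proof induction
    case (trig_exp c' x')
    have "(\<lambda>\<xi>. (c * exp (\<i> * of_real (\<xi> \<bullet> x))) * (c' * exp (\<i> * of_real (\<xi> \<bullet> x')))) =
        (\<lambda>\<xi>. (c * c') * exp (\<i> * of_real (\<xi> \<bullet> (x + x'))))"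
      by (simp add: inner_add_right exp_add algebra_simps)
    then show ?case by (simp only: trig_sums.trig_exp)
  next
    case (trig_add f g)
    then show ?case using trig_sums.trig_add by (simp add: distrib_left)
  qed
next
  case (trig_add f g)
  then show ?case using trig_sums.trig_add by (simp add: distrib_right)
qed

lemma trig_sums_continuous: "f \<in> trig_sums \<Longrightarrow> continuous_on S f"
  by (induction rule: trig_sums.induct) (intro continuous_intros; assumption)+

lemma cos_sin_trig_sums:
  "(\<lambda>\<xi>. complex_of_real (cos (\<xi> \<bullet> x))) \<in> trig_sums" "(\<lambda>\<xi>. complex_of_real (sin (\<xi> \<bullet> x))) \<in> trig_sums"
proof -
  have "(\<lambda>\<xi>. complex_of_real (cos (\<xi> \<bullet> x))) =
      (\<lambda>\<xi>. (1 / 2) * exp (\<i> * of_real (\<xi> \<bullet> x)) + (1 / 2) * exp (\<i> * of_real (\<xi> \<bullet> (- x))))"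
    by (simp add: cos_of_real[symmetric] cos_exp_eq field_simps)
  then show "(\<lambda>\<xi>. complex_of_real (cos (\<xi> \<bullet> x))) \<in> trig_sums"
    by (simp only: trig_sums.intros)
  have "(\<lambda>\<xi>. complex_of_real (sin (\<xi> \<bullet> x))) =
      (\<lambda>\<xi>. (1 / (2 * \<i>)) * exp (\<i> * of_real (\<xi> \<bullet> x)) + (- 1 / (2 * \<i>)) * exp (\<i> * of_real (\<xi> \<bullet> (- x))))"
    by (simp add: sin_of_real[symmetric] sin_exp_eq field_simps)
  then show "(\<lambda>\<xi>. complex_of_real (sin (\<xi> \<bullet> x))) \<in> trig_sums"
    by (simp only: trig_sums.intros)
qed

text \<open>If the Fourier integral of \<open>h\<close> vanishes, so does the integral of
  \<open>h\<close> against every trigonometric sum. On the compact set \<open>K\<close> the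
  real-valued ones are uniformly dense in the real continuous functions, so \<open>h\<close>
  integrates to zero against real and imaginary parts of test functions.\<close>

lemma osc_injective:
  fixes h :: "real ^ 'd::finite \<Rightarrow> complex"
  assumes h: "continuous_on UNIV h" "compact K" "\<And>x. x \<notin> K \<Longrightarrow> h x = 0"
    and osc0: "\<And>x. osc \<i> h x = 0"
  shows "h x = 0"
proof -
  have hi: "integrable lborel h"
    by (rule integrable_lborel_continuous_compact_support[OF h])
  have hf: "integrable lborel (\<lambda>\<xi>. h \<xi> * f \<xi>)" if "continuous_on UNIV f" for f :: "real ^ 'd \<Rightarrow> complex"
    by (rule integrable_lborel_continuous_compact_support[OF _ h(2)])
      (use h(1,3) that in \<open>auto intro: continuous_intros\<close>)
  have trig: "(LINT \<xi>|lborel. h \<xi> * f \<xi>) = 0" if "f \<in> trig_sums" for f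
    using that
  proof induction
    case (trig_exp c x)
    have "(LINT \<xi>|lborel. h \<xi> * (c * exp (\<i> * of_real (\<xi> \<bullet> x)))) = c * osc \<i> h x"
      unfolding osc_def by (subst integral_mult_right_zero[symmetric]) (simp only: mult_ac)
    then show ?case by (simp add: osc0)
  next
    case (trig_add f g)
    have "integrable lborel (\<lambda>\<xi>. h \<xi> * f \<xi>)" "integrable lborel (\<lambda>\<xi>. h \<xi> * g \<xi>)"
      by (intro hf trig_sums_continuous trig_add.hyps)+
    then show ?case
      using trig_add.IH by (simp add: distrib_left)
  qed
  define R where "R = {f :: real ^ 'd \<Rightarrow> real. (\<lambda>\<xi>. complex_of_real (f \<xi>)) \<in> trig_sums}"
  have contR: "continuous_on S f" if "f \<in> R" for f S
  proof -
    have "continuous_on S (\<lambda>\<xi>. complex_of_real (f \<xi>))"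
      using that by (intro trig_sums_continuous) (simp add: R_def)
    then have "continuous_on S (\<lambda>\<xi>. Re (complex_of_real (f \<xi>)))"
      by (rule continuous_on_Re)
    then show ?thesis by simp
  qed
  interpret function_ring_on R K
  proof
    show "compact K" by (rule h(2))
    show "continuous_on K f" if "f \<in> R" for f using that by (rule contR)
    show "(\<lambda>x. f x + g x) \<in> R" if "f \<in> R" "g \<in> R" for f g
      using that trig_sums.trig_add unfolding R_def by simp
    show "(\<lambda>x. f x * g x) \<in> R" if "f \<in> R" "g \<in> R" for f g
      using that trig_sums_mult unfolding R_def by simp
    show "(\<lambda>_. c) \<in> R" for c
      using trig_sums.trig_exp[of "complex_of_real c" 0] by (simp add: R_def)
    show "\<exists>f\<in>R. f x \<noteq> f y" if xy: "x \<in> K" "y \<in> K" "x \<noteq> y" for x y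
    proof (rule ccontr)
      assume *: "\<not> ?thesis"
      \<comment> \<open>Normalized so that the phases at \<open>x\<close> and \<open>y\<close>
        differ by exactly \<open>1\<close>; equal sines and cosines would then force
        \<open>cos 1 = 1\<close>.\<close>
      define v where "v = (1 / ((x - y) \<bullet> (x - y))) *\<^sub>R (x - y)"
      have v: "x \<bullet> v - y \<bullet> v = 1"
      proof -
        have "x \<bullet> v - y \<bullet> v = (x - y) \<bullet> v" by (rule inner_diff_left[symmetric])
        also have "\<dots> = 1" using xy(3) by (simp only: v_def inner_scaleR_right) simp
        finally show ?thesis .
      qed
      have eq: "f x = f y" if "f \<in> R" for f using * that by blast
      have "(\<lambda>\<xi>. cos (\<xi> \<bullet> v)) \<in> R" "(\<lambda>\<xi>. sin (\<xi> \<bullet> v)) \<in> R"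
        using cos_sin_trig_sums[of v] by (simp_all add: R_def)
      then have "cos (x \<bullet> v) = cos (y \<bullet> v)" "sin (x \<bullet> v) = sin (y \<bullet> v)"
        using eq[of "\<lambda>\<xi>. cos (\<xi> \<bullet> v)"] eq[of "\<lambda>\<xi>. sin (\<xi> \<bullet> v)"] by simp_all
      then have "cos (x \<bullet> v - y \<bullet> v) = 1"
        by (simp add: cos_diff flip: power2_eq_square)
      then have "cos (1 :: real) = cos 0" using v by simp
      moreover have "cos (1 :: real) < cos 0"
        by (rule cos_monotone_0_pi) (use pi_gt3 in auto)
      ultimately show False by simp
    qed
  qed
  have real0: "(LINT \<xi>|lborel. h \<xi> * complex_of_real (f \<xi>)) = 0" if f: "continuous_on UNIV f" for f
  proof -
    define I where "I = (LINT \<xi>|lborel. norm (h \<xi>))"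
    have I: "0 \<le> I" by (simp add: I_def)
    have fc: "continuous_on UNIV (\<lambda>\<xi>. complex_of_real (f \<xi>))"
      using f by (intro continuous_intros)
    have le: "norm (LINT \<xi>|lborel. h \<xi> * complex_of_real (f \<xi>)) \<le> e * I" if e: "e > 0" for e
    proof -
      obtain g where g: "g \<in> R" "\<And>x. x \<in> K \<Longrightarrow> \<bar>f x - g x\<bar> < e"
        using Stone_Weierstrass_basic[OF continuous_on_subset[OF f subset_UNIV] e] by blast
      have gc: "continuous_on UNIV (\<lambda>\<xi>. complex_of_real (g \<xi>))"
        using contR[OF g(1)] by (intro continuous_intros)
      have "(LINT \<xi>|lborel. h \<xi> * complex_of_real (f \<xi>)) =
          (LINT \<xi>|lborel. h \<xi> * complex_of_real (f \<xi>)) - (LINT \<xi>|lborel. h \<xi> * complex_of_real (g \<xi>))"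
        using trig[of "\<lambda>\<xi>. complex_of_real (g \<xi>)"] g(1) by (simp add: R_def)
      also have "\<dots> = (LINT \<xi>|lborel. h \<xi> * complex_of_real (f \<xi>) - h \<xi> * complex_of_real (g \<xi>))"
        by (rule Bochner_Integration.integral_diff[symmetric]) (intro hf fc gc)+
      also have "norm \<dots> \<le> (LINT \<xi>|lborel. norm (h \<xi> * complex_of_real (f \<xi>) - h \<xi> * complex_of_real (g \<xi>)))"
        by (rule integral_norm_bound)
      also have "\<dots> \<le> (LINT \<xi>|lborel. e * norm (h \<xi>))"
      proof (rule integral_mono)
        show "integrable lborel (\<lambda>\<xi>. norm (h \<xi> * complex_of_real (f \<xi>) - h \<xi> * complex_of_real (g \<xi>)))"
          by (intro integrable_norm Bochner_Integration.integrable_diff hf fc gc)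
        show "integrable lborel (\<lambda>\<xi>. e * norm (h \<xi>))"
          using hi by (intro integrable_mult_right integrable_norm)
        fix \<xi>
        have "norm (h \<xi> * complex_of_real (f \<xi>) - h \<xi> * complex_of_real (g \<xi>)) = \<bar>f \<xi> - g \<xi>\<bar> * norm (h \<xi>)"
          by (simp add: norm_mult flip: right_diff_distrib of_real_diff)
        also have "\<dots> \<le> e * norm (h \<xi>)"
          using g(2)[of \<xi>] h(3)[of \<xi>] by (cases "\<xi> \<in> K") (auto intro!: mult_right_mono)
        finally show "norm (h \<xi> * complex_of_real (f \<xi>) - h \<xi> * complex_of_real (g \<xi>)) \<le> e * norm (h \<xi>)" .
      qed
      also have "\<dots> = e * I" by (simp add: I_def)
      finally show ?thesis .
    qed
    have "norm (LINT \<xi>|lborel. h \<xi> * complex_of_real (f \<xi>)) \<le> 0"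
    proof (rule field_le_epsilon)
      fix e :: real assume e: "0 < e"
      \<comment> \<open>\<open>I\<close> may vanish, whence the denominator
        \<open>I + 1\<close>.\<close>
      have "norm (LINT \<xi>|lborel. h \<xi> * complex_of_real (f \<xi>)) \<le> e / (I + 1) * I"
        by (rule le) (use e I in simp)
      also have "\<dots> \<le> e" using e I by (simp add: field_simps)
      finally show "norm (LINT \<xi>|lborel. h \<xi> * complex_of_real (f \<xi>)) \<le> 0 + e" by simp
    qed
    then show ?thesis by simp
  qed
  show ?thesis
  proof (rule continuous_eq_0_if_test_integrals_0[OF h(1)])
    fix \<psi> :: "real ^ 'd \<Rightarrow> complex" assume "test_function UNIV \<psi>"
    then have "smooth_on UNIV \<psi>" by (simp add: test_function_def)
    from smooth_on_continuous[OF this, of "[]"] have \<psi>: "continuous_on UNIV \<psi>" by simp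
    have c: "continuous_on UNIV (\<lambda>x. Re (\<psi> x))" "continuous_on UNIV (\<lambda>x. Im (\<psi> x))"
      by (rule continuous_on_Re[OF \<psi>], rule continuous_on_Im[OF \<psi>])
    have i: "integrable lborel (\<lambda>x. h x * complex_of_real (Re (\<psi> x)))" "integrable lborel (\<lambda>x. h x * complex_of_real (Im (\<psi> x)))"
      by (rule hf[OF continuous_on_of_real[OF c(1)]], rule hf[OF continuous_on_of_real[OF c(2)]])
    have "(LINT x|lebesgue. h x * \<psi> x) = (LINT x|lborel. h x * \<psi> x)"
      by (rule integral_completion) (use borel_measurable_continuous_onI[OF h(1)] borel_measurable_continuous_onI[OF \<psi>] in simp)
    also have "\<dots> = (LINT x|lborel. h x * complex_of_real (Re (\<psi> x)) + \<i> * (h x * complex_of_real (Im (\<psi> x))))"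
    proof (rule Bochner_Integration.integral_cong[OF refl])
      fix x
      have "h x * \<psi> x = h x * (complex_of_real (Re (\<psi> x)) + \<i> * complex_of_real (Im (\<psi> x)))"
        using complex_eq[of "\<psi> x"] by simp
      then show "h x * \<psi> x = h x * complex_of_real (Re (\<psi> x)) + \<i> * (h x * complex_of_real (Im (\<psi> x)))"
        by (simp only: distrib_left mult_ac)
    qed
    also have "\<dots> = (LINT x|lborel. h x * complex_of_real (Re (\<psi> x))) + (LINT x|lborel. \<i> * (h x * complex_of_real (Im (\<psi> x))))"
      by (intro Bochner_Integration.integral_add integrable_mult_right i)
    also have "\<dots> = 0"
      using real0[OF c(1)] real0[OF c(2)] by simp
    finally show "(LINT x|lebesgue. h x * \<psi> x) = 0" .
  qed
qed

subsection \<open>Littlewood-Paley pieces of bumps\<close>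

lemma osc_affine:
  fixes h :: "'a::euclidean_space \<Rightarrow> complex"
  assumes [measurable]: "h \<in> borel_measurable borel" and r: "0 < r"
  shows "osc s (\<lambda>x. a * h ((1 / r) *\<^sub>R (x - y))) \<xi> =
    of_real (r ^ DIM('a)) * a * exp (s * of_real (y \<bullet> \<xi>)) * osc s h (r *\<^sub>R \<xi>)"
proof -
  have "osc s (\<lambda>x. a * h ((1 / r) *\<^sub>R (x - y))) \<xi> =
      \<bar>r\<bar> ^ DIM('a) *\<^sub>R (LINT x|lborel. exp (s * of_real ((y + r *\<^sub>R x) \<bullet> \<xi>)) * (a * h ((1 / r) *\<^sub>R (y + r *\<^sub>R x - y))))"
    unfolding osc_def using r by (intro lborel_integral_affine) auto
  also have "(\<lambda>x. exp (s * of_real ((y + r *\<^sub>R x) \<bullet> \<xi>)) * (a * h ((1 / r) *\<^sub>R (y + r *\<^sub>R x - y)))) =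
      (\<lambda>x. (a * exp (s * of_real (y \<bullet> \<xi>))) * (exp (s * of_real (x \<bullet> (r *\<^sub>R \<xi>))) * h x))"
    using r by (simp add: fun_eq_iff inner_add_left exp_add algebra_simps)
  also have "(LINT x|lborel. (a * exp (s * of_real (y \<bullet> \<xi>))) * (exp (s * of_real (x \<bullet> (r *\<^sub>R \<xi>))) * h x)) =
      a * exp (s * of_real (y \<bullet> \<xi>)) * osc s h (r *\<^sub>R \<xi>)"
    unfolding osc_def by simp
  finally show ?thesis using r by (simp add: scaleR_conv_of_real mult_ac)
qed

text \<open>The common profile of the resolution for all \<open>j \<ge> 1\<close>. It equals
  \<open>1\<close> on the sphere of radius \<open>3 / 2\<close>, where the first term is
  \<open>1\<close> and the second \<open>0\<close>; this shows that it is not identically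
  zero.\<close>

definition dyadic_annulus :: "(real ^ 'd::finite \<Rightarrow> complex) \<Rightarrow> real ^ 'd \<Rightarrow> complex" where
  "dyadic_annulus \<phi>0 y = \<phi>0 ((1 / 2) *\<^sub>R y) - \<phi>0 y"

lemma dyadic_resolution_eq:
  "1 \<le> j \<Longrightarrow> dyadic_resolution \<phi>0 j \<xi> = dyadic_annulus \<phi>0 ((2 powr (1 - real j)) *\<^sub>R \<xi>)"
  by (simp add: dyadic_resolution_def dyadic_annulus_def Let_def)

lemma dyadic_annulus_properties:
  assumes "lp_generator \<phi>0"
  shows "continuous_on UNIV (dyadic_annulus \<phi>0)" "\<And>x. x \<notin> cball 0 6 \<Longrightarrow> dyadic_annulus \<phi>0 x = 0"
    "\<And>x. norm x = 3 / 2 \<Longrightarrow> dyadic_annulus \<phi>0 x = 1"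
proof -
  have "dyadic_annulus \<phi>0 = dyadic_resolution \<phi>0 1"
    by (simp add: fun_eq_iff dyadic_resolution_eq)
  then show "continuous_on UNIV (dyadic_annulus \<phi>0)" "\<And>x. x \<notin> cball 0 6 \<Longrightarrow> dyadic_annulus \<phi>0 x = 0"
    using dyadic_resolution_continuous_support[OF assms, where j = 1] by simp_all
  show "dyadic_annulus \<phi>0 x = 1" if "norm x = 3 / 2" for x
    using assms that by (simp add: lp_generator_def dyadic_annulus_def)
qed

lemma cbump_integrable: "integrable lborel (cbump :: real ^ 'd::finite \<Rightarrow> complex)"
  and cbump_continuous: "continuous_on UNIV (cbump :: real ^ 'd::finite \<Rightarrow> complex)"
  and cbump_measurable: "(cbump :: real ^ 'd::finite \<Rightarrow> complex) \<in> borel_measurable borel"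
proof -
  show c: "continuous_on UNIV (cbump :: real ^ 'd \<Rightarrow> complex)"
    using smooth_on_continuous[OF smooth_on_cbump, of "[]"] by simp
  then show "integrable lborel (cbump :: real ^ 'd \<Rightarrow> complex)"
    by (rule integrable_lborel_continuous_compact_support[of _ "cball 0 (1 / 2)"])
      (auto intro: unit_bump_eq_0)
  show "(cbump :: real ^ 'd \<Rightarrow> complex) \<in> borel_measurable borel"
    by (rule borel_measurable_continuous_onI[OF c])
qed

text \<open>The piece of the unit bump at the dyadic frequency of index \<open>1 - J\<close>. For
  \<open>J \<ge> 1\<close> the inhomogeneous resolution has no annulus there, but for a bump of
  radius \<open>(1 / 2) ^ k\<close> the index becomes \<open>k + 1 - J\<close>.\<close>

definition scaled_piece :: "(real ^ 'd::finite \<Rightarrow> complex) \<Rightarrow> nat \<Rightarrow> real ^ 'd \<Rightarrow> complex" where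
  "scaled_piece \<phi>0 J = inv_fourier (\<lambda>\<eta>. dyadic_annulus \<phi>0 ((2 ^ J) *\<^sub>R \<eta>) * fourier cbump \<eta>)"

lemma scaled_multiplier:
  fixes \<phi>0 :: "real ^ 'd::finite \<Rightarrow> complex"
  assumes "lp_generator \<phi>0"
  shows "continuous_on UNIV (\<lambda>\<eta>. dyadic_annulus \<phi>0 ((2 ^ J) *\<^sub>R \<eta>) * fourier cbump \<eta>)" (is "continuous_on UNIV ?m")
    and "integrable lborel (\<lambda>\<eta>. dyadic_annulus \<phi>0 ((2 ^ J) *\<^sub>R \<eta>) * fourier cbump \<eta>)"
    and "(\<lambda>\<eta>. dyadic_annulus \<phi>0 ((2 ^ J) *\<^sub>R \<eta>) * fourier cbump \<eta>) \<in> borel_measurable borel"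
    and "continuous_on UNIV (scaled_piece \<phi>0 J)"
proof -
  note T = dyadic_annulus_properties[OF assms]
  have "continuous_on UNIV (\<lambda>\<eta>. dyadic_annulus \<phi>0 ((2 ^ J) *\<^sub>R \<eta>))"
    by (rule continuous_on_compose2[OF T(1)]) (auto intro: continuous_intros)
  then show c: "continuous_on UNIV ?m"
    by (intro continuous_on_mult fourier_continuous_bounded(1)[OF cbump_integrable])
  show i: "integrable lborel ?m"
  proof (rule integrable_lborel_continuous_compact_support[OF c])
    fix x :: "real ^ 'd" assume x: "x \<notin> cball 0 6"
    have "1 * norm x \<le> 2 ^ J * norm x"
      by (intro mult_right_mono) auto
    then have "(2 ^ J) *\<^sub>R x \<notin> cball 0 6" using x by simp
    then show "?m x = 0" using T(2) by simp
  qed simp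
  show "?m \<in> borel_measurable borel"
    by (rule borel_measurable_continuous_onI[OF c])
  show "continuous_on UNIV (scaled_piece \<phi>0 J)"
    unfolding scaled_piece_def by (rule fourier_continuous_bounded(2)[OF i])
qed

text \<open>Translation and dilation commute with taking pieces, up to a shift of the frequency
  index, which is an integer because \<open>r\<close> is a power of \<open>1 / 2\<close>. The
  condition \<open>J \<le> k\<close> makes the index at least \<open>1\<close>, where the resolution
  is a dilated annulus. The Jacobians of the two transforms cancel.\<close>

lemma lp_piece_rescaled_bump:
  fixes \<phi>0 :: "real ^ 'd::finite \<Rightarrow> complex"
  assumes \<phi>0: "lp_generator \<phi>0" and r: "r = (1 / 2) ^ k" and J: "J \<le> k"
  shows "inv_fourier (\<lambda>\<xi>. dyadic_resolution \<phi>0 (k + 1 - J) \<xi> * fourier (\<lambda>x. a * cbump ((1 / r) *\<^sub>R (x - y))) \<xi>) x =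
    a * scaled_piece \<phi>0 J ((1 / r) *\<^sub>R (x - y))"
proof -
  let ?\<kappa> = "complex_of_real ((2 * pi) powr (- real CARD('d) / 2))"
  let ?d = "CARD('d)"
  let ?g = "\<lambda>x. a * cbump ((1 / r) *\<^sub>R (x - y))"
  let ?m = "\<lambda>\<eta>. dyadic_annulus \<phi>0 ((2 ^ J) *\<^sub>R \<eta>) * fourier cbump \<eta>"
  define j where "j = k + 1 - J"
  have r0: "0 < r" by (simp add: r)
  have j: "1 \<le> j" "real j = real k + 1 - real J"
    using J by (auto simp: j_def of_nat_diff)
  have cg: "continuous_on UNIV ?g"
    by (intro continuous_on_mult_left continuous_on_compose2[OF cbump_continuous]) (auto intro!: continuous_intros)
  then have mg: "?g \<in> borel_measurable borel" by (rule borel_measurable_continuous_onI)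
  have scale: "dyadic_resolution \<phi>0 j \<xi> = dyadic_annulus \<phi>0 ((2 ^ J) *\<^sub>R (r *\<^sub>R \<xi>))" for \<xi>
  proof -
    have "(2 :: real) powr (1 - real j) = 2 ^ J * r"
    proof -
      have "(2 :: real) powr (1 - real j) = 2 powr real J * 2 powr (- real k)"
        by (simp add: j flip: powr_add)
      then show ?thesis by (simp add: r powr_realpow powr_minus power_one_over inverse_eq_divide)
    qed
    then show ?thesis using dyadic_resolution_eq[OF j(1)] by simp
  qed
  have Fg: "fourier ?g \<xi> = of_real (r ^ ?d) * a * exp (- \<i> * of_real (y \<bullet> \<xi>)) * fourier cbump (r *\<^sub>R \<xi>)" for \<xi>
    unfolding fourier_eq_osc[OF mg] fourier_eq_osc[OF cbump_measurable] osc_affine[OF cbump_measurable r0]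
    by simp
  have eq: "(\<lambda>\<xi>. dyadic_resolution \<phi>0 j \<xi> * fourier ?g \<xi>) =
      (\<lambda>\<xi>. of_real (r ^ ?d) * a * exp (- \<i> * of_real (y \<bullet> \<xi>)) * ?m (r *\<^sub>R \<xi>))"
    by (simp add: fun_eq_iff Fg scale mult_ac)
  have mm [measurable]: "?m \<in> borel_measurable borel" by (rule scaled_multiplier[OF \<phi>0])
  have cm: "continuous_on UNIV (\<lambda>\<xi>. of_real (r ^ ?d) * a * exp (- \<i> * of_real (y \<bullet> \<xi>)) * ?m (r *\<^sub>R \<xi>))"
    by (intro continuous_on_mult continuous_on_compose2[OF scaled_multiplier(1)[OF \<phi>0]] continuous_intros) auto
  then have mm2: "(\<lambda>\<xi>. of_real (r ^ ?d) * a * exp (- \<i> * of_real (y \<bullet> \<xi>)) * ?m (r *\<^sub>R \<xi>)) \<in> borel_measurable borel"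
    by (rule borel_measurable_continuous_onI)
  have "osc \<i> (\<lambda>\<xi>. of_real (r ^ ?d) * a * exp (- \<i> * of_real (y \<bullet> \<xi>)) * ?m (r *\<^sub>R \<xi>)) x =
      (LINT \<xi>|lborel. of_real (r ^ ?d) * a * (exp (\<i> * of_real ((r *\<^sub>R \<xi>) \<bullet> ((1 / r) *\<^sub>R (x - y)))) * ?m (r *\<^sub>R \<xi>)))"
    unfolding osc_def
  proof (rule Bochner_Integration.integral_cong[OF refl])
    fix \<xi>
    have "exp (\<i> * of_real ((r *\<^sub>R \<xi>) \<bullet> ((1 / r) *\<^sub>R (x - y)))) = exp (\<i> * of_real (\<xi> \<bullet> x)) * exp (- \<i> * of_real (y \<bullet> \<xi>))"
      using r0 by (simp add: inner_diff_right inner_commute[of y] algebra_simps flip: exp_add)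
    then show "exp (\<i> * of_real (\<xi> \<bullet> x)) * (of_real (r ^ ?d) * a * exp (- \<i> * of_real (y \<bullet> \<xi>)) * ?m (r *\<^sub>R \<xi>)) =
        of_real (r ^ ?d) * a * (exp (\<i> * of_real ((r *\<^sub>R \<xi>) \<bullet> ((1 / r) *\<^sub>R (x - y)))) * ?m (r *\<^sub>R \<xi>))"
      by (simp only: mult_ac)
  qed
  also have "\<dots> = a * (\<bar>r\<bar> ^ ?d *\<^sub>R (LINT \<xi>|lborel. exp (\<i> * of_real ((0 + r *\<^sub>R \<xi>) \<bullet> ((1 / r) *\<^sub>R (x - y)))) * ?m (0 + r *\<^sub>R \<xi>)))"
    using r0 by (simp add: scaleR_conv_of_real mult_ac)
  also have "\<dots> = a * osc \<i> ?m ((1 / r) *\<^sub>R (x - y))"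
    unfolding osc_def
    using lborel_integral_affine[of "\<lambda>\<eta>. exp (\<i> * of_real (\<eta> \<bullet> ((1 / r) *\<^sub>R (x - y)))) * ?m \<eta>" r 0] r0
    by simp
  finally show ?thesis
    unfolding j_def[symmetric] eq scaled_piece_def fourier_eq_osc(2)[OF mm2] fourier_eq_osc(2)[OF mm]
    by simp
qed

text \<open>Up to normalization this is the integral of a nonnegative continuous function that is
  positive at the origin.\<close>

lemma fourier_cbump_0: "fourier cbump (0 :: real ^ 'd::finite) \<noteq> 0"
proof
  assume *: "fourier cbump (0 :: real ^ 'd) = 0"
  have c: "continuous_on UNIV (unit_bump :: real ^ 'd \<Rightarrow> real)"
    using smooth_on_continuous[OF smooth_on_unit_bump, of "[]"] by simp
  have i: "integrable lborel (unit_bump :: real ^ 'd \<Rightarrow> real)"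
    by (rule integrable_lborel_continuous_compact_support[OF c, of "cball 0 (1 / 2)"])
      (auto intro: unit_bump_eq_0)
  have "osc (- \<i>) cbump (0 :: real ^ 'd) = complex_of_real (LINT x|lborel. unit_bump (x :: real ^ 'd))"
    unfolding osc_def by (simp add: integral_complex_of_real)
  then have "(LINT x|lborel. unit_bump (x :: real ^ 'd)) = 0"
    using * unfolding fourier_eq_osc(1)[OF cbump_measurable] by simp
  then have "AE x in lborel. unit_bump (x :: real ^ 'd) = 0"
    using integral_nonneg_eq_0_iff_AE[OF i AE_I2[OF unit_bump_nonneg]] by simp
  from continuous_eq_0_if_AE_eq_0[OF c AE_completion[OF this], of 0] show False
    using unit_bump_0[where 'a = 'd] by simp
qed

text \<open>As \<open>J\<close> grows, the multiplier sees only the mean of the bump, and the pieces rescale to the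
  inverse Fourier transform of the annulus, which does not vanish identically.\<close>

lemma scaled_piece_nonzero:
  fixes \<phi>0 :: "real ^ 'd::finite \<Rightarrow> complex"
  assumes \<phi>0: "lp_generator \<phi>0"
  shows "\<exists>J x. scaled_piece \<phi>0 J x \<noteq> 0"
proof (rule ccontr)
  assume "\<not> ?thesis"
  then have zero: "scaled_piece \<phi>0 J x = 0" for J x by blast
  let ?T = "dyadic_annulus \<phi>0"
  note T = dyadic_annulus_properties[OF \<phi>0]
  have Ti: "integrable lborel ?T"
    by (rule integrable_lborel_continuous_compact_support[OF T(1), of "cball 0 6"]) (use T(2) in auto)
  have Tm: "?T \<in> borel_measurable borel" by (rule borel_measurable_continuous_onI[OF T(1)])
  let ?F = "fourier (cbump :: real ^ 'd \<Rightarrow> complex)"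
  note F = fourier_continuous_bounded[OF cbump_integrable[where 'd = 'd]]
  obtain B where B: "\<And>x. norm (?F x) \<le> B" using F(3) by blast
  have meas: "(\<lambda>\<zeta>. exp (\<i> * of_real (\<zeta> \<bullet> z)) * (?T \<zeta> * ?F ((1 / 2 ^ J) *\<^sub>R \<zeta>))) \<in> borel_measurable borel" for J z
    by (intro borel_measurable_continuous_onI continuous_on_mult T(1) continuous_on_compose2[OF F(1)] continuous_intros) auto
  \<comment> \<open>Substituting \<open>\<zeta> = 2 ^ J \<eta>\<close> fixes the annulus and moves
    the dilation into the transform of the bump, whose argument then tends to
    \<open>0\<close>.\<close>
  have int0: "(LINT \<zeta>|lborel. exp (\<i> * of_real (\<zeta> \<bullet> z)) * (?T \<zeta> * ?F ((1 / 2 ^ J) *\<^sub>R \<zeta>))) = 0" for J z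
  proof -
    let ?m = "\<lambda>\<eta>. ?T ((2 ^ J) *\<^sub>R \<eta>) * ?F \<eta>"
    have "osc \<i> ?m ((2 ^ J) *\<^sub>R z) = 0"
      using zero[of J "(2 ^ J) *\<^sub>R z"] unfolding scaled_piece_def fourier_eq_osc(2)[OF scaled_multiplier(3)[OF \<phi>0]] by simp
    then show ?thesis
      using lborel_integral_affine[OF meas, of "2 ^ J" z J 0] by (simp add: osc_def mult.commute)
  qed
  have lim: "(\<lambda>J. LINT \<zeta>|lborel. exp (\<i> * of_real (\<zeta> \<bullet> z)) * (?T \<zeta> * ?F ((1 / 2 ^ J) *\<^sub>R \<zeta>)))
      \<longlonglongrightarrow> (LINT \<zeta>|lborel. exp (\<i> * of_real (\<zeta> \<bullet> z)) * (?T \<zeta> * ?F 0))" for z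
  proof (rule integral_dominated_convergence[where w = "\<lambda>\<zeta>. norm (?T \<zeta>) * B"])
    show "(\<lambda>\<zeta>. exp (\<i> * of_real (\<zeta> \<bullet> z)) * (?T \<zeta> * ?F 0)) \<in> borel_measurable lborel"
      using Tm by simp
    show "(\<lambda>\<zeta>. exp (\<i> * of_real (\<zeta> \<bullet> z)) * (?T \<zeta> * ?F ((1 / 2 ^ J) *\<^sub>R \<zeta>))) \<in> borel_measurable lborel" for J
      using meas by simp
    show "integrable lborel (\<lambda>\<zeta>. norm (?T \<zeta>) * B)"
      by (intro integrable_mult_left integrable_norm Ti)
    show "AE \<zeta> in lborel. (\<lambda>J. exp (\<i> * of_real (\<zeta> \<bullet> z)) * (?T \<zeta> * ?F ((1 / 2 ^ J) *\<^sub>R \<zeta>))) \<longlonglongrightarrow>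
        exp (\<i> * of_real (\<zeta> \<bullet> z)) * (?T \<zeta> * ?F 0)"
    proof (intro AE_I2)
      fix \<zeta> :: "real ^ 'd"
      have "(\<lambda>J. (1 / 2) ^ J *\<^sub>R \<zeta>) \<longlonglongrightarrow> 0 *\<^sub>R \<zeta>"
        by (intro tendsto_intros LIMSEQ_power_zero) simp
      then have "(\<lambda>J. (1 / 2 ^ J) *\<^sub>R \<zeta>) \<longlonglongrightarrow> 0"
        by (simp add: power_one_over)
      then have "(\<lambda>J. ?F ((1 / 2 ^ J) *\<^sub>R \<zeta>)) \<longlonglongrightarrow> ?F 0"
        using continuous_on_tendsto_compose[OF F(1), of "\<lambda>J. (1 / 2 ^ J) *\<^sub>R \<zeta>" 0 sequentially] by simp
      then show "(\<lambda>J. exp (\<i> * of_real (\<zeta> \<bullet> z)) * (?T \<zeta> * ?F ((1 / 2 ^ J) *\<^sub>R \<zeta>))) \<longlonglongrightarrow>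
          exp (\<i> * of_real (\<zeta> \<bullet> z)) * (?T \<zeta> * ?F 0)"
        by (intro tendsto_intros)
    qed
    show "AE \<zeta> in lborel. norm (exp (\<i> * of_real (\<zeta> \<bullet> z)) * (?T \<zeta> * ?F ((1 / 2 ^ J) *\<^sub>R \<zeta>))) \<le> norm (?T \<zeta>) * B" for J
      using B by (intro AE_I2) (simp add: norm_mult mult_left_mono)
  qed
  have osc0: "osc \<i> ?T z = 0" for z
  proof -
    have "(LINT \<zeta>|lborel. exp (\<i> * of_real (\<zeta> \<bullet> z)) * (?T \<zeta> * ?F 0)) = 0"
      using lim[of z] LIMSEQ_unique[of "\<lambda>n. 0 :: complex" _ 0] unfolding int0 by simp
    moreover have "(LINT \<zeta>|lborel. exp (\<i> * of_real (\<zeta> \<bullet> z)) * (?T \<zeta> * ?F 0)) = osc \<i> ?T z * ?F 0"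
      unfolding osc_def mult.assoc[symmetric] by simp
    ultimately show ?thesis using fourier_cbump_0[where 'd = 'd] by simp
  qed
  have "?T x = 0" for x
    by (rule osc_injective[where h = ?T and K = "cball 0 6"]) (use T(1,2) osc0 in simp_all)
  moreover have "?T ((3 / 2) *\<^sub>R axis (SOME i. True) 1) = 1"
    by (rule T(3)) (simp add: norm_axis_1)
  ultimately show False by simp
qed

lemma nn_integral_scaled_piece_pos:
  fixes \<phi>0 :: "real ^ 'd::finite \<Rightarrow> complex"
  assumes \<phi>0: "lp_generator \<phi>0"
  shows "\<exists>J \<kappa>. 0 < \<kappa> \<and> ennreal \<kappa> \<le> (\<integral>\<^sup>+x. ennreal (norm (scaled_piece \<phi>0 J x) powr \<tau>) \<partial>lborel)"
proof -
  from scaled_piece_nonzero[OF \<phi>0] obtain J x0 where x0: "scaled_piece \<phi>0 J x0 \<noteq> 0"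
    by (elim exE)
  have c: "continuous_on UNIV (scaled_piece \<phi>0 J)" by (rule scaled_multiplier(4)[OF \<phi>0])
  then have [measurable]: "scaled_piece \<phi>0 J \<in> borel_measurable borel"
    by (rule borel_measurable_continuous_onI)
  let ?I = "\<integral>\<^sup>+x. ennreal (norm (scaled_piece \<phi>0 J x) powr \<tau>) \<partial>lborel"
  have z: "ennreal (t powr \<tau>) = 0 \<longleftrightarrow> t = 0" for t
  proof -
    have "ennreal (t powr \<tau>) = 0 \<longleftrightarrow> t powr \<tau> = 0"
      using powr_ge_zero[of t \<tau>] unfolding ennreal_eq_0_iff by linarith
    then show ?thesis by simp
  qed
  have "?I \<noteq> 0"
  proof
    assume "?I = 0"
    then have "AE x in lborel. scaled_piece \<phi>0 J x = 0"
      by (subst (asm) nn_integral_0_iff_AE) (auto simp: z)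
    from continuous_eq_0_if_AE_eq_0[OF c AE_completion[OF this]] x0 show False by blast
  qed
  \<comment> \<open>Finiteness of the integral is not claimed; truncation at \<open>1\<close> turns
    it into a real lower bound.\<close>
  then have "0 < min ?I 1" by (simp add: zero_less_iff_neq_zero)
  moreover have fin: "min ?I 1 < top" by (simp add: min_less_iff_disj)
  ultimately have "0 < enn2real (min ?I 1)" by (simp add: enn2real_positive_iff)
  moreover have "ennreal (enn2real (min ?I 1)) \<le> ?I"
    using fin by (simp add: ennreal_enn2real)
  ultimately show ?thesis by blast
qed

subsection \<open>Whitney cubes near a bump\<close>

lemma dist_double_cube_le:
  fixes x x' :: "real ^ 'd::finite"
  assumes "x \<in> double_cube w" "x' \<in> double_cube w"
  shows "dist x x' \<le> 2 * real CARD('d) / 2 ^ fst w"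
proof -
  obtain j k where w: "w = (j, k)" by (cases w)
  have "norm (x - x') \<le> (\<Sum>i\<in>UNIV. \<bar>(x - x') $ i\<bar>)" by (rule norm_le_l1_cart)
  also have "\<dots> \<le> (\<Sum>i\<in>(UNIV :: 'd set). 2 / 2 ^ j)"
  proof (rule sum_mono)
    fix i
    define z :: real where "z = (of_int (k $ i) + 1 / 2) / 2 ^ j"
    have "\<bar>x $ i - z\<bar> < 1 / 2 ^ j" "\<bar>x' $ i - z\<bar> < 1 / 2 ^ j"
      using assms by (auto simp: w double_cube_def z_def)
    then show "\<bar>(x - x') $ i\<bar> \<le> 2 / 2 ^ j" by simp
  qed
  finally show ?thesis by (simp add: w dist_norm mult.commute)
qed

lemma dyadic_cube_eq_box:
  "dyadic_cube (j, k) = box (\<chi> i. of_int (k $ i) / 2 ^ j) (\<chi> i. (of_int (k $ i) + 1) / 2 ^ j)"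
  by (auto simp: dyadic_cube_def mem_box_cart)

lemma dyadic_cube_subset_double_cube: "dyadic_cube w \<subseteq> double_cube w"
proof
  fix x assume x: "x \<in> dyadic_cube w"
  obtain j k where w: "w = (j, k)" by (cases w)
  have "\<bar>x $ i - (of_int (k $ i) + 1 / 2) / 2 ^ j\<bar> < 1 / 2 ^ j" for i
  proof -
    have "of_int (k $ i) / 2 ^ j < x $ i" "x $ i < (of_int (k $ i) + 1) / 2 ^ j"
      using x by (auto simp: w dyadic_cube_def)
    moreover have "(of_int (k $ i) + 1 / 2) / 2 ^ j = of_int (k $ i) / 2 ^ j + (1 / 2) * (1 / 2 ^ j :: real)"
      "(of_int (k $ i) + 1) / 2 ^ j = of_int (k $ i) / 2 ^ j + (1 / 2 ^ j :: real)"
      by (simp_all add: add_divide_distrib)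
    moreover have "(0 :: real) < 1 / 2 ^ j" by simp
    ultimately show ?thesis by (simp add: abs_less_iff)
  qed
  then show "x \<in> double_cube w" by (simp add: w double_cube_def)
qed

lemma measure_dyadic_cube:
  "measure lborel (dyadic_cube w :: (real ^ 'd::finite) set) = (1 / 2 ^ fst w) ^ CARD('d)"
proof -
  obtain j and k :: "int ^ 'd" where w: "w = (j, k)" by (cases w)
  define lo hi :: "real ^ 'd" where "lo = (\<chi> i. of_int (k $ i) / 2 ^ j)" and "hi = (\<chi> i. (of_int (k $ i) + 1) / 2 ^ j)"
  have "\<forall>b\<in>Basis. lo \<bullet> b \<le> hi \<bullet> b"
    by (auto simp: lo_def hi_def Basis_vec_def inner_axis divide_right_mono)
  then have "measure lborel (box lo hi) = (\<Prod>b\<in>Basis. (hi - lo) \<bullet> b)"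
    by (intro measure_lborel_box) blast
  also have "\<dots> = (\<Prod>b\<in>(Basis :: (real ^ 'd) set). 1 / 2 ^ j)"
    by (intro prod.cong refl) (auto simp: lo_def hi_def Basis_vec_def inner_axis diff_divide_distrib[symmetric])
  finally show ?thesis by (simp add: w dyadic_cube_eq_box lo_def hi_def)
qed

text \<open>The segment from \<open>x\<close> to the point \<open>s\<close> outside \<open>D\<close>
  crosses the frontier, so the cube is at most \<open>A * r\<close> away from it, and this limits
  the size of the cube. Conversely the frontier is at least \<open>r / 2\<close> away from
  \<open>x\<close>, and the double cube has diameter of order \<open>1 / 2 ^ fst w\<close>, so a
  very small cube would be too far from the frontier.\<close>

lemma whitney_cube_size:
  fixes D :: "(real ^ 'd::finite) set"
  assumes "whitney_decomposition D W"
  shows "\<exists>c K. 0 < c \<and> 1 \<le> K \<and> (\<forall>w\<in>W. \<forall>x\<in>double_cube w. \<forall>r s A.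
    0 < r \<and> r \<le> 1 \<and> ball x (r / 2) \<subseteq> D \<and> s \<notin> D \<and> dist x s \<le> A * r \<longrightarrow>
    c / 2 ^ fst w \<le> A * r \<and> r \<le> K / 2 ^ fst w)"
proof -
  obtain c1 C1 where c1: "0 < c1" "0 < C1"
    "\<And>w. w \<in> W \<Longrightarrow> 1 \<le> fst w \<Longrightarrow> c1 / 2 ^ fst w \<le> setdist (double_cube w) (frontier D) \<and>
        setdist (double_cube w) (frontier D) \<le> C1 / 2 ^ fst w"
    using assms unfolding whitney_decomposition_def by blast
  obtain c0 where c0: "0 < c0" "\<And>w. w \<in> W \<Longrightarrow> fst w = 0 \<Longrightarrow> c0 \<le> setdist (double_cube w) (frontier D)"
    using assms unfolding whitney_decomposition_def by blast
  define c where "c = min c0 c1"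
  define K where "K = max 1 (2 * (C1 + 2 * real CARD('d)))"
  have "c / 2 ^ fst w \<le> A * r \<and> r \<le> K / 2 ^ fst w"
    if w: "w \<in> W" "x \<in> double_cube w" and r: "0 < r" "r \<le> 1" "ball x (r / 2) \<subseteq> D" and s: "s \<notin> D" "dist x s \<le> A * r"
    for w x r s A
  proof -
    have "x \<in> D" using r by auto
    then have "closed_segment x s \<inter> D \<noteq> {}" "closed_segment x s - D \<noteq> {}"
      using s(1) ends_in_segment[of x s] by blast+
    then have "closed_segment x s \<inter> frontier D \<noteq> {}"
      by (intro connected_Int_frontier connected_segment)
    then obtain f where f: "f \<in> closed_segment x s" "f \<in> frontier D" by blast
    have "setdist (double_cube w) (frontier D) \<le> dist x f"
      by (rule setdist_le_dist[OF w(2) f(2)])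
    also have "\<dots> \<le> dist x s"
      using dist_in_closed_segment[OF f(1)] by (simp add: dist_commute)
    finally have up: "setdist (double_cube w) (frontier D) \<le> A * r" using s(2) by linarith
    have low: "r / 2 - 2 * real CARD('d) / 2 ^ fst w \<le> setdist (double_cube w) (frontier D)"
    proof (rule le_setdistI)
      fix x' g assume x': "x' \<in> double_cube w" and g: "g \<in> frontier D"
      have "g \<notin> ball x (r / 2)"
        using r(3) g interior_maximal[OF r(3) open_ball] by (auto simp: frontier_def)
      then have "r / 2 \<le> dist x x' + dist x' g"
        using dist_triangle[of x g x'] by simp
      then show "r / 2 - 2 * real CARD('d) / 2 ^ fst w \<le> dist x' g"
        using dist_double_cube_le[OF w(2) x'] by simp
    qed (use w(2) f(2) in auto)
    show ?thesis
    proof (cases "fst w = 0")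
      \<comment> \<open>For unit cubes the decomposition bounds the distance from the frontier only
        from below; the second inequality comes from \<open>r \<le> 1 \<le> K\<close>.\<close>
      case True
      then have "c0 \<le> A * r" using c0(2)[OF w(1)] up by linarith
      then show ?thesis
        using True r by (simp add: c_def K_def min_le_iff_disj le_max_iff_disj)
    next
      case False
      have "c / 2 ^ fst w \<le> c1 / 2 ^ fst w"
        by (intro divide_right_mono) (auto simp: c_def)
      moreover have "r \<le> 2 * (C1 + 2 * real CARD('d)) / 2 ^ fst w"
        using low c1(3)[OF w(1)] False by (simp add: add_divide_distrib)
      moreover have "2 * (C1 + 2 * real CARD('d)) / 2 ^ fst w \<le> K / 2 ^ fst w"
        by (intro divide_right_mono) (auto simp: K_def)
      ultimately show ?thesis
        using up c1(3)[OF w(1)] False by force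
    qed
  qed
  moreover have "0 < c" "1 \<le> K" using c0 c1 by (auto simp: c_def K_def)
  ultimately show ?thesis by (intro exI[of _ c] exI[of _ K]) blast
qed

text \<open>A packing argument. The disjoint cubes have volume at least \<open>(r / K) ^ d\<close>
  each. Their doubles meet \<open>cball y r\<close> and have diameter at most
  \<open>2 * d * B * r\<close>, so all cubes lie in the ball of radius
  \<open>(1 + 2 * d * B) * r\<close>, and the volumes are compared.\<close>

lemma card_cubes_meeting_ball:
  fixes y :: "real ^ 'd::finite"
  assumes disj: "disjoint_family_on dyadic_cube F"
    and r: "0 < r" and K: "0 < K" and B: "0 \<le> B"
    and size: "\<And>w. w \<in> F \<Longrightarrow> r / K \<le> 1 / 2 ^ fst w \<and> 1 / 2 ^ fst w \<le> B * r"
    and meet: "\<And>w. w \<in> F \<Longrightarrow> double_cube w \<inter> cball y r \<noteq> {}"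
  shows "finite F" "real (card F) \<le> unit_ball_vol (real CARD('d)) * (K * (1 + 2 * real CARD('d) * B)) ^ CARD('d)"
proof -
  let ?d = "CARD('d)"
  let ?R = "(1 + 2 * real ?d * B) * r"
  let ?N = "unit_ball_vol (real ?d) * (K * (1 + 2 * real ?d * B)) ^ ?d"
  have R: "0 \<le> ?R" using r B by simp
  have sub: "dyadic_cube w \<subseteq> cball y ?R" if w: "w \<in> F" for w
  proof
    fix x assume "x \<in> dyadic_cube w"
    then have x: "x \<in> double_cube w" using dyadic_cube_subset_double_cube by blast
    obtain z where z: "z \<in> double_cube w" "dist y z \<le> r" using meet[OF w] by auto
    have "2 * real ?d * (1 / 2 ^ fst w) \<le> 2 * real ?d * (B * r)"
      using size[OF w] by (intro mult_left_mono) auto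
    then have "dist z x \<le> 2 * real ?d * (B * r)"
      using dist_double_cube_le[OF z(1) x] by simp
    then show "x \<in> cball y ?R"
      using dist_triangle[of y x z] z(2) by (simp add: algebra_simps)
  qed
  have bound: "real (card H) \<le> ?N" if H: "H \<subseteq> F" "finite H" for H
  proof -
    have "real (card H) * (r / K) ^ ?d = (\<Sum>w\<in>H. (r / K) ^ ?d)" by simp
    also have "\<dots> \<le> (\<Sum>w\<in>H. measure lborel (dyadic_cube w :: (real ^ 'd) set))"
      unfolding measure_dyadic_cube using size H r K by (intro sum_mono power_mono) auto
    also have "\<dots> = measure lborel (\<Union>w\<in>H. dyadic_cube w :: (real ^ 'd) set)"
    proof (rule measure_finite_Union[symmetric])
      show "finite H" by (rule H(2))
      show "dyadic_cube ` H \<subseteq> sets (lborel :: (real ^ 'd) measure)"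
      proof
        fix A assume "A \<in> dyadic_cube ` H"
        then obtain j and k :: "int ^ 'd" where "A = dyadic_cube (j, k)" by auto
        then show "A \<in> sets lborel" by (simp add: dyadic_cube_eq_box)
      qed
      show "disjoint_family_on dyadic_cube H"
        using disj H(1) by (rule disjoint_family_on_mono[rotated])
      show "emeasure lborel (dyadic_cube w :: (real ^ 'd) set) \<noteq> \<infinity>" for w
        by (cases w) (simp add: dyadic_cube_eq_box emeasure_lborel_box_eq)
    qed
    also have "\<dots> \<le> measure lborel (cball y ?R)"
    proof (rule measure_mono_fmeasurable)
      show "(\<Union>w\<in>H. dyadic_cube w) \<subseteq> cball y ?R" using sub H by blast
      have "dyadic_cube w \<in> sets borel" for w :: "nat \<times> (int ^ 'd)"
        by (cases w) (simp add: dyadic_cube_eq_box)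
      then show "(\<Union>w\<in>H. dyadic_cube w) \<in> sets (lborel :: (real ^ 'd) measure)"
        using H(2) by (intro sets.finite_UN) auto
      show "cball y ?R \<in> fmeasurable lborel"
        using emeasure_compact_finite[OF compact_cball[of y ?R]] by (simp add: fmeasurable_def)
    qed
    also have "\<dots> = unit_ball_vol (real ?d) * ?R ^ ?d"
      using R by (simp add: measure_def emeasure_cball)
    also have "\<dots> = ?N * (r / K) ^ ?d"
      using K by (simp add: power_mult_distrib power_divide)
    finally show ?thesis using r K by (simp add: mult_le_cancel_right)
  qed
  \<comment> \<open>The bound for all finite subfamilies also yields the finiteness of
    \<open>F\<close>.\<close>
  have "finite F \<and> card F \<le> nat \<lfloor>?N\<rfloor>"
    by (rule finite_if_finite_subsets_card_bdd) (use bound le_nat_floor in blast)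
  then show "finite F" "real (card F) \<le> ?N"
    using bound[of F] by auto
qed

subsection \<open>Divergence of the refined localization norm\<close>

lemma epowr_ennreal: "0 \<le> t \<Longrightarrow> epowr (ennreal t) q = ennreal (t powr q)"
  by (simp add: epowr_def)

lemma epowr_mono:
  assumes "x \<le> y" "0 \<le> q"
  shows "epowr x q \<le> epowr y q"
proof (cases "y = \<infinity>")
  case False
  then have y: "y < top" by (simp add: less_top)
  then have "x < top" using assms(1) by (rule le_less_trans[rotated])
  moreover have "enn2real x powr q \<le> enn2real y powr q"
    using assms y by (intro powr_mono2 enn2real_mono) auto
  ultimately show ?thesis
    using False by (auto simp: epowr_def ennreal_leI)
qed (simp add: epowr_def)

lemma epowr_epowr:
  assumes "a * b = 1"
  shows "epowr (epowr x a) b = x"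
proof (cases "x = \<infinity>")
  case False
  then have "epowr (epowr x a) b = ennreal ((enn2real x powr a) powr b)"
    by (simp add: epowr_def)
  also have "(enn2real x powr a) powr b = enn2real x"
    using assms by (simp add: powr_powr)
  finally show ?thesis
    using False by (simp add: less_top)
qed (simp add: epowr_def)

lemma le_lq_norm_2: "b j \<le> lq_norm 2 b"
proof -
  have "b j = epowr (epowr (b j) 2) (1 / 2)"
    by (simp add: epowr_epowr)
  also have "\<dots> \<le> epowr (\<Sum>j. epowr (b j) 2) (1 / 2)"
  proof (rule epowr_mono)
    show "epowr (b j) 2 \<le> (\<Sum>j. epowr (b j) 2)"
      using sum_le_suminf[of "\<lambda>j. epowr (b j) 2" "{j}"] by simp
  qed simp
  also have "\<dots> = lq_norm 2 b" by (simp add: lq_norm_def)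
  finally show ?thesis .
qed

lemma nn_integral_lp_piece_le_tl_norm:
  assumes \<tau>: "0 < \<tau>"
  shows "(\<integral>\<^sup>+x. ennreal ((2 powr (real j * s) * norm (lp_piece \<phi>0 j T x)) powr \<tau>) \<partial>lebesgue) \<le>
    epowr (tl_norm \<phi>0 s \<tau> 2 T) \<tau>"
proof -
  let ?b = "\<lambda>x j. ennreal (2 powr (real j * s) * norm (lp_piece \<phi>0 j T x))"
  have "(\<integral>\<^sup>+x. ennreal ((2 powr (real j * s) * norm (lp_piece \<phi>0 j T x)) powr \<tau>) \<partial>lebesgue) \<le>
      (\<integral>\<^sup>+x. epowr (lq_norm 2 (?b x)) \<tau> \<partial>lebesgue)"
  proof (rule nn_integral_mono)
    fix x
    have "ennreal ((2 powr (real j * s) * norm (lp_piece \<phi>0 j T x)) powr \<tau>) = epowr (?b x j) \<tau>"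
      by (simp add: epowr_ennreal)
    also have "\<dots> \<le> epowr (lq_norm 2 (?b x)) \<tau>"
      by (rule epowr_mono[OF le_lq_norm_2]) (use \<tau> in simp)
    finally show "ennreal ((2 powr (real j * s) * norm (lp_piece \<phi>0 j T x)) powr \<tau>) \<le> epowr (lq_norm 2 (?b x)) \<tau>" .
  qed
  also have "\<dots> = epowr (tl_norm \<phi>0 s \<tau> 2 T) \<tau>"
    unfolding tl_norm_def Lp_norm_def using \<tau> by (subst epowr_epowr) simp_all
  finally show ?thesis .
qed

lemma osc_sum:
  assumes "\<And>w. w \<in> F \<Longrightarrow> integrable lborel (h w)" "Re s = 0"
  shows "osc s (\<lambda>x. \<Sum>w\<in>F. h w x) \<xi> = (\<Sum>w\<in>F. osc s (h w) \<xi>)"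
proof -
  have "osc s (\<lambda>x. \<Sum>w\<in>F. h w x) \<xi> = (LINT x|lborel. (\<Sum>w\<in>F. exp (s * of_real (x \<bullet> \<xi>)) * h w x))"
    by (simp add: osc_def sum_distrib_left)
  also have "\<dots> = (\<Sum>w\<in>F. osc s (h w) \<xi>)"
    unfolding osc_def by (rule Bochner_Integration.integral_sum) (intro integrable_osc assms)
  finally show ?thesis .
qed

lemma sum_lp_pieces:
  fixes g :: "'i \<Rightarrow> real ^ 'd::finite \<Rightarrow> complex"
  assumes \<phi>0: "lp_generator \<phi>0" and F: "finite F" and K: "compact K"
    and g: "\<And>w. w \<in> F \<Longrightarrow> continuous_on UNIV (g w)" "\<And>w x. w \<in> F \<Longrightarrow> x \<notin> K \<Longrightarrow> g w x = 0"
  shows "(\<Sum>w\<in>F. inv_fourier (\<lambda>\<xi>. dyadic_resolution \<phi>0 j \<xi> * fourier (g w) \<xi>) x) =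
    inv_fourier (\<lambda>\<xi>. dyadic_resolution \<phi>0 j \<xi> * fourier (\<lambda>x. \<Sum>w\<in>F. g w x) \<xi>) x"
proof -
  let ?\<phi> = "dyadic_resolution \<phi>0 j"
  let ?\<kappa> = "complex_of_real ((2 * pi) powr (- real CARD('d) / 2))"
  note \<phi> = dyadic_resolution_continuous_support[OF \<phi>0, where j = j]
  have gi: "integrable lborel (g w)" if "w \<in> F" for w
    by (rule integrable_lborel_continuous_compact_support[OF g(1)[OF that] K g(2)[OF that]])
  have cm: "continuous_on UNIV (\<lambda>\<xi>. ?\<phi> \<xi> * fourier h \<xi>)" "integrable lborel (\<lambda>\<xi>. ?\<phi> \<xi> * fourier h \<xi>)"
    if "integrable lborel h" for h
  proof -
    show "continuous_on UNIV (\<lambda>\<xi>. ?\<phi> \<xi> * fourier h \<xi>)"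
      by (intro continuous_on_mult \<phi>(1) fourier_continuous_bounded(1)[OF that])
    then show "integrable lborel (\<lambda>\<xi>. ?\<phi> \<xi> * fourier h \<xi>)"
      by (rule integrable_lborel_continuous_compact_support[of _ "cball 0 (3 * 2 powr real j)"])
        (use \<phi>(2) in auto)
  qed
  have m: "h \<in> borel_measurable borel" if "integrable lborel h" for h :: "real ^ 'd \<Rightarrow> complex"
    using borel_measurable_integrable[OF that] by simp
  have gs: "integrable lborel (\<lambda>x. \<Sum>w\<in>F. g w x)"
    by (intro Bochner_Integration.integrable_sum gi)
  have fs: "fourier (\<lambda>x. \<Sum>w\<in>F. g w x) \<xi> = (\<Sum>w\<in>F. fourier (g w) \<xi>)" for \<xi>
  proof -
    have "fourier (\<lambda>x. \<Sum>w\<in>F. g w x) \<xi> = (\<Sum>w\<in>F. ?\<kappa> * osc (- \<i>) (g w) \<xi>)"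
      unfolding fourier_eq_osc(1)[OF m[OF gs]] by (simp add: osc_sum gi sum_distrib_left)
    also have "\<dots> = (\<Sum>w\<in>F. fourier (g w) \<xi>)"
      by (intro sum.cong refl) (simp add: fourier_eq_osc(1)[OF m[OF gi]])
    finally show ?thesis .
  qed
  have "inv_fourier (\<lambda>\<xi>. ?\<phi> \<xi> * fourier (\<lambda>x. \<Sum>w\<in>F. g w x) \<xi>) x =
      ?\<kappa> * osc \<i> (\<lambda>\<xi>. \<Sum>w\<in>F. ?\<phi> \<xi> * fourier (g w) \<xi>) x"
    unfolding fourier_eq_osc(2)[OF m[OF cm(2)[OF gs]]] by (simp add: fs sum_distrib_left)
  also have "\<dots> = (\<Sum>w\<in>F. ?\<kappa> * osc \<i> (\<lambda>\<xi>. ?\<phi> \<xi> * fourier (g w) \<xi>) x)"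
    by (subst osc_sum) (simp_all add: cm(2)[OF gi] sum_distrib_left)
  also have "\<dots> = (\<Sum>w\<in>F. inv_fourier (\<lambda>\<xi>. ?\<phi> \<xi> * fourier (g w) \<xi>) x)"
    by (intro sum.cong refl) (simp add: fourier_eq_osc(2)[OF m[OF cm(2)[OF gi]]])
  finally show ?thesis by simp
qed

text \<open>The largest of the summands carries at least the share \<open>1 / N\<close> of the norm
  of the sum. The factor \<open>t\<close> is the weight of the frequency.\<close>

lemma powr_norm_sum_le:
  fixes G :: "'i \<Rightarrow> 'b::real_normed_vector"
  assumes F: "finite F" "real (card F) \<le> N" and N: "0 < N" and \<tau>: "0 < \<tau>" and t: "0 \<le> t"
  shows "ennreal ((t * (norm (\<Sum>w\<in>F. G w) / N)) powr \<tau>) \<le> (\<Sum>w\<in>F. ennreal ((t * norm (G w)) powr \<tau>))"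
proof (cases "F = {}")
  case False
  have "Max ((\<lambda>w. norm (G w)) ` F) \<in> (\<lambda>w. norm (G w)) ` F"
    using F(1) False by (intro Max_in) auto
  then obtain w where w: "w \<in> F" "Max ((\<lambda>w. norm (G w)) ` F) = norm (G w)" by auto
  have le: "norm (G v) \<le> norm (G w)" if "v \<in> F" for v
    unfolding w(2)[symmetric] using F(1) that by (intro Max_ge) auto
  have "norm (\<Sum>w\<in>F. G w) \<le> (\<Sum>w\<in>F. norm (G w))" by (rule norm_sum)
  also have "\<dots> \<le> real (card F) * norm (G w)"
    by (rule sum_bounded_above) (rule le)
  also have "\<dots> \<le> N * norm (G w)"
    using F(2) by (intro mult_right_mono) auto
  finally have "norm (\<Sum>w\<in>F. G w) / N \<le> norm (G w)"
    using N by (simp add: pos_divide_le_eq mult.commute)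
  then have "(t * (norm (\<Sum>w\<in>F. G w) / N)) powr \<tau> \<le> (t * norm (G w)) powr \<tau>"
    using t N \<tau> by (intro powr_mono2 mult_left_mono) auto
  then have "ennreal ((t * (norm (\<Sum>w\<in>F. G w) / N)) powr \<tau>) \<le> ennreal ((t * norm (G w)) powr \<tau>)"
    by (rule ennreal_leI)
  also have "\<dots> \<le> (\<Sum>w\<in>F. ennreal ((t * norm (G w)) powr \<tau>))"
    by (rule member_le_sum[OF w(1)]) (use F(1) in auto)
  finally show ?thesis .
qed simp

text \<open>\<open>size\<close> fixes the constants of \<open>whitney_cube_size\<close>: a cube near
  a bump of scale \<open>r\<close> has side between \<open>r / K\<close> and \<open>B * r\<close>,
  where \<open>B = (C + 1) / cw\<close>. If it were near bumps of two scales, their ratio would be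
  at most \<open>K * B\<close>, against \<open>L_large\<close>. If it were near two bumps of one
  scale, their centres would be within two radii \<open>r / 2\<close> plus the diameter of the
  double cube, against \<open>M_large\<close>.\<close>

locale bump_family_whitney = bump_family D S C M L X c
  for D S :: "(real ^ 'd::finite) set" and C M :: real and L :: nat
    and X :: "nat \<Rightarrow> (real ^ 'd) set" and c :: "nat \<Rightarrow> real" +
  fixes W :: "(nat \<times> (int ^ 'd)) set" and \<phi> :: "nat \<times> (int ^ 'd) \<Rightarrow> real ^ 'd \<Rightarrow> real" and cw K :: real
  assumes whitney: "whitney_decomposition D W" and partition: "whitney_partition D W \<phi>"
    and cw: "0 < cw" and K: "1 \<le> K"
    and size: "\<And>w x r s A. \<lbrakk>w \<in> W; x \<in> double_cube w; 0 < r; r \<le> 1; ball x (r / 2) \<subseteq> D; s \<notin> D; dist x s \<le> A * r\<rbrakk>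
      \<Longrightarrow> cw / 2 ^ fst w \<le> A * r \<and> r \<le> K / 2 ^ fst w"
    and L_large: "K * ((C + 1) / cw) < 2 ^ L"
    and M_large: "1 + 2 * real CARD('d) * ((C + 1) / cw) \<le> M"
begin

abbreviation B :: real where "B \<equiv> (C + 1) / cw"

lemma B_pos: "0 < B" using C cw by simp

text \<open>Double cubes, because these contain the supports of the weights: on the bump all other
  weights vanish.\<close>

definition near_cubes :: "nat \<Rightarrow> real ^ 'd \<Rightarrow> (nat \<times> (int ^ 'd)) set" where
  "near_cubes i y = {w \<in> W. double_cube w \<inter> Q i y \<noteq> {}}"

lemma near_cubes_size:
  assumes "y \<in> X i" "w \<in> near_cubes i y"
  shows "r i / K \<le> 1 / 2 ^ fst w" "1 / 2 ^ fst w \<le> B * r i"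
proof -
  obtain x where x: "w \<in> W" "x \<in> double_cube w" "x \<in> Q i y"
    using assms(2) unfolding near_cubes_def by blast
  obtain s where s: "s \<in> S" "dist x s \<le> (C + 1) * r i"
    using near_Q[OF assms(1) x(3)] by blast
  have "s \<notin> D" using s(1) S_disjoint by blast
  from size[OF x(1,2) rad_pos rad_le_1 ball_Q[OF assms(1) x(3)] this s(2)]
  have "cw / 2 ^ fst w \<le> (C + 1) * r i" "r i \<le> K / 2 ^ fst w" by simp_all
  then show "1 / 2 ^ fst w \<le> B * r i" "r i / K \<le> 1 / 2 ^ fst w"
    using cw K by (simp_all add: field_simps)
qed

lemma near_cubes_unique:
  assumes y: "y \<in> X i" "w \<in> near_cubes i y" and z: "z \<in> X i'" "w \<in> near_cubes i' z"
  shows "i = i'" "y = z"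
proof -
  have no: False if ij: "i < j" "r i / K \<le> 1 / 2 ^ fst w" "1 / 2 ^ fst w \<le> B * r j" for i j
  proof -
    have "2 ^ L * r j \<le> r i" by (rule rad_less[OF ij(1)])
    also have "r i \<le> K * (1 / 2 ^ fst w)"
      using ij(2) K by (simp add: pos_divide_le_eq mult.commute)
    also have "\<dots> \<le> K * (B * r j)"
      using ij(3) K by (intro mult_left_mono) auto
    also have "\<dots> = (K * B) * r j" by simp
    also have "\<dots> < 2 ^ L * r j"
      using L_large rad_pos[of L j] by (intro mult_strict_right_mono)
    finally show False by simp
  qed
  show ii: "i = i'"
  proof (rule ccontr)
    assume "i \<noteq> i'"
    then have "i < i' \<or> i' < i" by linarith
    then show False
      using no[of i i'] no[of i' i] near_cubes_size[OF y] near_cubes_size[OF z] by blast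
  qed
  obtain x x' where x: "x \<in> double_cube w" "x \<in> Q i y" "x' \<in> double_cube w" "x' \<in> Q i' z"
    using y z unfolding near_cubes_def by blast
  have "dist x x' \<le> 2 * real CARD('d) * (1 / 2 ^ fst w)"
    using dist_double_cube_le[OF x(1,3)] by simp
  also have "\<dots> \<le> 2 * real CARD('d) * (B * r i)"
    using near_cubes_size(2)[OF y] by (intro mult_left_mono) auto
  finally have "dist y z \<le> r i / 2 + 2 * real CARD('d) * (B * r i) + r i / 2"
    using x(2,4) ii dist_triangle[of y z x] dist_triangle[of x z x'] by (simp add: dist_commute)
  also have "\<dots> = (1 + 2 * real CARD('d) * B) * r i" by (simp add: algebra_simps)
  also have "\<dots> \<le> M * r i"
    using M_large rad_pos[of L i] by (intro mult_right_mono) auto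
  finally show "y = z"
    using sep_X[of y i z] y(1) z(1) ii by force
qed

definition max_cubes :: real where
  "max_cubes = unit_ball_vol (real CARD('d)) * (K * (1 + 2 * real CARD('d) * B)) ^ CARD('d)"

lemma max_cubes_pos: "0 < max_cubes"
proof -
  have "0 < 1 + 2 * real CARD('d) * B"
    using B_pos by (intro add_pos_nonneg mult_nonneg_nonneg) auto
  then show ?thesis
    unfolding max_cubes_def using K by (intro mult_pos_pos zero_less_power) auto
qed

lemma near_cubes_finite:
  assumes "y \<in> X i"
  shows "finite (near_cubes i y)" "real (card (near_cubes i y)) \<le> max_cubes"
proof -
  have "disjoint_family_on dyadic_cube (near_cubes i y)"
    using whitney unfolding whitney_decomposition_def near_cubes_def
    by (elim conjE) (rule disjoint_family_on_mono[rotated], assumption, blast)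
  moreover have "double_cube w \<inter> cball y (r i) \<noteq> {}" if "w \<in> near_cubes i y" for w
  proof -
    have "Q i y \<subseteq> cball y (r i)"
      using rad_pos[of L i] by (intro subset_cball) simp
    then show ?thesis using that unfolding near_cubes_def by blast
  qed
  ultimately show "finite (near_cubes i y)" "real (card (near_cubes i y)) \<le> max_cubes"
    unfolding max_cubes_def
    using card_cubes_meeting_ball[of "near_cubes i y" "r i" K B y] rad_pos[of L i] K B_pos near_cubes_size[OF assms]
    by simp_all
qed

lemma weight_eq_0:
  assumes "w \<in> W" "x \<notin> double_cube w"
  shows "\<phi> w x = 0"
  using partition assms support_subset[of "\<phi> w"] unfolding whitney_partition_def by blast

text \<open>By \<open>near_cubes_unique\<close> the double cube meets no other bump. The bump sum,
  which is smooth only on \<open>D\<close>, may thus be replaced by one bump, smooth on the whole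
  space and compactly supported, to which the formula for the pieces applies.\<close>

lemma localized_bump_sum:
  assumes y: "y \<in> X i" and w: "w \<in> near_cubes i y"
  shows "localized D (\<phi> w) bump_sum = function_distr (\<lambda>x. of_real (\<phi> w x) * bump i y x)"
proof -
  have "(if x \<in> D then of_real (\<phi> w x) * bump_sum x else 0) = of_real (\<phi> w x) * bump i y x" for x
  proof (cases "x \<in> Q i y")
    case True
    then show ?thesis using Q_subset_D[OF y] bump_sum_eq[OF y True] by auto
  next
    case False
    have "\<phi> w x = 0 \<or> bump_sum x = 0"
    proof (rule disjCI)
      assume "bump_sum x \<noteq> 0"
      then obtain i' z where z: "z \<in> X i'" "x \<in> Q i' z"
        using bump_sum_eq_0[of x] by blast
      have wW: "w \<in> W" using w by (simp add: near_cubes_def)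
      have "x \<notin> double_cube w"
      proof
        assume "x \<in> double_cube w"
        then have "w \<in> near_cubes i' z"
          unfolding near_cubes_def using wW z by blast
        then show False
          using near_cubes_unique[OF y w z(1)] z(2) False by simp
      qed
      then show "\<phi> w x = 0" by (rule weight_eq_0[OF wW])
    qed
    then show ?thesis using bump_eq_0[OF False] by auto
  qed
  then show ?thesis by (simp add: localized_def)
qed

lemma sum_weights_bump:
  assumes y: "y \<in> X i"
  shows "(\<Sum>w\<in>near_cubes i y. of_real (\<phi> w x) * bump i y x) = bump i y x"
proof (cases "x \<in> Q i y")
  case True
  then have "x \<in> D" using Q_subset_D[OF y] by blast
  then have "((\<lambda>w. \<phi> w x) has_sum 1) W"
    using partition unfolding whitney_partition_def by blast
  moreover have "\<phi> w x = 0" if "w \<in> W - near_cubes i y" for w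
    using that True weight_eq_0[of w x] unfolding near_cubes_def by blast
  \<comment> \<open>The possibly infinite partition of unity reduces to a finite sum at
    \<open>x\<close>, as the weights of the other cubes vanish there.\<close>
  ultimately have "((\<lambda>w. \<phi> w x) has_sum 1) (near_cubes i y)"
    by (subst has_sum_cong_neutral[where T = W and g = "\<lambda>w. \<phi> w x"]) (auto simp: near_cubes_def)
  then have "(\<Sum>w\<in>near_cubes i y. \<phi> w x) = 1"
    using has_sum_finite[OF near_cubes_finite(1)[OF y]] has_sum_unique by blast
  then have "(\<Sum>w\<in>near_cubes i y. complex_of_real (\<phi> w x)) = 1"
    by (metis of_real_1 of_real_sum)
  then show ?thesis by (simp flip: sum_distrib_right)
qed (simp add: bump_eq_0)

text \<open>By linearity the pieces \<open>G w\<close> of the localized functions add up to the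
  piece of the bump, a translate and dilate of \<open>scaled_piece\<close>. Pigeonhole bounds their
  powers from below, and the change of variables supplies the factor \<open>r i ^ d\<close>. The
  frequency index moves with the scale, so that the same \<open>scaled_piece\<close> appears for
  every \<open>i\<close>.\<close>

lemma sum_tl_norms_ge:
  assumes \<phi>0: "lp_generator \<phi>0" and \<tau>: "0 < \<tau>" and y: "y \<in> X i" and J: "J \<le> L"
    and \<kappa>: "0 < \<kappa>" "ennreal \<kappa> \<le> (\<integral>\<^sup>+x. ennreal (norm (scaled_piece \<phi>0 J x) powr \<tau>) \<partial>lborel)"
  shows "ennreal (\<kappa> * (2 powr ((1 - real J) * real m) / max_cubes) powr \<tau> *
      (c i powr \<tau> * r i powr (real CARD('d) - real m * \<tau>))) \<le>
    (\<Sum>w\<in>near_cubes i y. epowr (tl_norm \<phi>0 (real m) \<tau> 2 (localized D (\<phi> w) bump_sum)) \<tau>)"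
proof -
  let ?F = "near_cubes i y"
  let ?d = "CARD('d)"
  define k where "k = L * (i + 1)"
  define j where "j = k + 1 - J"
  have Jk: "J \<le> k"
    unfolding k_def using J by (simp add: trans_le_add1)
  have ri: "r i = (1 / 2) ^ k" by (simp add: rad_def k_def)
  define g where "g w x = complex_of_real (\<phi> w x) * bump i y x" for w x
  define G where "G w = lp_piece \<phi>0 j (localized D (\<phi> w) bump_sum)" for w
  define t where "t = 2 powr (real j * real m)"
  have gc: "continuous_on UNIV (g w)" if "w \<in> ?F" for w
  proof -
    have "smooth_on UNIV (\<phi> w)"
      using partition that unfolding whitney_partition_def near_cubes_def by blast
    from smooth_on_continuous[OF this, of "[]"] have "continuous_on UNIV (\<phi> w)" by simp
    moreover have "continuous_on UNIV (bump i y)"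
      using smooth_on_continuous[OF smooth_on_bump, of "[]"] by simp
    ultimately show ?thesis
      unfolding g_def by (intro continuous_on_mult continuous_on_of_real)
  qed
  have gz: "g w x = 0" if "x \<notin> Q i y" for w x
    using bump_eq_0[OF that] by (simp add: g_def)
  have G: "G w = inv_fourier (\<lambda>\<xi>. dyadic_resolution \<phi>0 j \<xi> * fourier (g w) \<xi>)" "continuous_on UNIV (G w)"
    if w: "w \<in> ?F" for w
  proof -
    show Gw: "G w = inv_fourier (\<lambda>\<xi>. dyadic_resolution \<phi>0 j \<xi> * fourier (g w) \<xi>)"
      unfolding G_def localized_bump_sum[OF y w] g_def[symmetric]
      by (rule lp_piece_function_distr(1)[OF \<phi>0 gc[OF w] compact_cball gz])
    show "continuous_on UNIV (G w)"
      unfolding Gw by (rule lp_piece_function_distr(2)[OF \<phi>0 gc[OF w] compact_cball gz])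
  qed
  have sumG: "(\<Sum>w\<in>?F. G w x) = of_real (c i) * scaled_piece \<phi>0 J ((1 / r i) *\<^sub>R (x - y))" for x
  proof -
    have "(\<Sum>w\<in>?F. G w x) = (\<Sum>w\<in>?F. inv_fourier (\<lambda>\<xi>. dyadic_resolution \<phi>0 j \<xi> * fourier (g w) \<xi>) x)"
      by (intro sum.cong refl) (simp add: G(1))
    also have "\<dots> = inv_fourier (\<lambda>\<xi>. dyadic_resolution \<phi>0 j \<xi> * fourier (\<lambda>x. \<Sum>w\<in>?F. g w x) \<xi>) x"
      by (rule sum_lp_pieces[OF \<phi>0 near_cubes_finite(1)[OF y] compact_cball gc gz])
    also have "(\<lambda>x. \<Sum>w\<in>?F. g w x) = (\<lambda>x. of_real (c i) * cbump ((1 / r i) *\<^sub>R (x - y)))"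
      unfolding g_def sum_weights_bump[OF y] by (simp add: fun_eq_iff bump_def)
    also have "inv_fourier (\<lambda>\<xi>. dyadic_resolution \<phi>0 j \<xi> * fourier (\<lambda>x. of_real (c i) * cbump ((1 / r i) *\<^sub>R (x - y))) \<xi>) x =
        of_real (c i) * scaled_piece \<phi>0 J ((1 / r i) *\<^sub>R (x - y))"
      unfolding j_def by (rule lp_piece_rescaled_bump[OF \<phi>0 ri Jk])
    finally show ?thesis .
  qed
  have [measurable]: "G w \<in> borel_measurable borel" if "w \<in> ?F" for w
    using G(2)[OF that] by (rule borel_measurable_continuous_onI)
  have [measurable]: "scaled_piece \<phi>0 J \<in> borel_measurable borel"
    using scaled_multiplier(4)[OF \<phi>0] by (rule borel_measurable_continuous_onI)
  \<comment> \<open>Here the order of smoothness turns into the weight: \<open>2 powr j\<close> is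
    \<open>1 / r i\<close> up to a constant depending on \<open>J\<close>, so the frequency factor
    plays the part of \<open>\<rho> powr (- m)\<close>.\<close>
  have tm: "2 powr (real j * real m) = 2 powr ((1 - real J) * real m) * r i powr (- real m)"
  proof -
    have "r i powr (- real m) = (2 powr (- real k)) powr (- real m)"
      by (simp add: ri powr_minus powr_realpow power_one_over inverse_eq_divide)
    also have "\<dots> = 2 powr (real k * real m)"
      by (simp add: powr_powr)
    finally have "2 powr ((1 - real J) * real m) * r i powr (- real m) = 2 powr ((1 - real J) * real m + real k * real m)"
      by (simp add: powr_add)
    moreover have "real j = (1 - real J) + real k"
      using Jk by (simp add: j_def of_nat_diff)
    ultimately show ?thesis by (simp only: distrib_right)
  qed
  \<comment> \<open>The height of the bump times the frequency factor, reduced to the share left by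
    pigeonhole.\<close>
  define q where "q = t * c i / max_cubes"
  have q: "0 < q" using c_pos[of i] max_cubes_pos by (simp add: q_def t_def)
  have qr: "\<kappa> * (2 powr ((1 - real J) * real m) / max_cubes) powr \<tau> *
      (c i powr \<tau> * r i powr (real ?d - real m * \<tau>)) = r i ^ ?d * (q powr \<tau> * \<kappa>)"
  proof -
    have "q = (2 powr ((1 - real J) * real m) / max_cubes) * c i * r i powr (- real m)"
      by (simp add: q_def t_def tm)
    then have "q powr \<tau> = (2 powr ((1 - real J) * real m) / max_cubes) powr \<tau> * c i powr \<tau> * r i powr (- real m * \<tau>)"
      using max_cubes_pos c_pos[of i] by (simp only: powr_mult powr_powr)
    moreover have "r i powr (real ?d - real m * \<tau>) = r i ^ ?d * r i powr (- real m * \<tau>)"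
    proof -
      have "real ?d - real m * \<tau> = real ?d + - real m * \<tau>" by simp
      then show ?thesis using rad_pos[of L i] by (simp only: powr_add powr_realpow)
    qed
    ultimately show ?thesis by (simp only: mult_ac)
  qed
  let ?h = "\<lambda>x. ennreal ((q * norm (scaled_piece \<phi>0 J ((1 / r i) *\<^sub>R (x - y)))) powr \<tau>)"
  have cs: "continuous_on UNIV (\<lambda>x. scaled_piece \<phi>0 J ((1 / r i) *\<^sub>R (x - y)))"
    by (rule continuous_on_compose2[OF scaled_multiplier(4)[OF \<phi>0]]) (auto intro!: continuous_intros)
  have [measurable]: "(\<lambda>x. scaled_piece \<phi>0 J ((1 / r i) *\<^sub>R (x - y))) \<in> borel_measurable borel"
    by (rule borel_measurable_continuous_onI[OF cs])
  have "ennreal (r i ^ ?d * (q powr \<tau> * \<kappa>)) = ennreal (r i ^ ?d) * (ennreal (q powr \<tau>) * ennreal \<kappa>)"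
    using rad_pos[of L i] \<kappa>(1) by (simp add: ennreal_mult less_imp_le)
  also have "\<dots> \<le> ennreal (r i ^ ?d) * (ennreal (q powr \<tau>) * (\<integral>\<^sup>+x. ennreal (norm (scaled_piece \<phi>0 J x) powr \<tau>) \<partial>lborel))"
    by (intro mult_left_mono \<kappa>(2)) auto
  also have "ennreal (q powr \<tau>) * (\<integral>\<^sup>+x. ennreal (norm (scaled_piece \<phi>0 J x) powr \<tau>) \<partial>lborel) =
      (\<integral>\<^sup>+x. ennreal (q powr \<tau>) * ennreal (norm (scaled_piece \<phi>0 J x) powr \<tau>) \<partial>lborel)"
    by (rule nn_integral_cmult[symmetric]) measurable
  also have "\<dots> = (\<integral>\<^sup>+x. ?h (y + r i *\<^sub>R x) \<partial>lborel)"
    using rad_pos[of L i] q by (intro nn_integral_cong) (simp add: powr_mult ennreal_mult less_imp_le)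
  also have "ennreal (r i ^ ?d) * (\<integral>\<^sup>+x. ?h (y + r i *\<^sub>R x) \<partial>lborel) = (\<integral>\<^sup>+x. ?h x \<partial>lborel)"
    using nn_integral_lborel_affine[of ?h "r i" y] rad_pos[of L i] by simp
  also have "\<dots> \<le> (\<integral>\<^sup>+x. (\<Sum>w\<in>?F. ennreal ((t * norm (G w x)) powr \<tau>)) \<partial>lborel)"
  proof (rule nn_integral_mono)
    fix x
    have "q * norm (scaled_piece \<phi>0 J ((1 / r i) *\<^sub>R (x - y))) = t * (norm (\<Sum>w\<in>?F. G w x) / max_cubes)"
      unfolding sumG using c_pos[of i] by (simp add: q_def norm_mult)
    then show "?h x \<le> (\<Sum>w\<in>?F. ennreal ((t * norm (G w x)) powr \<tau>))"
      using powr_norm_sum_le[OF near_cubes_finite[OF y] max_cubes_pos \<tau>, of t "\<lambda>w. G w x"]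
      by (simp add: t_def)
  qed
  also have "\<dots> = (\<Sum>w\<in>?F. \<integral>\<^sup>+x. ennreal ((t * norm (G w x)) powr \<tau>) \<partial>lborel)"
    by (rule nn_integral_sum) measurable
  also have "\<dots> \<le> (\<Sum>w\<in>?F. epowr (tl_norm \<phi>0 (real m) \<tau> 2 (localized D (\<phi> w) bump_sum)) \<tau>)"
  proof (rule sum_mono)
    fix w assume w: "w \<in> ?F"
    have "(\<integral>\<^sup>+x. ennreal ((t * norm (G w x)) powr \<tau>) \<partial>lborel) = (\<integral>\<^sup>+x. ennreal ((t * norm (G w x)) powr \<tau>) \<partial>lebesgue)"
      by (rule nn_integral_completion[symmetric])
    then show "(\<integral>\<^sup>+x. ennreal ((t * norm (G w x)) powr \<tau>) \<partial>lborel) \<le>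
        epowr (tl_norm \<phi>0 (real m) \<tau> 2 (localized D (\<phi> w) bump_sum)) \<tau>"
      using nn_integral_lp_piece_le_tl_norm[OF \<tau>, of j "real m" \<phi>0 "localized D (\<phi> w) bump_sum"]
      by (simp add: t_def G_def)
  qed
  finally show ?thesis unfolding qr .
qed

lemma rloc_norm_bump_sum_infinite:
  assumes \<phi>0: "lp_generator \<phi>0" and \<tau>: "0 < \<tau>" and J: "J \<le> L"
    and \<kappa>: "0 < \<kappa>" "ennreal \<kappa> \<le> (\<integral>\<^sup>+x. ennreal (norm (scaled_piece \<phi>0 J x) powr \<tau>) \<partial>lborel)"
    and div: "\<not> summable (\<lambda>i. real (card (X i)) * c i powr \<tau> * r i powr (real CARD('d) - real m * \<tau>))"
  shows "rloc_norm \<phi>0 D W \<phi> (real m) \<tau> 2 bump_sum = \<infinity>"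
proof -
  define a where "a w = epowr (tl_norm \<phi>0 (real m) \<tau> 2 (localized D (\<phi> w) bump_sum)) \<tau>" for w
  define \<mu> where "\<mu> = \<kappa> * (2 powr ((1 - real J) * real m) / max_cubes) powr \<tau>"
  have \<mu>: "0 < \<mu>" using \<kappa>(1) max_cubes_pos by (simp add: \<mu>_def)
  let ?f = "\<lambda>i. real (card (X i)) * c i powr \<tau> * r i powr (real CARD('d) - real m * \<tau>)"
  have "(\<Sum>i<n. ennreal (\<mu> * ?f i)) \<le> infsum a W" for n
  proof -
    \<comment> \<open>Finitely many bumps are treated at a time. Their families of cubes are
      disjoint by \<open>near_cubes_unique\<close>, so the norms add up to a finite partial sum over
      \<open>W\<close>.\<close>
    define I where "I = Sigma {..<n} X"
    have fI: "finite I" unfolding I_def by (intro finite_SigmaI finite_X) simp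
    have "(\<Sum>i<n. ennreal (\<mu> * ?f i)) \<le> (\<Sum>i<n. \<Sum>y\<in>X i. sum a (near_cubes i y))"
    proof (rule sum_mono)
      fix i
      have "ennreal (\<mu> * ?f i) = of_nat (card (X i)) * ennreal (\<mu> * (c i powr \<tau> * r i powr (real CARD('d) - real m * \<tau>)))"
        using \<mu> by (simp add: ennreal_of_nat_eq_real_of_nat mult_ac flip: ennreal_mult)
      also have "\<dots> = (\<Sum>y\<in>X i. ennreal (\<mu> * (c i powr \<tau> * r i powr (real CARD('d) - real m * \<tau>))))"
        by simp
      also have "\<dots> \<le> (\<Sum>y\<in>X i. sum a (near_cubes i y))"
        unfolding a_def \<mu>_def by (intro sum_mono sum_tl_norms_ge \<phi>0 \<tau> J \<kappa>)
      finally show "ennreal (\<mu> * ?f i) \<le> (\<Sum>y\<in>X i. sum a (near_cubes i y))" .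
    qed
    also have "\<dots> = (\<Sum>(i, y)\<in>I. sum a (near_cubes i y))"
      unfolding I_def by (intro sum.Sigma) (auto simp: finite_X)
    also have "\<dots> = (\<Sum>z\<in>I. sum a (near_cubes (fst z) (snd z)))"
      by (simp add: case_prod_beta)
    also have "\<dots> = sum a (\<Union>z\<in>I. near_cubes (fst z) (snd z))"
    proof (rule sum.UNION_disjoint[symmetric, OF fI])
      show "\<forall>z\<in>I. finite (near_cubes (fst z) (snd z))"
        by (auto simp: I_def intro: near_cubes_finite)
      show "\<forall>z\<in>I. \<forall>z'\<in>I. z \<noteq> z' \<longrightarrow> near_cubes (fst z) (snd z) \<inter> near_cubes (fst z') (snd z') = {}"
      proof (intro ballI impI)
        fix z z' assume z: "z \<in> I" "z' \<in> I" "z \<noteq> z'"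
        then have X: "snd z \<in> X (fst z)" "snd z' \<in> X (fst z')" by (auto simp: I_def)
        show "near_cubes (fst z) (snd z) \<inter> near_cubes (fst z') (snd z') = {}"
        proof (rule ccontr)
          assume "near_cubes (fst z) (snd z) \<inter> near_cubes (fst z') (snd z') \<noteq> {}"
          then obtain w where "w \<in> near_cubes (fst z) (snd z)" "w \<in> near_cubes (fst z') (snd z')" by blast
          then have "fst z = fst z'" "snd z = snd z'"
            using near_cubes_unique[OF X(1) _ X(2)] by blast+
          then show False using z(3) by (simp add: prod_eq_iff)
        qed
      qed
    qed
    also have "\<dots> \<le> infsum a W"
    proof -
      have "finite (\<Union>z\<in>I. near_cubes (fst z) (snd z))"
        using fI by (intro finite_UN_I) (auto simp: I_def intro: near_cubes_finite)
      moreover have "(\<Union>z\<in>I. near_cubes (fst z) (snd z)) \<subseteq> W"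
        by (auto simp: near_cubes_def)
      ultimately show ?thesis
        by (subst nonneg_infsum_complete) (auto intro!: SUP_upper)
    qed
    finally show ?thesis .
  qed
  then have "(\<Sum>i. ennreal (\<mu> * ?f i)) \<le> infsum a W"
    by (intro suminf_le_const) auto
  moreover have "(\<Sum>i. ennreal (\<mu> * ?f i)) = top"
  proof (rule ccontr)
    assume "\<not> ?thesis"
    then have "summable (\<lambda>i. \<mu> * ?f i)"
      using \<mu> by (intro summable_suminf_not_top) (auto simp: mult_nonneg_nonneg less_imp_le)
    from summable_mult_D[OF this less_imp_neq[OF \<mu>, symmetric]] div show False by blast
  qed
  ultimately have "infsum a W = top" by (simp add: top_unique)
  then show ?thesis
    unfolding rloc_norm_def a_def[symmetric] by (simp add: epowr_def)
qed

end

theorem proposition4p1: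
  fixes D S :: "(real ^ 'd::finite) set"
    and \<rho> :: "real ^ 'd \<Rightarrow> real"
    and m \<delta> :: nat
    and a p \<tau> :: real
  assumes "1 \<le> m" and "1 < p" and "0 < \<tau>" and "\<tau> < p"
    and "admissible_domain D S \<delta>"
    and "regularized_distance D S \<rho>"
    and "(real m - a = (real CARD('d) - real \<delta>) * (1 / \<tau> - 1 / p) \<and> a < real m) \<or>
         real m - a > (real CARD('d) - real \<delta>) * (1 / \<tau> - 1 / p)"
  shows "(\<exists>u \<in> kondratiev_space D \<rho> m a p.
            Lp_norm D \<tau> (\<lambda>x. ennreal (norm (\<rho> x powr (- real m) *\<^sub>R u x))) = \<infinity>) \<and>
         (\<forall>\<phi>0 W \<phi>.
            lp_generator \<phi>0 \<longrightarrow> whitney_decomposition D W \<longrightarrow> whitney_partition D W \<phi> \<longrightarrow>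
            tl_sigma TYPE('d) \<tau> 2 < real m \<longrightarrow>
            \<not> continuously_embedded
                (kondratiev_space D \<rho> m a p) (kondratiev_norm D \<rho> m a p)
                (rloc_space \<phi>0 D W \<phi> (real m) \<tau> 2) (rloc_norm \<phi>0 D W \<phi> (real m) \<tau> 2))"
proof -
  note D = admissible_domain_bump_room[OF assms(5)]
  have p: "0 < p" using assms(2) by simp
  have crit: "(real CARD('d) - real \<delta>) * (1 / \<tau> - 1 / p) \<le> real m - a"
    using assms(7) by linarith
  from bump_family_exists[OF D p assms(3,4) crit]
  obtain C where C: "C > 0" and ex: "\<forall>M\<ge>1. \<forall>L0. \<exists>L\<ge>L0. \<exists>X c. bump_family D S C M L X c \<and>
    summable (\<lambda>i. real (card (X i)) * c i powr p * rad L i powr (real CARD('d) - a * p)) \<and>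
    \<not> summable (\<lambda>i. real (card (X i)) * c i powr \<tau> * rad L i powr (real CARD('d) - real m * \<tau>))"
    by (elim exE conjE)
  note family = ex[THEN spec, THEN mp, THEN spec]
  show ?thesis
  proof (intro conjI allI impI)
    \<comment> \<open>No Whitney cubes occur in the first assertion, so the least separation and any
      gap will do.\<close>
    from family[OF order_refl, of 0] obtain L X c where bf: "bump_family D S C 1 L X c"
      and sums: "summable (\<lambda>i. real (card (X i)) * c i powr p * rad L i powr (real CARD('d) - a * p))"
        "\<not> summable (\<lambda>i. real (card (X i)) * c i powr \<tau> * rad L i powr (real CARD('d) - real m * \<tau>))"
      by (elim exE conjE)
    interpret bump_family D S C 1 L X c by (rule bf)
    show "\<exists>u \<in> kondratiev_space D \<rho> m a p. Lp_norm D \<tau> (\<lambda>x. ennreal (norm (\<rho> x powr (- real m) *\<^sub>R u x))) = \<infinity>"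
      using bump_sum_in_kondratiev_space[OF assms(6,2) sums(1)] Lp_norm_bump_sum_infinite[OF assms(6,3) sums(2)]
      by blast
  next
    fix \<phi>0 :: "real ^ 'd \<Rightarrow> complex" and W \<phi>
    assume \<phi>0: "lp_generator \<phi>0" and W: "whitney_decomposition D W" and \<phi>: "whitney_partition D W \<phi>"
    obtain J \<kappa> where \<kappa>: "0 < \<kappa>" "ennreal \<kappa> \<le> (\<integral>\<^sup>+x. ennreal (norm (scaled_piece \<phi>0 J x) powr \<tau>) \<partial>lborel)"
      using nn_integral_scaled_piece_pos[OF \<phi>0, of \<tau>] by blast
    obtain cw K where K: "0 < cw" "1 \<le> K" and size: "\<forall>w\<in>W. \<forall>x\<in>double_cube w. \<forall>r s A.
        0 < r \<and> r \<le> 1 \<and> ball x (r / 2) \<subseteq> D \<and> s \<notin> D \<and> dist x s \<le> A * r \<longrightarrow>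
        cw / 2 ^ fst w \<le> A * r \<and> r \<le> K / 2 ^ fst w"
      using whitney_cube_size[OF W] by (elim exE conjE)
    \<comment> \<open>All that \<open>M\<close> and \<open>L\<close> depend on is fixed by now:
      \<open>C\<close> by the domain, \<open>cw\<close> and \<open>K\<close> by the Whitney
      decomposition, \<open>J\<close> by \<open>\<phi>0\<close> and \<open>\<tau>\<close>.\<close>
    obtain L1 :: nat where L1: "K * ((C + 1) / cw) < 2 ^ L1"
      using real_arch_pow[of 2 "K * ((C + 1) / cw)"] by auto
    define M where "M = 1 + 2 * real CARD('d) * ((C + 1) / cw)"
    have M: "1 \<le> M" using C K(1) by (simp add: M_def)
    \<comment> \<open>\<open>J \<le> L\<close> keeps the frequency index
      \<open>L * (i + 1) + 1 - J\<close> positive at every scale, including the coarsest.\<close>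
    from family[OF M, of "max L1 J"] obtain L X c where LJ: "max L1 J \<le> L" and bf: "bump_family D S C M L X c"
      and sums: "summable (\<lambda>i. real (card (X i)) * c i powr p * rad L i powr (real CARD('d) - a * p))"
        "\<not> summable (\<lambda>i. real (card (X i)) * c i powr \<tau> * rad L i powr (real CARD('d) - real m * \<tau>))"
      by (elim exE conjE)
    interpret bump_family D S C M L X c by (rule bf)
    have "bump_family_whitney D S C M L X c W \<phi> cw K"
    proof
      have "(2 :: real) ^ L1 \<le> 2 ^ L"
        using LJ by (intro power_increasing) auto
      then show "K * ((C + 1) / cw) < 2 ^ L" using L1 by linarith
      show "1 + 2 * real CARD('d) * ((C + 1) / cw) \<le> M" by (simp add: M_def)
    qed (use W \<phi> K size in blast)+
    then interpret bump_family_whitney D S C M L X c W \<phi> cw K .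
    have "J \<le> L" using LJ by simp
    then have "rloc_norm \<phi>0 D W \<phi> (real m) \<tau> 2 bump_sum = \<infinity>"
      by (rule rloc_norm_bump_sum_infinite[OF \<phi>0 assms(3) _ \<kappa> sums(2)])
    \<comment> \<open>Already the inclusion of the spaces fails, for every choice of the weights and
      of \<open>\<phi>0\<close>.\<close>
    then have "bump_sum \<notin> rloc_space \<phi>0 D W \<phi> (real m) \<tau> 2"
      by (simp add: rloc_space_def)
    then show "\<not> continuously_embedded
        (kondratiev_space D \<rho> m a p) (kondratiev_norm D \<rho> m a p)
        (rloc_space \<phi>0 D W \<phi> (real m) \<tau> 2) (rloc_norm \<phi>0 D W \<phi> (real m) \<tau> 2)"
      using bump_sum_in_kondratiev_space[OF assms(6,2) sums(1), of m]
      unfolding continuously_embedded_def by blast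
  qed
qed

end
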